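(* Let $d\ge2$. For any finite squarefree strongly stable $d$-uniform hypergraph $K\subset\binom{\mathbb P}{d}$ or any finite strongly stable collection $M\subset\binom{\mathbb P+d-1}{d}$, all of the ideals $I(K),I(F(K)),I(M),I(F(M))$ obey the colex lower bound.
   Context: $\mathbb P=\{1,2,\dots\}$; $\binom{\mathbb P}{d}$ is the set of $d$-subsets $\{i_1<\dots<i_d\}$ and $\binom{\mathbb P+d-1}{d}$ the set of $d$-element multisets, i.e. sequences $(i_1\le\dots\le i_d)$ in $\mathbb P$. The Gale partial order on either set is componentwise: $(i_1,\dots,i_d)\le(i_1',\dots,i_d')$ iff $i_j\le i_j'$ for all $j$ (entries listed increasingly). $K$ is squarefree strongly stable, resp. $M$ is strongly stable, if it is an order ideal (down-set) in the Gale order. Let $k$ be a field. $I(K)$ (resp. $I(M)$) is the ideal of a polynomial ring $k[x_1,\dots,x_N]$ ($N$ large enough) generated by $x_{i_1}\cdots x_{i_d}$ for $(i_1,\dots,i_d)\in K$ (resp. $M$). $I(F(K))$ (resp. $I(F(M))$) is the ideal, in a polynomial ring over $k$ on $d$ disjoint sets of variables $\{x^{(j)}_i\}_i$, $j=1,\dots,d$, generated by $x^{(1)}_{i_1}x^{(2)}_{i_2}\cdots x^{(d)}_{i_d}$ for $(i_1,\dots,i_d)\in K$ (resp. $M$), entries listed increasingly. Colexicographic order on $\binom{\mathbb P}{d}$: for $S=\{i_1<\dots<i_d\}$, $S'=\{i_1'<\dots<i_d'\}$, $S<_{colex}S'$ if $i_m<i_m'$ for some $m$ and $i_j=i_j'$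 for all $j>m$. A colexsegment-generated ideal is $J=(x_{i_1}\cdots x_{i_d}:\{i_1,\dots,i_d\}\in C)$ with $C\subset\binom{\mathbb P}{d}$ a finite initial segment of the colex order. $\beta_i(I)=\dim_k\mathrm{Tor}_i^S(I,k)$ are total Betti numbers over the ambient polynomial ring $S$. A monomial ideal $I$ generated in degree $d$ obeys the colex lower bound if $\beta_i(I)\ge\beta_i(J)$ for all $i$, where $J$ is the unique colexsegment-generated squarefree monomial ideal generated in degree $d$ having the same number of minimal generators as $I$. *)

theory Defs
  imports "HOL-Library.Poly_Mapping" "HOL-Library.Multiset" "HOL-Algebra.Ideal"
    "Jordan_Normal_Form.VS_Connect"
begin

section \<open>Polynomial rings and monomial ideals\<close>

text \<open>Polynomials over \<open>'k\<close> in variables from the type \<open>'v\<close>: finitely supported maps from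
  exponent vectors to coefficients, with the convolution product of \<open>Poly_Mapping\<close>.\<close>

type_synonym ('v, 'k) mpoly = "('v \<Rightarrow>\<^sub>0 nat) \<Rightarrow>\<^sub>0 'k"

definition pmonom :: "('v \<Rightarrow>\<^sub>0 nat) \<Rightarrow> ('v, 'k::field) mpoly" where
  "pmonom m = Poly_Mapping.single m 1"

definition pvar :: "'v \<Rightarrow> ('v, 'k::field) mpoly" where
  "pvar v = pmonom (Poly_Mapping.single v 1)"

definition polys :: "'v set \<Rightarrow> ('v, 'k::field) mpoly set" where
  "polys V = {p. \<forall>m \<in> Poly_Mapping.keys p. Poly_Mapping.keys m \<subseteq> V}"

text \<open>The polynomial ring \<open>k[x\<^sub>v : v \<in> V]\<close>.  The ambient ring of an ideal matters, since it is the
  ring over which resolutions are formed, so it is always an explicit parameter.\<close>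

definition poly_ring :: "'v set \<Rightarrow> ('v, 'k::field) mpoly ring" where
  "poly_ring V = \<lparr> carrier = polys V, mult = (*), one = 1, zero = 0, add = (+) \<rparr>"

text \<open>The minimal monomial generators of a monomial ideal (given by their exponent vectors): the
  monomials in the ideal that are minimal with respect to divisibility.\<close>

definition min_gens :: "('v, 'k::field) mpoly set \<Rightarrow> ('v \<Rightarrow>\<^sub>0 nat) set" where
  "min_gens I = {m. pmonom m \<in> I \<and>
     (\<forall>t. pmonom t \<in> I \<and> (\<forall>v. Poly_Mapping.lookup t v \<le> Poly_Mapping.lookup m v) \<longrightarrow> t = m)}"


section \<open>Betti numbers\<close>

definition free_mod :: "'v set \<Rightarrow> nat \<Rightarrow> ('v, 'k::field) mpoly vec set" where
  "free_mod V n = {v \<in> carrier_vec n. \<forall>i<n. v $ i \<in> polys V}"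

text \<open>A free resolution \<open>\<dots> \<rightarrow> S\<^bsup>n\<^sub>2\<^esup> \<rightarrow> S\<^bsup>n\<^sub>1\<^esup> \<rightarrow> S\<^bsup>n\<^sub>0\<^esup> \<rightarrow> I \<rightarrow> 0\<close> of an ideal \<open>I\<close> of
  \<open>S = k[x\<^sub>v : v \<in> V]\<close> by free modules of finite rank, given by its matrices: \<open>n\<^sub>i\<close> is the
  number of columns of \<open>D i\<close>, the one-row matrix \<open>D 0\<close> is the augmentation onto \<open>I\<close>, and
  \<open>D (i + 1)\<close> is the differential from homological degree \<open>i + 1\<close> to \<open>i\<close>.\<close>

definition free_resolution ::
  "'v set \<Rightarrow> ('v, 'k::field) mpoly set \<Rightarrow> (nat \<Rightarrow> ('v, 'k) mpoly mat) \<Rightarrow> bool" where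
  "free_resolution V I D \<longleftrightarrow>
     dim_row (D 0) = 1 \<and> (\<forall>i. dim_row (D (Suc i)) = dim_col (D i)) \<and>
     (\<forall>i. elements_mat (D i) \<subseteq> polys V) \<and>
     {(D 0 *\<^sub>v v) $ 0 | v. v \<in> free_mod V (dim_col (D 0))} = I \<and>
     (\<forall>i. {v \<in> free_mod V (dim_col (D i)). D i *\<^sub>v v = 0\<^sub>v (dim_row (D i))} =
          {D (Suc i) *\<^sub>v w | w. w \<in> free_mod V (dim_col (D (Suc i)))})"

text \<open>\<open>k\<close> is the \<open>S\<close>-module on which every variable acts as zero.  Hence tensoring with \<open>k\<close>
  turns \<open>S\<^bsup>n\<^esup>\<close> into \<open>k\<^bsup>n\<^esup>\<close> and replaces each matrix entry by its constant term.\<close>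

definition tensor_k :: "('v, 'k::field) mpoly mat \<Rightarrow> 'k mat" where
  "tensor_k A = map_mat (\<lambda>p. Poly_Mapping.lookup p 0) A"

text \<open>The augmentation is not part of the complex whose homology is Tor, so in degree \<open>0\<close>
  every element is a cycle.\<close>

fun tor_cycles :: "(nat \<Rightarrow> ('v, 'k::field) mpoly mat) \<Rightarrow> nat \<Rightarrow> 'k vec set" where
  "tor_cycles D 0 = carrier_vec (dim_col (D 0))"
| "tor_cycles D (Suc i) =
     {v \<in> carrier_vec (dim_col (D (Suc i))). tensor_k (D (Suc i)) *\<^sub>v v = 0\<^sub>v (dim_col (D i))}"

definition tor_boundaries :: "(nat \<Rightarrow> ('v, 'k::field) mpoly mat) \<Rightarrow> nat \<Rightarrow> 'k vec set" where
  "tor_boundaries D i = {tensor_k (D (Suc i)) *\<^sub>v w | w. w \<in> carrier_vec (dim_col (D (Suc i)))}"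

text \<open>The quotient \<open>Z / B\<close> of subspaces \<open>B \<subseteq> Z\<close> of \<open>k\<^bsup>n\<^esup>\<close>.  The fields \<open>mult\<close> and \<open>one\<close> of the
  record are irrelevant for modules.\<close>

definition quot_space :: "nat \<Rightarrow> 'k::field vec set \<Rightarrow> 'k vec set \<Rightarrow> ('k, 'k vec set) module" where
  "quot_space n Z B =
     \<lparr> carrier = {a_r_coset (module_vec TYPE('k) n) B z | z. z \<in> Z},
       mult = undefined, one = undefined,
       zero = B,
       add = set_add (module_vec TYPE('k) n),
       smult = (\<lambda>c X. \<Union>x\<in>X. a_r_coset (module_vec TYPE('k) n) B (c \<cdot>\<^sub>v x)) \<rparr>"

definition tor_space :: "(nat \<Rightarrow> ('v, 'k::field) mpoly mat) \<Rightarrow> nat \<Rightarrow> ('k, 'k vec set) module" where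
  "tor_space D i = quot_space (dim_col (D i)) (tor_cycles D i) (tor_boundaries D i)"

text \<open>\<open>\<beta>\<^sub>i(I)\<close>, the dimension of the \<open>i\<close>-th Tor of \<open>I\<close> (not of \<open>S/I\<close>) and \<open>k\<close> over
  \<open>S = k[x\<^sub>v : v \<in> V]\<close>.  For finite \<open>V\<close> the ring is Noetherian, so resolutions by free modules
  of finite rank exist, and the dimension is the same for all of them.\<close>

definition betti :: "'v set \<Rightarrow> ('v, 'k::field) mpoly set \<Rightarrow> nat \<Rightarrow> nat" where
  "betti V I i = vectorspace.dim class_ring (tor_space (SOME D. free_resolution V I D) i)"


section \<open>Stable collections and their ideals\<close>

definition dsubsets :: "nat \<Rightarrow> nat set set" where
  "dsubsets d = {S. S \<subseteq> {1..} \<and> finite S \<and> card S = d}"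

definition dmultisets :: "nat \<Rightarrow> nat multiset set" where
  "dmultisets d = {A. set_mset A \<subseteq> {1..} \<and> size A = d}"

abbreviation gale_le :: "nat list \<Rightarrow> nat list \<Rightarrow> bool" where
  "gale_le \<equiv> list_all2 (\<le>)"

definition sqfree_strongly_stable :: "nat \<Rightarrow> nat set set \<Rightarrow> bool" where
  "sqfree_strongly_stable d K \<longleftrightarrow> K \<subseteq> dsubsets d \<and>
     (\<forall>S \<in> K. \<forall>T \<in> dsubsets d.
        gale_le (sorted_list_of_set T) (sorted_list_of_set S) \<longrightarrow> T \<in> K)"

definition strongly_stable :: "nat \<Rightarrow> nat multiset set \<Rightarrow> bool" where
  "strongly_stable d M \<longleftrightarrow> M \<subseteq> dmultisets d \<and>
     (\<forall>A \<in> M. \<forall>B \<in> dmultisets d.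
        gale_le (sorted_list_of_multiset B) (sorted_list_of_multiset A) \<longrightarrow> B \<in> M)"

text \<open>For a set \<open>L\<close> of increasingly sorted lists \<open>[i\<^sub>1, \<dots>, i\<^sub>d]\<close>, the ideals generated by the
  \<open>x\<^bsub>i\<^sub>1\<^esub> \<cdots> x\<^bsub>i\<^sub>d\<^esub>\<close>, and by the products of the \<open>x\<^bsup>(j)\<^esup>\<^bsub>i\<^sub>j\<^esub>\<close> for \<open>j = 1, \<dots>, d\<close>.  The variable
  \<open>x\<^bsup>(j)\<^esup>\<^sub>i\<close> is indexed by the pair \<open>(j, i)\<close>.\<close>

definition mon_ideal :: "nat set \<Rightarrow> nat list set \<Rightarrow> (nat, 'k::field) mpoly set" where
  "mon_ideal V L = Idl\<^bsub>poly_ring V\<^esub> {\<Prod>j<length xs. pvar (xs ! j) | xs. xs \<in> L}"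

definition F_ideal :: "(nat \<times> nat) set \<Rightarrow> nat list set \<Rightarrow> (nat \<times> nat, 'k::field) mpoly set" where
  "F_ideal V L = Idl\<^bsub>poly_ring V\<^esub> {\<Prod>j<length xs. pvar (Suc j, xs ! j) | xs. xs \<in> L}"


section \<open>The colex lower bound\<close>

definition colex_less :: "nat set \<Rightarrow> nat set \<Rightarrow> bool" where
  "colex_less S T \<longleftrightarrow>
     (let xs = sorted_list_of_set S; ys = sorted_list_of_set T in
      \<exists>m<length xs. xs ! m < ys ! m \<and> (\<forall>j. m < j \<and> j < length xs \<longrightarrow> xs ! j = ys ! j))"

definition colex_segment :: "nat \<Rightarrow> nat set set \<Rightarrow> bool" where
  "colex_segment d C \<longleftrightarrow> finite C \<and> C \<subseteq> dsubsets d \<and>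
     (\<forall>S \<in> C. \<forall>T \<in> dsubsets d. colex_less T S \<longrightarrow> T \<in> C)"

text \<open>As colex is a total order, the initial segment \<open>C\<close> is determined by the number of minimal
  generators of its ideal.  That ideal lives in \<open>k[x\<^sub>1, \<dots>, x\<^sub>N]\<close> for any \<open>N\<close> large enough to
  contain the variables of \<open>C\<close>, which need not be those of the ambient ring of \<open>I\<close>.\<close>

definition obeys_colex_lower_bound :: "nat \<Rightarrow> 'v set \<Rightarrow> ('v, 'k::field) mpoly set \<Rightarrow> bool" where
  "obeys_colex_lower_bound d V I \<longleftrightarrow>
     (\<exists>C. colex_segment d C \<and>
        (\<forall>N. \<Union>C \<subseteq> {1..N} \<longrightarrow>
           (let J = (mon_ideal {1..N} (sorted_list_of_set ` C) :: (nat, 'k) mpoly set) in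
              card (min_gens J) = card (min_gens I) \<and>
              (\<forall>i. betti V I i \<ge> betti {1..N} J i))))"

end

theory Submission
  imports Defs "HOL-Library.Nat_Bijection"
begin

text \<open>
  All four ideals have linear quotients, and the number of variables in each quotient depends only
  on the largest entry of the generator. The inequality is then a statement about the distribution
  of largest entries, and a colex initial segment has the smallest ones possible.

  A generator is an increasing list \<open>u\<^sub>1, \<dots>, u\<^sub>d\<close>. A parameter \<open>c\<close>, the least
  allowed increment between neighbours, treats multisets (\<open>c = 0\<close>) and sets (\<open>c = 1\<close>) together, and a
  function \<open>\<phi>\<close> naming the variable of entry \<open>i\<close> in position \<open>j\<close> treats \<open>x\<^sub>i\<close> and \<open>x\<^bsup>(j)\<^esup>\<^sub>i\<close> together. List
  the generators by the sum of their entries, in any order within a sum. Say that \<open>(j, i)\<close> is a slot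
  of \<open>u\<close> if \<open>u\<^bsub>j-1\<^esub> + c \<le> i < u\<^sub>j\<close> (for \<open>j = 1\<close>: \<open>1 \<le> i < u\<^sub>1\<close>). Lowering \<open>u\<^sub>j\<close> to \<open>i\<close> keeps the list
  admissible and makes it Gale smaller, so the result is an earlier generator; hence the variable of
  the slot lies in the colon ideal of the earlier generators by \<open>u\<close>. Conversely, a generator
  \<open>g \<noteq> u\<close> with no larger sum has a first position \<open>j\<close> with \<open>g\<^sub>j < u\<^sub>j\<close>. Then \<open>(j, g\<^sub>j)\<close> is a slot, and
  its variable has a larger exponent in \<open>g\<close> than in \<open>u\<close>; so every monomial that multiplies \<open>u\<close> into
  the multiples of \<open>g\<close> is divisible by that variable. The colon ideal is therefore generated by the
  variables of the slots, and counting slots telescopes to \<open>u\<^sub>d - 1 - c (d - 1)\<close>. The details are in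
  \<open>slot_replacement\<close>, \<open>first_drop\<close>, \<open>card_slots\<close> and \<open>lookup_exp_of_first_drop\<close>.

  If \<open>I\<close> is generated in degree \<open>d\<close> with a linear resolution, \<open>m\<close> has degree \<open>d\<close>
  and \<open>I : m\<close> has a linear resolution, then the mapping cone of a lift of multiplication by \<open>m\<close>
  resolves \<open>I + (m)\<close>. Replacing the lift by its component of degree one keeps the cone linear. Its
  ranks are the sums of the old ranks and the shifted ranks of the resolution of \<open>I : m\<close>. Applied to
  ideals generated by \<open>r\<close> variables this produces the ranks of the Koszul complex, and applied to
  linear quotients it gives \<open>\<beta>\<^sub>i = \<Sum>\<^sub>u (r\<^sub>u choose i)\<close>, where \<open>r\<^sub>u\<close> is the number of slots of \<open>u\<close>
  (\<open>linear_resolution_mapping_cone\<close>, \<open>linear_quotients_resolution\<close>). The Betti numbers are defined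
  by an arbitrary resolution, so a comparison of resolutions up to homotopy is needed to read them off
  from a minimal one (\<open>betti_eq_of_minimal_resolution\<close>).

  The shift \<open>u\<^sub>j \<mapsto> u\<^sub>j + j - 1\<close> turns multisets into sets and preserves the number of
  slots. If \<open>C\<close> is a colex initial segment, then no \<open>d\<close>-set outside \<open>C\<close> has a smaller largest element
  than a member of \<open>C\<close>. Hence for any family \<open>A\<close> of \<open>d\<close>-sets with \<open>card A = card C\<close>, after cancelling
  \<open>A \<inter> C\<close>, the binomials summed over \<open>C - A\<close> are at most those summed over \<open>A - C\<close>
  (\<open>colex_segment_exists\<close>, \<open>sum_choose_colex_le\<close>). Colex segments are themselves Gale down-sets, so
  the formula for the Betti numbers applies to them too.
\<close>

section \<open>Matrices over a polynomial ring and chain maps between resolutions\<close>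

lemma keys_add_nat: "Poly_Mapping.keys (a + b) = Poly_Mapping.keys a \<union> Poly_Mapping.keys (b :: 'v \<Rightarrow>\<^sub>0 nat)"
  by (auto simp: in_keys_iff lookup_add)

lemma polys_zero [simp]: "0 \<in> polys V"
  by (simp add: polys_def)

lemma polys_one [simp]: "(1 :: ('v, 'k::field) mpoly) \<in> polys V"
  by (simp add: polys_def)

lemma polys_uminus: "p \<in> polys V \<Longrightarrow> - p \<in> polys V"
  by (simp add: polys_def in_keys_iff)

lemma polys_add: "p \<in> polys V \<Longrightarrow> q \<in> polys V \<Longrightarrow> p + q \<in> polys V"
  unfolding polys_def using keys_add[of p q] by blast

lemma polys_minus: "p \<in> polys V \<Longrightarrow> q \<in> polys V \<Longrightarrow> p - q \<in> polys V"
  using polys_add[of p V "- q"] polys_uminus[of q V] by simp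

lemma polys_mult:
  assumes "p \<in> polys V" "q \<in> polys V"
  shows "p * q \<in> polys V"
proof -
  have "Poly_Mapping.keys m \<subseteq> V" if "m \<in> Poly_Mapping.keys (p * q)" for m
  proof -
    from that obtain a b where "m = a + b" "a \<in> Poly_Mapping.keys p" "b \<in> Poly_Mapping.keys q"
      using keys_mult[of p q] by blast
    with assms show ?thesis by (auto simp: polys_def keys_add_nat)
  qed
  then show ?thesis by (simp add: polys_def)
qed

lemma polys_sum: "(\<And>x. x \<in> A \<Longrightarrow> f x \<in> polys V) \<Longrightarrow> sum f A \<in> polys V"
  by (induction A rule: infinite_finite_induct) (auto intro: polys_add)

text \<open>Entries are confined to \<open>k[x\<^sub>v : v \<in> V]\<close>; the dimensions are part of the
  set so that the matrix calculus below can be driven by its carrier conditions.\<close>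

definition pmat :: "'v set \<Rightarrow> nat \<Rightarrow> nat \<Rightarrow> ('v, 'k::field) mpoly mat set" where
  "pmat V r c = {A \<in> carrier_mat r c. elements_mat A \<subseteq> polys V}"

lemma pmat_iff: "A \<in> pmat V r c \<longleftrightarrow> A \<in> carrier_mat r c \<and> (\<forall>i<r. \<forall>j<c. A $$ (i, j) \<in> polys V)"
proof (cases "A \<in> carrier_mat r c")
  case True
  then have "elements_mat A = {A $$ (i, j) | i j. i < r \<and> j < c}"
    unfolding elements_mat_def by (auto; blast)
  with True show ?thesis unfolding pmat_def by auto
qed (simp add: pmat_def)

lemma pmat_carrier: "A \<in> pmat V r c \<Longrightarrow> A \<in> carrier_mat r c"
  by (simp add: pmat_def)

lemma free_mod_carrier: "v \<in> free_mod V n \<Longrightarrow> v \<in> carrier_vec n"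
  by (simp add: free_mod_def)

lemma pmat_mult_vec: "A \<in> pmat V r n \<Longrightarrow> v \<in> free_mod V n \<Longrightarrow> A *\<^sub>v v \<in> free_mod V r"
  by (auto simp: pmat_iff free_mod_def scalar_prod_def intro!: polys_sum polys_mult)

lemma pmat_mult: "A \<in> pmat V r n \<Longrightarrow> B \<in> pmat V n c \<Longrightarrow> A * B \<in> pmat V r c"
  by (auto simp: pmat_iff scalar_prod_def intro!: polys_sum polys_mult)

lemma pmat_minus: "A \<in> pmat V r c \<Longrightarrow> B \<in> pmat V r c \<Longrightarrow> A - B \<in> pmat V r c"
  by (auto simp: pmat_iff intro!: polys_minus)

lemma pmat_uminus: "A \<in> pmat V r c \<Longrightarrow> - A \<in> pmat V r c"
  by (auto simp: pmat_iff intro!: polys_uminus)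

lemma pmat_one [simp]: "1\<^sub>m n \<in> pmat V n n"
  by (auto simp: pmat_iff one_mat_def)

lemma pmat_zero [simp]: "0\<^sub>m r c \<in> pmat V r c"
  by (auto simp: pmat_iff)

lemma pmat_col: "A \<in> pmat V r c \<Longrightarrow> j < c \<Longrightarrow> col A j \<in> free_mod V r"
  by (auto simp: pmat_iff free_mod_def)

lemma unit_vec_free_mod: "unit_vec n j \<in> free_mod V n"
  by (auto simp: free_mod_def unit_vec_def)

lemma pmat_of_cols:
  assumes "\<And>j. j < c \<Longrightarrow> w j \<in> free_mod V n"
  shows "mat_of_cols n (map w [0..<c]) \<in> pmat V n c"
  using assms by (auto simp: pmat_iff free_mod_def mat_of_cols_def)

lemma mult_mat_of_cols_eq:
  assumes A: "A \<in> carrier_mat r n" and B: "B \<in> carrier_mat r c"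
    and w: "\<And>j. j < c \<Longrightarrow> w j \<in> carrier_vec n" "\<And>j. j < c \<Longrightarrow> A *\<^sub>v w j = col B j"
  shows "A * mat_of_cols n (map w [0..<c]) = B"
proof (rule eq_matI)
  fix i j assume "i < dim_row B" "j < dim_col B"
  then have ij: "i < r" "j < c" using B by auto
  have "col (mat_of_cols n (map w [0..<c])) j = w j"
    using w(1)[OF ij(2)] ij by (intro eq_vecI) (auto simp: mat_of_cols_def)
  then have "(A * mat_of_cols n (map w [0..<c])) $$ (i, j) = (A *\<^sub>v w j) $ i"
    using A ij by simp
  also have "\<dots> = B $$ (i, j)" using w(2)[OF ij(2)] B ij by simp
  finally show "(A * mat_of_cols n (map w [0..<c])) $$ (i, j) = B $$ (i, j)" .
qed (use A B in auto)

text \<open>Freeness of the source: a map out of a free module lifts as soon as the images of the basis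
  vectors do.\<close>

lemma lift_through_mat:
  assumes A: "A \<in> pmat V r n" and B: "B \<in> pmat V r c"
    and col: "\<And>j. j < c \<Longrightarrow> \<exists>w \<in> free_mod V n. A *\<^sub>v w = col B j"
  shows "\<exists>X \<in> pmat V n c. A * X = B"
proof -
  obtain w where w: "\<And>j. j < c \<Longrightarrow> w j \<in> free_mod V n" "\<And>j. j < c \<Longrightarrow> A *\<^sub>v w j = col B j"
    using col by metis
  have "A * mat_of_cols n (map w [0..<c]) = B"
    using A B w by (intro mult_mat_of_cols_eq[of _ r]) (auto simp: pmat_def free_mod_def)
  with pmat_of_cols[of c w V n] w(1) show ?thesis by blast
qed

lemma mult_mat_unit_vec: "(A :: 'a::semiring_1 mat) \<in> carrier_mat r n \<Longrightarrow> j < n \<Longrightarrow> A *\<^sub>v unit_vec n j = col A j"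
  by (intro eq_vecI) auto

lemma free_resolution_dims:
  assumes "free_resolution V I D"
  shows "dim_row (D 0) = 1" "dim_row (D (Suc i)) = dim_col (D i)"
  using assms unfolding free_resolution_def by blast+

lemma free_resolution_pmat':
  assumes "free_resolution V I D"
  shows "D i \<in> pmat V (dim_row (D i)) (dim_col (D i))"
proof -
  have "elements_mat (D i) \<subseteq> polys V" using assms unfolding free_resolution_def by blast
  then show ?thesis unfolding pmat_def by (intro CollectI conjI carrier_matI refl)
qed

lemma free_resolution_pmat:
  assumes "free_resolution V I D"
  shows "D 0 \<in> pmat V 1 (dim_col (D 0))" "D (Suc i) \<in> pmat V (dim_col (D i)) (dim_col (D (Suc i)))"
  using free_resolution_pmat'[OF assms, of 0] free_resolution_pmat'[OF assms, of "Suc i"]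
  by (simp_all add: free_resolution_dims[OF assms])

lemma free_resolution_exact:
  assumes "free_resolution V I D"
  shows "{v \<in> free_mod V (dim_col (D i)). D i *\<^sub>v v = 0\<^sub>v (dim_row (D i))} =
     {D (Suc i) *\<^sub>v w | w. w \<in> free_mod V (dim_col (D (Suc i)))}"
  using assms unfolding free_resolution_def by (elim conjE) (rule spec)

lemma free_resolution_image:
  assumes "free_resolution V I D"
  shows "{(D 0 *\<^sub>v v) $ 0 | v. v \<in> free_mod V (dim_col (D 0))} = I"
  using assms unfolding free_resolution_def by (elim conjE)

lemma free_resolution_complex:
  assumes D: "free_resolution V I D"
  shows "D i * D (Suc i) = 0\<^sub>m (dim_row (D i)) (dim_col (D (Suc i)))"
proof (rule eq_matI)
  fix r j assume "r < dim_row (0\<^sub>m (dim_row (D i)) (dim_col (D (Suc i))))"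
    and "j < dim_col (0\<^sub>m (dim_row (D i)) (dim_col (D (Suc i))))"
  then have rj: "r < dim_row (D i)" "j < dim_col (D (Suc i))" by auto
  have c: "D (Suc i) \<in> carrier_mat (dim_col (D i)) (dim_col (D (Suc i)))"
    using free_resolution_pmat(2)[OF D, of i] by (simp add: pmat_def)
  have "D (Suc i) *\<^sub>v unit_vec (dim_col (D (Suc i))) j \<in>
     {D (Suc i) *\<^sub>v w | w. w \<in> free_mod V (dim_col (D (Suc i)))}"
    using unit_vec_free_mod by blast
  then have "D i *\<^sub>v (D (Suc i) *\<^sub>v unit_vec (dim_col (D (Suc i))) j) = 0\<^sub>v (dim_row (D i))"
    unfolding free_resolution_exact[OF D, symmetric] by simp
  also have "D (Suc i) *\<^sub>v unit_vec (dim_col (D (Suc i))) j = col (D (Suc i)) j"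
    by (rule mult_mat_unit_vec[OF c rj(2)])
  finally have "(D i *\<^sub>v col (D (Suc i)) j) $ r = 0" using rj by simp
  then show "(D i * D (Suc i)) $$ (r, j) = 0\<^sub>m (dim_row (D i)) (dim_col (D (Suc i))) $$ (r, j)"
    using rj by simp
qed auto

text \<open>Exactness for matrices instead of single vectors: it is applied column by column.\<close>

lemma free_resolution_lift:
  assumes D: "free_resolution V I D" and B: "B \<in> pmat V (dim_col (D i)) c"
    and 0: "D i * B = 0\<^sub>m (dim_row (D i)) c"
  shows "\<exists>X \<in> pmat V (dim_col (D (Suc i))) c. D (Suc i) * X = B"
proof (rule lift_through_mat[OF free_resolution_pmat(2)[OF D] B])
  fix j assume j: "j < c"
  have "D i *\<^sub>v col B j = col (D i * B) j"
    using B j by (auto simp: pmat_def)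
  also have "\<dots> = 0\<^sub>v (dim_row (D i))" using j by (simp add: 0)
  finally have "col B j \<in> {v \<in> free_mod V (dim_col (D i)). D i *\<^sub>v v = 0\<^sub>v (dim_row (D i))}"
    using pmat_col[OF B j] by simp
  then show "\<exists>w\<in>free_mod V (dim_col (D (Suc i))). D (Suc i) *\<^sub>v w = col B j"
    unfolding free_resolution_exact[OF D] by auto
qed

lemma free_resolution_lift_augmentation:
  assumes D: "free_resolution V I D" and B: "B \<in> pmat V 1 c"
    and I: "\<And>j. j < c \<Longrightarrow> B $$ (0, j) \<in> I"
  shows "\<exists>X \<in> pmat V (dim_col (D 0)) c. D 0 * X = B"
proof (rule lift_through_mat[OF free_resolution_pmat(1)[OF D] B])
  fix j assume j: "j < c"
  from I[OF j] obtain w where w: "w \<in> free_mod V (dim_col (D 0))" "(D 0 *\<^sub>v w) $ 0 = B $$ (0, j)"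
    unfolding free_resolution_image[OF D, symmetric] by auto
  have "D 0 *\<^sub>v w = col B j"
    using w(2) B j free_resolution_dims[OF D] unfolding pmat_def by (intro eq_vecI) auto
  with w(1) show "\<exists>w\<in>free_mod V (dim_col (D 0)). D 0 *\<^sub>v w = col B j" by blast
qed

lemma free_resolution_augmentation_entries:
  assumes D: "free_resolution V I D" and j: "j < dim_col (D 0)"
  shows "D 0 $$ (0, j) \<in> I"
proof -
  have "dim_row (D 0) = 1" using free_resolution_dims[OF D] by simp
  then have "D 0 $$ (0, j) = (D 0 *\<^sub>v unit_vec (dim_col (D 0)) j) $ 0"
    using j mult_mat_unit_vec[OF pmat_carrier[OF free_resolution_pmat(1)[OF D]] j] by simp
  then show ?thesis using unit_vec_free_mod[of "dim_col (D 0)" j V]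
    unfolding free_resolution_image[OF D, symmetric] by blast
qed

text \<open>The lifting half of the comparison theorem. Only the target has to be exact, and \<open>A\<close>
  may be any map from \<open>G 0\<close> into the ideal that kills boundaries; with \<open>A = G
  0\<close> this compares two resolutions, with a multiple of an augmentation it prepares a mapping
  cone. The construction is recursive: each step needs that the map found so far sends boundaries to
  cycles, and this is what the invariant \<open>P\<close> records.\<close>

lemma chain_map_exists:
  assumes D: "free_resolution V I D"
    and G: "\<And>i. G (Suc i) \<in> pmat V (dim_col (G i)) (dim_col (G (Suc i)))"
    and GG: "\<And>i. G (Suc i) * G (Suc (Suc i)) = 0\<^sub>m (dim_col (G i)) (dim_col (G (Suc (Suc i))))"
    and A: "A \<in> pmat V 1 (dim_col (G 0))" "\<And>j. j < dim_col (G 0) \<Longrightarrow> A $$ (0, j) \<in> I"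
    and AG: "A * G (Suc 0) = 0\<^sub>m 1 (dim_col (G (Suc 0)))"
  shows "\<exists>f. (\<forall>i. f i \<in> pmat V (dim_col (D i)) (dim_col (G i))) \<and> D 0 * f 0 = A \<and>
           (\<forall>i. D (Suc i) * f (Suc i) = f i * G (Suc i))"
proof -
  have dr: "dim_row (D 0) = 1" "dim_row (D (Suc i)) = dim_col (D i)" for i
    using free_resolution_dims[OF D] by auto
  define P where "P i X \<longleftrightarrow> X \<in> pmat V (dim_col (D i)) (dim_col (G i)) \<and>
    (i = 0 \<longrightarrow> D 0 * X = A) \<and>
    D i * (X * G (Suc i)) = 0\<^sub>m (dim_row (D i)) (dim_col (G (Suc i)))" for i X
  have assoc: "D i * (X * G (Suc i)) = (D i * X) * G (Suc i)"
    if "X \<in> pmat V (dim_col (D i)) (dim_col (G i))" for i X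
    using that G[of i] free_resolution_pmat'[OF D, of i]
    by (intro assoc_mult_mat[symmetric]) (auto simp: pmat_def)
  have "\<exists>f. \<forall>i. P i (f i) \<and> D (Suc i) * f (Suc i) = f i * G (Suc i)"
  proof (rule dependent_nat_choice)
    from free_resolution_lift_augmentation[OF D A]
    obtain X where X: "X \<in> pmat V (dim_col (D 0)) (dim_col (G 0))" "D 0 * X = A" by blast
    then have "P 0 X" using AG assoc[OF X(1)] by (simp add: P_def dr)
    then show "\<exists>X. P 0 X" ..
  next
    fix X i assume P: "P i X"
    have X: "X \<in> pmat V (dim_col (D i)) (dim_col (G i))" using P by (simp add: P_def)
    from free_resolution_lift[OF D pmat_mult[OF X G[of i]]] P
    obtain Y where Y: "Y \<in> pmat V (dim_col (D (Suc i))) (dim_col (G (Suc i)))"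
      "D (Suc i) * Y = X * G (Suc i)" by (auto simp: P_def)
    have "D (Suc i) * (Y * G (Suc (Suc i))) = X * (G (Suc i) * G (Suc (Suc i)))"
      unfolding assoc[OF Y(1)] Y(2) using X G[of i] G[of "Suc i"]
      by (intro assoc_mult_mat) (auto simp: pmat_def)
    also have "\<dots> = 0\<^sub>m (dim_col (D i)) (dim_col (G (Suc (Suc i))))"
      using pmat_carrier[OF X] by (simp add: GG)
    finally have "P (Suc i) Y" using Y by (simp add: P_def dr)
    with Y(2) show "\<exists>Y. P (Suc i) Y \<and> D (Suc i) * Y = X * G (Suc i)" by blast
  qed
  then show ?thesis unfolding P_def by metis
qed

text \<open>The uniqueness half of the comparison theorem: a chain endomorphism that induces zero on the ideal
  is null homotopic. Here the invariant says that the next map minus the part already accounted for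
  takes values in cycles, so that exactness supplies the next component of the homotopy.\<close>

lemma null_homotopy_exists:
  assumes D: "free_resolution V I D"
    and e: "\<And>i. e i \<in> pmat V (dim_col (D i)) (dim_col (D i))"
    and e0: "D 0 * e 0 = 0\<^sub>m 1 (dim_col (D 0))"
    and e1: "\<And>i. D (Suc i) * e (Suc i) = e i * D (Suc i)"
  shows "\<exists>h. (\<forall>i. h i \<in> pmat V (dim_col (D (Suc i))) (dim_col (D i))) \<and> D (Suc 0) * h 0 = e 0 \<and>
           (\<forall>i. D (Suc (Suc i)) * h (Suc i) = e (Suc i) - h i * D (Suc i))"
proof -
  note Dc = free_resolution_pmat[OF D]
  have dr: "dim_row (D 0) = 1" "dim_row (D (Suc i)) = dim_col (D i)" for i
    using free_resolution_dims[OF D] by auto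
  define P where "P i X \<longleftrightarrow> X \<in> pmat V (dim_col (D (Suc i))) (dim_col (D i)) \<and>
    (i = 0 \<longrightarrow> D (Suc 0) * X = e 0) \<and>
    D (Suc i) * (e (Suc i) - X * D (Suc i)) = 0\<^sub>m (dim_row (D (Suc i))) (dim_col (D (Suc i)))" for i X
  have expand: "D (Suc i) * (e (Suc i) - X * D (Suc i)) = e i * D (Suc i) - (D (Suc i) * X) * D (Suc i)"
    if X: "X \<in> pmat V (dim_col (D (Suc i))) (dim_col (D i))" for X i
  proof -
    have "D (Suc i) * (e (Suc i) - X * D (Suc i)) = D (Suc i) * e (Suc i) - D (Suc i) * (X * D (Suc i))"
      using X Dc e[of "Suc i"] by (intro mult_minus_distrib_mat) (auto simp: pmat_def)
    also have "D (Suc i) * (X * D (Suc i)) = (D (Suc i) * X) * D (Suc i)"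
      using X Dc by (intro assoc_mult_mat[symmetric]) (auto simp: pmat_def)
    finally show ?thesis by (simp add: e1)
  qed
  have "\<exists>h. \<forall>i. P i (h i) \<and> D (Suc (Suc i)) * h (Suc i) = e (Suc i) - h i * D (Suc i)"
  proof (rule dependent_nat_choice)
    from free_resolution_lift[OF D e[of 0]] e0
    obtain X where X: "X \<in> pmat V (dim_col (D (Suc 0))) (dim_col (D 0))" "D (Suc 0) * X = e 0"
      by (auto simp: dr)
    have "e 0 * D (Suc 0) \<in> carrier_mat (dim_col (D 0)) (dim_col (D (Suc 0)))"
      using e[of 0] by (auto simp: pmat_def)
    then have "P 0 X" using expand[OF X(1)] X by (simp add: P_def dr)
    then show "\<exists>X. P 0 X" ..
  next
    fix X i assume P: "P i X"
    have X: "X \<in> pmat V (dim_col (D (Suc i))) (dim_col (D i))" using P by (simp add: P_def)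
    let ?W = "e (Suc i) - X * D (Suc i)"
    have W: "?W \<in> pmat V (dim_col (D (Suc i))) (dim_col (D (Suc i)))"
      using pmat_minus[OF e pmat_mult[OF X Dc(2)]] .
    from free_resolution_lift[OF D W] P
    obtain Y where Y: "Y \<in> pmat V (dim_col (D (Suc (Suc i)))) (dim_col (D (Suc i)))"
      "D (Suc (Suc i)) * Y = ?W" by (auto simp: P_def)
    have "?W * D (Suc (Suc i)) = e (Suc i) * D (Suc (Suc i)) - X * D (Suc i) * D (Suc (Suc i))"
      using X Dc e[of "Suc i"] by (intro minus_mult_distrib_mat) (auto simp: pmat_def)
    also have "X * D (Suc i) * D (Suc (Suc i)) = X * (D (Suc i) * D (Suc (Suc i)))"
      using X Dc by (intro assoc_mult_mat) (auto simp: pmat_def)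
    also have "\<dots> = 0\<^sub>m (dim_col (D (Suc i))) (dim_col (D (Suc (Suc i))))"
      using pmat_carrier[OF X] free_resolution_complex[OF D, of "Suc i"] by (simp add: dr)
    finally have "?W * D (Suc (Suc i)) = e (Suc i) * D (Suc (Suc i))"
      using e[of "Suc i"] by (auto simp: pmat_def minus_r_inv_mat) 
    moreover have "e (Suc i) * D (Suc (Suc i)) \<in> carrier_mat (dim_col (D (Suc i))) (dim_col (D (Suc (Suc i))))"
      using e[of "Suc i"] by (auto simp: pmat_def)
    ultimately have "P (Suc i) Y" using expand[OF Y(1)] Y by (simp add: P_def dr)
    with Y(2) show "\<exists>Y. P (Suc i) Y \<and> D (Suc (Suc i)) * Y = ?W" by blast
  qed
  then show ?thesis unfolding P_def by metis
qed


section \<open>Tor from a minimal resolution\<close>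

lemma a_r_coset_module_vec: "a_r_coset (module_vec TYPE('k::field) n) B z = (\<lambda>b. b + z) ` B"
  by (auto simp: a_r_coset_def r_coset_def module_vec_def)

lemma set_add_module_vec: "set_add (module_vec TYPE('k::field) n) X Y = {x + y | x y. x \<in> X \<and> y \<in> Y}"
  by (auto simp: set_add_def set_mult_def module_vec_def)

text \<open>Transporting the axioms along a surjection that respects the operations. It turns a quotient given
  only by its record of operations into a vector space without proving anything about cosets beyond
  additivity and homogeneity of the projection.\<close>

lemma vectorspace_image:
  fixes V :: "('k::field, 'a) module" and W :: "('k, 'b) module"
  assumes V: "vectorspace class_ring V"
    and surj: "T ` carrier V = carrier W"
    and zero: "T \<zero>\<^bsub>V\<^esub> = \<zero>\<^bsub>W\<^esub>"
    and add: "\<And>u v. u \<in> carrier V \<Longrightarrow> v \<in> carrier V \<Longrightarrow> T (u \<oplus>\<^bsub>V\<^esub> v) = T u \<oplus>\<^bsub>W\<^esub> T v"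
    and smult: "\<And>c v. v \<in> carrier V \<Longrightarrow> T (c \<odot>\<^bsub>V\<^esub> v) = c \<odot>\<^bsub>W\<^esub> T v"
  shows "vectorspace class_ring W"
proof -
  interpret V: vectorspace class_ring V by (rule V)
  have Wc: "w \<in> carrier W \<Longrightarrow> \<exists>v \<in> carrier V. w = T v" for w using surj by blast
  have cl: "T v \<in> carrier W" if "v \<in> carrier V" for v using surj that by blast
  have sc: "c \<odot>\<^bsub>V\<^esub> v \<in> carrier V" if "v \<in> carrier V" for c v using that by (simp)
  have a: "T u \<oplus>\<^bsub>W\<^esub> T v = T (u \<oplus>\<^bsub>V\<^esub> v)" if "u \<in> carrier V" "v \<in> carrier V" for u v
    using add[OF that] by simp
  have s: "c \<odot>\<^bsub>W\<^esub> T v = T (c \<odot>\<^bsub>V\<^esub> v)" if "v \<in> carrier V" for c v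
    using smult[OF that] by simp
  show ?thesis
  proof (rule vs_criteria; (intro allI impI ballI; (elim conjE)?)?)
    show "field (class_ring :: 'k ring)" by (rule class_field)
    show "\<zero>\<^bsub>W\<^esub> \<in> carrier W" using cl[OF V.zero_closed] zero by simp
  next
    fix v w assume "v \<in> carrier W" "w \<in> carrier W"
    then show "v \<oplus>\<^bsub>W\<^esub> w \<in> carrier W" by (auto dest!: Wc simp: a cl)
  next
    fix w assume "w \<in> carrier W"
    then obtain v where v: "v \<in> carrier V" "w = T v" using Wc by blast
    then have "w \<oplus>\<^bsub>W\<^esub> T (\<ominus>\<^bsub>V\<^esub> v) = \<zero>\<^bsub>W\<^esub>" by (simp add: a zero V.r_neg)
    then show "\<exists>neg_v\<in>carrier W. w \<oplus>\<^bsub>W\<^esub> neg_v = \<zero>\<^bsub>W\<^esub>" using cl v(1) by blast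
  next
    fix c :: 'k and v assume "v \<in> carrier W"
    then show "c \<odot>\<^bsub>W\<^esub> v \<in> carrier W" by (auto dest!: Wc simp: s cl sc)
  next
    fix v w assume "v \<in> carrier W" "w \<in> carrier W"
    then show "v \<oplus>\<^bsub>W\<^esub> w = w \<oplus>\<^bsub>W\<^esub> v" by (auto dest!: Wc simp: a V.a_comm)
  next
    fix v w x assume "v \<in> carrier W" "w \<in> carrier W" "x \<in> carrier W"
    then show "v \<oplus>\<^bsub>W\<^esub> w \<oplus>\<^bsub>W\<^esub> x = v \<oplus>\<^bsub>W\<^esub> (w \<oplus>\<^bsub>W\<^esub> x)" by (auto dest!: Wc simp: a V.a_assoc)
  next
    fix v assume "v \<in> carrier W"
    then obtain u where "u \<in> carrier V" "v = T u" using Wc by blast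
    then show "v \<oplus>\<^bsub>W\<^esub> \<zero>\<^bsub>W\<^esub> = v" using a[of u "\<zero>\<^bsub>V\<^esub>"] by (simp add: zero)
  next
    fix c e :: 'k and v assume "v \<in> carrier W"
    then show "(c \<otimes>\<^bsub>class_ring\<^esub> e) \<odot>\<^bsub>W\<^esub> v = c \<odot>\<^bsub>W\<^esub> (e \<odot>\<^bsub>W\<^esub> v)"
      using V.smult_assoc1[of c e] by (auto dest!: Wc simp: s sc)
  next
    fix v assume "v \<in> carrier W"
    then show "\<one>\<^bsub>class_ring\<^esub> \<odot>\<^bsub>W\<^esub> v = v"
      using V.smult_one by (auto dest!: Wc simp: s)
  next
    fix c e :: 'k and v assume "v \<in> carrier W"
    then show "(c \<oplus>\<^bsub>class_ring\<^esub> e) \<odot>\<^bsub>W\<^esub> v = c \<odot>\<^bsub>W\<^esub> v \<oplus>\<^bsub>W\<^esub> e \<odot>\<^bsub>W\<^esub> v"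
      using V.smult_l_distr[of c e] by (auto dest!: Wc simp: s sc a)
  next
    fix c :: 'k and v w assume "v \<in> carrier W" "w \<in> carrier W"
    then show "c \<odot>\<^bsub>W\<^esub> (v \<oplus>\<^bsub>W\<^esub> w) = c \<odot>\<^bsub>W\<^esub> v \<oplus>\<^bsub>W\<^esub> c \<odot>\<^bsub>W\<^esub> w"
      using V.smult_r_distr[of c] by (auto dest!: Wc simp: s sc a)
  qed
qed

text \<open>\<open>v \<mapsto> F v + B\<close> is an isomorphism from \<open>k\<^sup>n\<close> onto \<open>Z /
  B\<close>: it is injective because \<open>G\<close> is a left inverse of \<open>F\<close> that
  kills \<open>B\<close>, and surjective because \<open>z\<close> and \<open>F (G z)\<close> differ
  by a boundary. In the application \<open>F\<close> and \<open>G\<close> are comparison maps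
  tensored with \<open>k\<close>, and \<open>E\<close> is the differential with image
  \<open>B\<close>.\<close>

lemma dim_quot_space:
  fixes E :: "'k::field mat"
  assumes E: "E \<in> carrier_mat m p" and F: "F \<in> carrier_mat m n" and G: "G \<in> carrier_mat n m"
    and B: "B = {E *\<^sub>v w | w. w \<in> carrier_vec p}" and BZ: "Z \<subseteq> carrier_vec m"
    and GF: "G * F = 1\<^sub>m n"
    and FZ: "\<And>v. v \<in> carrier_vec n \<Longrightarrow> F *\<^sub>v v \<in> Z"
    and GE: "G * E = 0\<^sub>m n p"
    and FG: "\<And>z. z \<in> Z \<Longrightarrow> \<exists>b \<in> B. z = b + F *\<^sub>v (G *\<^sub>v z)"
  shows "vectorspace.dim class_ring (quot_space m Z B) = n"
proof -
  define W where "W = quot_space m Z B"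
  define T where "T v = (\<lambda>b. b + F *\<^sub>v v) ` B" for v
  have Bc: "B \<subseteq> carrier_vec m" using E by (auto simp: B)
  have Bd: "b \<in> carrier_vec m" "dim_vec b = m" if "b \<in> B" for b
    using subsetD[OF Bc that] by auto
  have B0: "0\<^sub>v m \<in> B"
  proof -
    have "E *\<^sub>v 0\<^sub>v p = 0\<^sub>v m" using E by auto
    then show ?thesis unfolding B by (metis (mono_tags, lifting) mem_Collect_eq zero_carrier_vec)
  qed
  have Badd: "x + y \<in> B" if "x \<in> B" "y \<in> B" for x y
  proof -
    from that obtain u v where "x = E *\<^sub>v u" "y = E *\<^sub>v v" "u \<in> carrier_vec p" "v \<in> carrier_vec p"
      unfolding B by blast
    then have "x + y = E *\<^sub>v (u + v)" "u + v \<in> carrier_vec p"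
      using E by (auto simp: mult_add_distrib_mat_vec)
    then show ?thesis unfolding B by blast
  qed
  have Bsm: "c \<cdot>\<^sub>v x \<in> B" if "x \<in> B" for c x
  proof -
    from that obtain u where "x = E *\<^sub>v u" "u \<in> carrier_vec p" unfolding B by blast
    then have "c \<cdot>\<^sub>v x = E *\<^sub>v (c \<cdot>\<^sub>v u)" "c \<cdot>\<^sub>v u \<in> carrier_vec p"
      using E by (auto simp: mult_mat_vec)
    then show ?thesis unfolding B by blast
  qed
  have Bm: "x - y \<in> B" if "x \<in> B" "y \<in> B" for x y
  proof -
    have "x - y = x + (-1) \<cdot>\<^sub>v y" using that Bc by auto
    with Badd[OF that(1) Bsm[OF that(2)], of "-1"] show ?thesis by simp
  qed
  have coset_add: "(\<lambda>b. b + (b' + z)) ` B = (\<lambda>b. b + z) ` B" if b': "b' \<in> B" and z: "z \<in> carrier_vec m" for b' z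
  proof -
    have "(\<lambda>b. b + (b' + z)) ` B = (\<lambda>b. (b + b') + z) ` B"
      using b' z Bc by (intro image_cong refl) (auto simp: subset_iff intro!: assoc_add_vec[symmetric])
    also have "\<dots> = (\<lambda>b. b + z) ` ((\<lambda>b. b + b') ` B)" by (simp add: image_image)
    also have "(\<lambda>b. b + b') ` B = B"
    proof -
      have "b = (b - b') + b'" if "b \<in> B" for b
        using Bd[OF that] Bd[OF b'] by (intro eq_vecI) auto
      then have "b \<in> (\<lambda>b. b + b') ` B" if "b \<in> B" for b
        using Bm[OF that b'] that by blast
      with Badd[OF _ b'] show ?thesis by blast
    qed
    finally show ?thesis .
  qed
  have Fc: "F *\<^sub>v v \<in> carrier_vec m" if "v \<in> carrier_vec n" for v using F that by auto
  have Wcar: "carrier W = {(\<lambda>b. b + z) ` B | z. z \<in> Z}"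
    by (simp add: W_def quot_space_def a_r_coset_module_vec)
  have surj: "T ` carrier_vec n = carrier W"
  proof (rule subset_antisym; rule subsetI)
    fix x assume "x \<in> T ` carrier_vec n"
    then show "x \<in> carrier W" unfolding Wcar T_def using FZ by blast
  next
    fix x assume "x \<in> carrier W"
    then obtain z where z: "z \<in> Z" "x = (\<lambda>b. b + z) ` B" unfolding Wcar by blast
    from FG[OF z(1)] obtain b where b: "b \<in> B" "z = b + F *\<^sub>v (G *\<^sub>v z)" by blast
    have Gz: "G *\<^sub>v z \<in> carrier_vec n" using G z BZ by auto
    have "x = T (G *\<^sub>v z)" unfolding z(2) T_def using coset_add[OF b(1) Fc[OF Gz]] b(2) by simp
    then show "x \<in> T ` carrier_vec n" using Gz by blast
  qed
  have Tadd: "T (u + v) = T u \<oplus>\<^bsub>W\<^esub> T v" if u: "u \<in> carrier_vec n" and v: "v \<in> carrier_vec n" for u v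
  proof -
    have eq: "(b + F *\<^sub>v u) + (b' + F *\<^sub>v v) = (b + b') + F *\<^sub>v (u + v)" if "b \<in> B" "b' \<in> B" for b b'
      using Bd[OF that(1)] Bd[OF that(2)] carrier_vecD[OF Fc[OF u]] carrier_vecD[OF Fc[OF v]]
      unfolding mult_add_distrib_mat_vec[OF F u v] by (intro eq_vecI) (simp_all del: index_mult_mat_vec)
    have W_add: "T u \<oplus>\<^bsub>W\<^esub> T v = {x + y | x y. x \<in> T u \<and> y \<in> T v}"
      by (simp add: W_def quot_space_def set_add_module_vec)
    show ?thesis unfolding W_add
    proof (rule subset_antisym; rule subsetI)
      fix x assume "x \<in> T (u + v)"
      then obtain b where b: "b \<in> B" "x = b + F *\<^sub>v (u + v)" unfolding T_def by blast
      have "x = (b + F *\<^sub>v u) + (0\<^sub>v m + F *\<^sub>v v)" using eq[OF b(1) B0] b Bc by auto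
      then show "x \<in> {x + y | x y. x \<in> T u \<and> y \<in> T v}" using b(1) B0 unfolding T_def by blast
    next
      fix x assume "x \<in> {x + y | x y. x \<in> T u \<and> y \<in> T v}"
      then obtain b b' where "b \<in> B" "b' \<in> B" "x = (b + F *\<^sub>v u) + (b' + F *\<^sub>v v)"
        unfolding T_def by blast
      with eq Badd show "x \<in> T (u + v)" unfolding T_def by blast
    qed
  qed
  have Tsm: "T (c \<cdot>\<^sub>v v) = c \<odot>\<^bsub>W\<^esub> T v" if v: "v \<in> carrier_vec n" for c v
  proof -
    have "(\<lambda>b'. b' + c \<cdot>\<^sub>v (b + F *\<^sub>v v)) ` B = T (c \<cdot>\<^sub>v v)" if b: "b \<in> B" for b
    proof -
      have "c \<cdot>\<^sub>v (b + F *\<^sub>v v) = c \<cdot>\<^sub>v b + F *\<^sub>v (c \<cdot>\<^sub>v v)"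
        using b Bc Fc[OF v] v F by (simp add: smult_add_distrib_vec[of _ m] mult_mat_vec subset_iff)
      then show ?thesis unfolding T_def using coset_add[OF Bsm[OF b] Fc, of "c \<cdot>\<^sub>v v" c] v by simp
    qed
    then have "(\<Union>x\<in>T v. (\<lambda>b'. b' + c \<cdot>\<^sub>v x) ` B) = T (c \<cdot>\<^sub>v v)"
      using B0 by (subst (1) T_def) auto
    then show ?thesis by (simp add: W_def quot_space_def a_r_coset_module_vec)
  qed
  have T0: "T (0\<^sub>v n) = B"
  proof -
    have "F *\<^sub>v 0\<^sub>v n = 0\<^sub>v m" using F by auto
    then have "T (0\<^sub>v n) = (\<lambda>b. b) ` B" unfolding T_def using Bc by (intro image_cong) auto
    then show ?thesis by simp
  qed
  have inj: "inj_on T (carrier_vec n)"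
  proof (rule inj_onI)
    fix u v assume u: "u \<in> carrier_vec n" and v: "v \<in> carrier_vec n" and "T u = T v"
    have "0\<^sub>v m + F *\<^sub>v u \<in> T u" unfolding T_def using B0 by blast
    then obtain b where b: "b \<in> B" "0\<^sub>v m + F *\<^sub>v u = b + F *\<^sub>v v"
      using \<open>T u = T v\<close> unfolding T_def by auto
    have GFv: "G *\<^sub>v (F *\<^sub>v x) = x" if "x \<in> carrier_vec n" for x
      using that G F by (simp add: assoc_mult_mat_vec[symmetric, OF G F] GF)
    have Gb: "G *\<^sub>v b = 0\<^sub>v n"
    proof -
      from b(1) obtain w where w: "b = E *\<^sub>v w" "w \<in> carrier_vec p" unfolding B by blast
      have "0\<^sub>m n p *\<^sub>v w = 0\<^sub>v n" using w(2) by (intro eq_vecI) auto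
      then show ?thesis using assoc_mult_mat_vec[OF G E w(2)] GE w(1) by simp
    qed
    have "F *\<^sub>v u = b + F *\<^sub>v v" using b(2) Fc[OF u] by simp
    then have "G *\<^sub>v (F *\<^sub>v u) = G *\<^sub>v b + G *\<^sub>v (F *\<^sub>v v)"
      using mult_add_distrib_mat_vec[OF G _ Fc[OF v]] b(1) Bc by auto
    then show "u = v" using u v by (simp add: GFv Gb)
  qed
  \<comment> \<open>\<open>T\<close> is now a bijection that respects the operations, so it carries the dimension over.\<close>
  interpret V: vec_space "TYPE('k)" n .
  have vsW: "vectorspace class_ring W"
  proof (rule vectorspace_image[OF vec_vs[of n], of T])
    show "T ` carrier (module_vec TYPE('k) n) = carrier W" using surj by (simp add: module_vec_simps)
    show "T \<zero>\<^bsub>module_vec TYPE('k) n\<^esub> = \<zero>\<^bsub>W\<^esub>"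
      using T0 by (simp add: module_vec_simps) (simp add: W_def quot_space_def)
  qed (simp_all add: module_vec_simps Tadd Tsm)
  have lin: "linear_map class_ring (module_vec TYPE('k) n) W T"
    using vec_vs[of n] vsW surj
    by (intro linear_map.intro mod_hom.intro mod_hom_axioms.intro)
       (auto simp: LinearCombinations.module_hom_def module_vec_simps Tadd Tsm vectorspace_def)
  have "V.dim = vectorspace.dim class_ring W"
    by (rule linear_map.dim_eq[OF lin V.fin_dim]) (use inj surj in \<open>simp_all add: module_vec_simps\<close>)
  then show ?thesis by (simp add: W_def V.dim_is_n)
qed


text \<open>A product of two terms is constant only if both are, since exponent vectors have no negative
  entries.\<close>

lemma lookup_mult_zero: "Poly_Mapping.lookup (p * q) 0 = Poly_Mapping.lookup p 0 * Poly_Mapping.lookup (q :: ('v, 'k::field) mpoly) 0"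
proof -
  have zero: "0 = a + b \<longleftrightarrow> a = 0 \<and> b = 0" for a b :: "'v \<Rightarrow>\<^sub>0 nat"
    by (auto simp: poly_mapping_eq_iff lookup_add fun_eq_iff)
  have "Poly_Mapping.lookup (p * q) 0 =
    Sum_any (\<lambda>a. Poly_Mapping.lookup p a * Sum_any (\<lambda>b. Poly_Mapping.lookup q b when 0 = a + b))"
    by (simp add: lookup_mult)
  also have "\<dots> = Sum_any (\<lambda>a. Poly_Mapping.lookup p a * Poly_Mapping.lookup q 0 when a = 0)"
    by (intro Sum_any.cong) (auto simp: zero when_def)
  finally show ?thesis by simp
qed

lemma tensor_k_carrier [simp]: "A \<in> carrier_mat r c \<Longrightarrow> tensor_k A \<in> carrier_mat r c"
  by (simp add: tensor_k_def)

lemma lookup_sum_mult_zero: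
  "Poly_Mapping.lookup (\<Sum>x\<in>A. f x * (g x :: ('v, 'k::field) mpoly)) 0 =
   (\<Sum>x\<in>A. Poly_Mapping.lookup (f x) 0 * Poly_Mapping.lookup (g x) 0)"
  by (simp add: lookup_sum lookup_mult_zero)

lemma tensor_k_mult:
  assumes "A \<in> carrier_mat r n" "B \<in> carrier_mat n c"
  shows "tensor_k (A * B) = tensor_k A * tensor_k B"
  using assms by (intro eq_matI) (auto simp: tensor_k_def scalar_prod_def lookup_sum_mult_zero)

lemma tensor_k_minus:
  assumes "A \<in> carrier_mat r c" "B \<in> carrier_mat r c"
  shows "tensor_k (A - B) = tensor_k A - tensor_k B"
  using assms by (intro eq_matI) (auto simp: tensor_k_def lookup_minus)

lemma tensor_k_add:
  assumes "A \<in> carrier_mat r c" "B \<in> carrier_mat r c"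
  shows "tensor_k (A + B) = tensor_k A + tensor_k B"
  using assms by (intro eq_matI) (auto simp: tensor_k_def lookup_add)

lemma tensor_k_one: "tensor_k (1\<^sub>m n) = 1\<^sub>m n"
  by (intro eq_matI) (auto simp: tensor_k_def one_mat_def)

lemma free_resolution_pmat_n:
  assumes "free_resolution V I D" "\<And>i. dim_col (D i) = n i"
  shows "D 0 \<in> pmat V 1 (n 0)" "D (Suc i) \<in> pmat V (n i) (n (Suc i))"
  using free_resolution_pmat[OF assms(1)] unfolding assms(2) by auto

lemma composite_homotopic_to_one:
  assumes D: "free_resolution V I D" and n: "\<And>i. dim_col (D i) = n i"
    and e: "\<And>i. e i \<in> pmat V (n i) (n i)"
    and e0: "D 0 * e 0 = D 0"
    and e1: "\<And>i. D (Suc i) * e (Suc i) = e i * D (Suc i)"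
  shows "\<exists>h. (\<forall>i. h i \<in> pmat V (n (Suc i)) (n i)) \<and>
           e 0 - 1\<^sub>m (n 0) = D (Suc 0) * h 0 \<and>
           (\<forall>i. e (Suc i) - 1\<^sub>m (n (Suc i)) = D (Suc (Suc i)) * h (Suc i) + h i * D (Suc i))"
proof -
  note Dc = free_resolution_pmat_n[OF D n]
  let ?e = "\<lambda>i. e i - 1\<^sub>m (n i)"
  have "\<exists>h. (\<forall>i. h i \<in> pmat V (n (Suc i)) (n i)) \<and> D (Suc 0) * h 0 = ?e 0 \<and>
           (\<forall>i. D (Suc (Suc i)) * h (Suc i) = ?e (Suc i) - h i * D (Suc i))"
  proof (rule null_homotopy_exists[OF D, unfolded n])
    show "?e i \<in> pmat V (n i) (n i)" for i by (intro pmat_minus e pmat_one)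
    have "D 0 * ?e 0 = D 0 * e 0 - D 0 * 1\<^sub>m (n 0)"
      by (rule mult_minus_distrib_mat[OF pmat_carrier[OF Dc(1)] pmat_carrier[OF e] one_carrier_mat])
    also have "\<dots> = 0\<^sub>m 1 (n 0)" using pmat_carrier[OF Dc(1)] e0 by simp
    finally show "D 0 * ?e 0 = 0\<^sub>m 1 (n 0)" .
    show "D (Suc i) * ?e (Suc i) = ?e i * D (Suc i)" for i
    proof -
      have "D (Suc i) * ?e (Suc i) = D (Suc i) * e (Suc i) - D (Suc i) * 1\<^sub>m (n (Suc i))"
        by (rule mult_minus_distrib_mat[OF pmat_carrier[OF Dc(2)] pmat_carrier[OF e] one_carrier_mat])
      also have "\<dots> = e i * D (Suc i) - 1\<^sub>m (n i) * D (Suc i)"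
        using pmat_carrier[OF Dc(2)[of i]] e1 by simp
      also have "\<dots> = ?e i * D (Suc i)"
        by (rule minus_mult_distrib_mat[OF pmat_carrier[OF e] one_carrier_mat pmat_carrier[OF Dc(2)], symmetric])
      finally show ?thesis .
    qed
  qed
  then obtain h where h: "\<And>i. h i \<in> pmat V (n (Suc i)) (n i)"
    "D (Suc 0) * h 0 = ?e 0" "\<And>i. D (Suc (Suc i)) * h (Suc i) = ?e (Suc i) - h i * D (Suc i)" by blast
  have "?e (Suc i) = D (Suc (Suc i)) * h (Suc i) + h i * D (Suc i)" for i
  proof -
    have "h i * D (Suc i) \<in> carrier_mat (n (Suc i)) (n (Suc i))"
      using pmat_carrier[OF h(1)[of i]] pmat_carrier[OF Dc(2)[of i]] by simp
    then show ?thesis unfolding h(3) using pmat_carrier[OF e[of "Suc i"]] by (intro eq_matI) auto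
  qed
  with h show ?thesis by metis
qed

lemma comparison_map_exists:
  assumes A: "free_resolution V I A" "\<And>i. dim_col (A i) = m i"
    and B: "free_resolution V I B" "\<And>i. dim_col (B i) = n i"
  shows "\<exists>f. (\<forall>i. f i \<in> pmat V (m i) (n i)) \<and> A 0 * f 0 = B 0 \<and>
           (\<forall>i. A (Suc i) * f (Suc i) = f i * B (Suc i))"
proof (rule chain_map_exists[OF A(1), of B, unfolded A(2) B(2)])
  show "B (Suc i) * B (Suc (Suc i)) = 0\<^sub>m (n i) (n (Suc (Suc i)))" for i
    using free_resolution_complex[OF B(1), of "Suc i"] by (simp add: free_resolution_dims[OF B(1)] B(2))
  show "B 0 * B (Suc 0) = 0\<^sub>m 1 (n (Suc 0))"
    using free_resolution_complex[OF B(1), of 0] by (simp add: free_resolution_dims[OF B(1)] B(2))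
  show "B 0 $$ (0, j) \<in> I" if "j < n 0" for j
    using free_resolution_augmentation_entries[OF B(1)] that by (simp add: B(2))
qed (rule free_resolution_pmat_n[OF B])+

lemma comparison_maps_homotopy_inverse:
  assumes A: "free_resolution V I A" "\<And>i. dim_col (A i) = m i"
    and B: "free_resolution V I B" "\<And>i. dim_col (B i) = n i"
    and a: "\<And>i. a i \<in> pmat V (m i) (n i)" "A 0 * a 0 = B 0"
     "\<And>i. A (Suc i) * a (Suc i) = a i * B (Suc i)"
    and b: "\<And>i. b i \<in> pmat V (n i) (m i)" "B 0 * b 0 = A 0"
     "\<And>i. B (Suc i) * b (Suc i) = b i * A (Suc i)"
  shows "\<exists>h. (\<forall>i. h i \<in> pmat V (m (Suc i)) (m i)) \<and>
           a 0 * b 0 - 1\<^sub>m (m 0) = A (Suc 0) * h 0 \<and>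
           (\<forall>i. a (Suc i) * b (Suc i) - 1\<^sub>m (m (Suc i)) = A (Suc (Suc i)) * h (Suc i) + h i * A (Suc i))"
proof (rule composite_homotopic_to_one[OF A])
  note Ac = free_resolution_pmat_n[OF A, THEN pmat_carrier]
  note Bc = free_resolution_pmat_n[OF B, THEN pmat_carrier]
  note ac = pmat_carrier[OF a(1)] and bc = pmat_carrier[OF b(1)]
  show "a i * b i \<in> pmat V (m i) (m i)" for i by (rule pmat_mult[OF a(1) b(1)])
  show "A 0 * (a 0 * b 0) = A 0"
    unfolding assoc_mult_mat[OF Ac(1) ac bc, symmetric] a b ..
  show "A (Suc i) * (a (Suc i) * b (Suc i)) = a i * b i * A (Suc i)" for i
    unfolding assoc_mult_mat[OF Ac(2) ac bc, symmetric] a(3)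
      assoc_mult_mat[OF ac Bc(2) bc] assoc_mult_mat[OF ac bc Ac(2)] b(3) ..
qed

text \<open>The Betti number is defined through a chosen resolution \<open>D'\<close>. The comparison maps
  between \<open>D\<close> and \<open>D'\<close> are homotopy inverse to each other. After tensoring
  with \<open>k\<close> the differentials of the minimal resolution \<open>D\<close> vanish, so one
  composite becomes the identity on the nose, and the other one is the identity up to boundaries on
  cycles. This is the situation of \<open>dim_quot_space\<close>.\<close>

lemma betti_eq_of_minimal_resolution:
  fixes D :: "nat \<Rightarrow> ('v, 'k::field) mpoly mat"
  assumes D: "free_resolution V I D"
    and min: "\<And>i. tensor_k (D (Suc i)) = 0\<^sub>m (dim_col (D i)) (dim_col (D (Suc i)))"
  shows "betti V I i = dim_col (D i)"
proof -
  define D' :: "nat \<Rightarrow> ('v, 'k) mpoly mat" where "D' = (SOME D. free_resolution V I D)"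
  have D': "free_resolution V I D'" 
    unfolding D'_def using someI[of "free_resolution V I", OF D] by simp
  define n where "n i = dim_col (D i)" for i
  define m where "m i = dim_col (D' i)" for i
  note n = n_def[symmetric] and m = m_def[symmetric]
  obtain f where f: "\<And>i. f i \<in> pmat V (m i) (n i)" "D' 0 * f 0 = D 0"
     "\<And>i. D' (Suc i) * f (Suc i) = f i * D (Suc i)" using comparison_map_exists[OF D' m D n] by blast
  obtain g where g: "\<And>i. g i \<in> pmat V (n i) (m i)" "D 0 * g 0 = D' 0"
     "\<And>i. D (Suc i) * g (Suc i) = g i * D' (Suc i)" using comparison_map_exists[OF D n D' m] by blast
  obtain h where h: "\<And>i. h i \<in> pmat V (n (Suc i)) (n i)"
     "g 0 * f 0 - 1\<^sub>m (n 0) = D (Suc 0) * h 0"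
     "\<And>i. g (Suc i) * f (Suc i) - 1\<^sub>m (n (Suc i)) = D (Suc (Suc i)) * h (Suc i) + h i * D (Suc i)"
    using comparison_maps_homotopy_inverse[OF D n D' m g f] by blast
  obtain h' where h': "\<And>i. h' i \<in> pmat V (m (Suc i)) (m i)"
     "f 0 * g 0 - 1\<^sub>m (m 0) = D' (Suc 0) * h' 0"
     "\<And>i. f (Suc i) * g (Suc i) - 1\<^sub>m (m (Suc i)) = D' (Suc (Suc i)) * h' (Suc i) + h' i * D' (Suc i)"
    using comparison_maps_homotopy_inverse[OF D' m D n f g] by blast
  note c = free_resolution_pmat_n[OF D n, THEN pmat_carrier]
  note c' = free_resolution_pmat_n[OF D' m, THEN pmat_carrier]
  note fc = pmat_carrier[OF f(1)] and gc = pmat_carrier[OF g(1)]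
    and hc = pmat_carrier[OF h(1)] and hc' = pmat_carrier[OF h'(1)]
  let ?D = "\<lambda>i. tensor_k (D' i)" and ?f = "\<lambda>i. tensor_k (f i)" and ?g = "\<lambda>i. tensor_k (g i)"
    and ?h = "\<lambda>i. tensor_k (h' i)"
  note tc = fc[THEN tensor_k_carrier] gc[THEN tensor_k_carrier] hc[THEN tensor_k_carrier]
    hc'[THEN tensor_k_carrier] c'(2)[THEN tensor_k_carrier]
  have z: "tensor_k (D (Suc i)) = 0\<^sub>m (n i) (n (Suc i))" for i
    using min[of i] by (simp add: n)
  have gf: "?g i * ?f i = 1\<^sub>m (n i)" for i
  proof -
    have "tensor_k (g i * f i - 1\<^sub>m (n i)) = 0\<^sub>m (n i) (n i)"
    proof (cases i)
      case 0
      show ?thesis unfolding 0 h(2) tensor_k_mult[OF c(2) hc] z using tc(3)[of 0] by simp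
    next
      case (Suc j)
      show ?thesis unfolding Suc h(3)
          tensor_k_add[OF mult_carrier_mat[OF c(2) hc] mult_carrier_mat[OF hc c(2)]]
          tensor_k_mult[OF c(2) hc] tensor_k_mult[OF hc c(2)] z
        using tc(3)[of "Suc j"] tc(3)[of j] by simp
    qed
    then have eq: "?g i * ?f i - 1\<^sub>m (n i) = 0\<^sub>m (n i) (n i)"
      unfolding tensor_k_minus[OF mult_carrier_mat[OF gc fc] one_carrier_mat] tensor_k_mult[OF gc fc]
        tensor_k_one .
    show ?thesis
    proof (rule eq_matI)
      fix r s assume "r < dim_row (1\<^sub>m (n i) :: 'k mat)" "s < dim_col (1\<^sub>m (n i) :: 'k mat)"
      then have "r < n i" "s < n i" by auto
      then show "(?g i * ?f i) $$ (r, s) = 1\<^sub>m (n i) $$ (r, s)"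
        using arg_cong[OF eq, of "\<lambda>A. A $$ (r, s)"] tc(1)[of i] tc(2)[of i]
        by (simp del: index_mult_mat(1) index_one_mat(1))
    qed (use tc(1)[of i] tc(2)[of i] in auto)
  qed
  \<comment> \<open>\<open>f g - 1\<close> is null homotopic, so on cycles the first summand will be a boundary.\<close>
  have fg: "z = tensor_k (f i * g i - 1\<^sub>m (m i)) *\<^sub>v (- z) + ?f i *\<^sub>v (?g i *\<^sub>v z)" 
    if z: "z \<in> carrier_vec (m i)" for z i
  proof -
    have z': "- z \<in> carrier_vec (m i)" using z by simp
    have gz: "?f i *\<^sub>v (?g i *\<^sub>v z) \<in> carrier_vec (m i)"
      by (rule mult_mat_vec_carrier[OF tc(1) mult_mat_vec_carrier[OF tc(2) z]])
    have "tensor_k (f i * g i - 1\<^sub>m (m i)) *\<^sub>v (- z) = ?f i *\<^sub>v (?g i *\<^sub>v (- z)) - (- z)"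
      unfolding tensor_k_minus[OF mult_carrier_mat[OF fc gc] one_carrier_mat] tensor_k_mult[OF fc gc]
        tensor_k_one minus_mult_distrib_mat_vec[OF mult_carrier_mat[OF tc(1) tc(2)] one_carrier_mat z']
        assoc_mult_mat_vec[OF tc(1) tc(2) z'] using z' by simp
    moreover have "?f i *\<^sub>v (?g i *\<^sub>v (- z)) = - (?f i *\<^sub>v (?g i *\<^sub>v z))"
    proof -
      have "- x = (-1) \<cdot>\<^sub>v x" for x :: "'k vec" by (intro eq_vecI) auto
      then show ?thesis using mult_mat_vec[OF tc(2) z, of "-1"]
          mult_mat_vec[OF tc(1) mult_mat_vec_carrier[OF tc(2) z], of "-1"] by simp
    qed
    moreover have "z = (- y - (- z)) + y" if "y \<in> carrier_vec (m i)" for y :: "'k vec"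
      using z that by (intro eq_vecI) auto
    ultimately show ?thesis using gz by metis
  qed
  have "vectorspace.dim class_ring (tor_space D' i) = n i"
    unfolding tor_space_def m
  proof (rule dim_quot_space[OF tc(5)[of i] tc(1)[of i] tc(2)[of i] _ _ gf])
    show "tor_boundaries D' i = {?D (Suc i) *\<^sub>v w |w. w \<in> carrier_vec (m (Suc i))}"
      unfolding tor_boundaries_def m ..
    show "tor_cycles D' i \<subseteq> carrier_vec (m i)" by (cases i) (auto simp: m)
    show "?g i * ?D (Suc i) = 0\<^sub>m (n i) (m (Suc i))"
      unfolding tensor_k_mult[OF gc c'(2), symmetric] g(3)[symmetric] tensor_k_mult[OF c(2) gc] z
      using tc(2)[of "Suc i"] by simp
    show "?f i *\<^sub>v v \<in> tor_cycles D' i" if v: "v \<in> carrier_vec (n i)" for v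
    proof (cases i)
      case 0
      then show ?thesis using tc(1)[of i] v by (simp add: m)
    next
      case (Suc j)
      have "?D (Suc j) *\<^sub>v (?f (Suc j) *\<^sub>v v) = (?f j * 0\<^sub>m (n j) (n (Suc j))) *\<^sub>v v"
        unfolding assoc_mult_mat_vec[OF tc(5) tc(1) v[unfolded Suc], symmetric]
          tensor_k_mult[OF c'(2) fc, symmetric] f(3) tensor_k_mult[OF fc c(2)] z ..
      also have "\<dots> = 0\<^sub>v (m j)" using tc(1)[of j] v by (intro eq_vecI) (auto simp: Suc)
      finally show ?thesis using Suc tc(1)[of i] v by (simp add: m)
    qed
    show "\<exists>b \<in> tor_boundaries D' i. x = b + ?f i *\<^sub>v (?g i *\<^sub>v x)" if x: "x \<in> tor_cycles D' i" for x
    proof -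
      have xc: "x \<in> carrier_vec (m i)" "- x \<in> carrier_vec (m i)" using x by (cases i; simp add: m)+
      have "tensor_k (f i * g i - 1\<^sub>m (m i)) *\<^sub>v (- x) \<in> tor_boundaries D' i"
      proof (cases i)
        case 0
        have "tensor_k (f i * g i - 1\<^sub>m (m i)) *\<^sub>v (- x) = ?D (Suc 0) *\<^sub>v (?h 0 *\<^sub>v (- x))"
          unfolding 0 h'(2) tensor_k_mult[OF c'(2) hc']
            assoc_mult_mat_vec[OF tc(5) tc(4) xc(2)[unfolded 0]] ..
        moreover have "?h 0 *\<^sub>v (- x) \<in> carrier_vec (m (Suc 0))" using tc(4)[of 0] xc 0 by auto
        ultimately show ?thesis unfolding tor_boundaries_def m 0 by blast
      next
        case (Suc j)
        note x' = xc(2)[unfolded Suc]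
        have D0: "?D (Suc j) *\<^sub>v (- x) = 0\<^sub>v (m j)"
        proof -
          have "- x = (-1) \<cdot>\<^sub>v x" by (intro eq_vecI) auto
          then have "?D (Suc j) *\<^sub>v (- x) = (-1) \<cdot>\<^sub>v (?D (Suc j) *\<^sub>v x)"
            using mult_mat_vec[OF tc(5) xc(1)[unfolded Suc], of "-1"] by simp
          also have "?D (Suc j) *\<^sub>v x = 0\<^sub>v (m j)" using x Suc by (simp add: m)
          finally show ?thesis by (intro eq_vecI) auto
        qed
        have "tensor_k (f i * g i - 1\<^sub>m (m i)) *\<^sub>v (- x) =
          ?D (Suc i) *\<^sub>v (?h i *\<^sub>v (- x)) + ?h j *\<^sub>v (?D (Suc j) *\<^sub>v (- x))"
          unfolding Suc h'(3) tensor_k_add[OF mult_carrier_mat[OF c'(2) hc'] mult_carrier_mat[OF hc' c'(2)]]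
            tensor_k_mult[OF c'(2) hc'] tensor_k_mult[OF hc' c'(2)]
            add_mult_distrib_mat_vec[OF mult_carrier_mat[OF tc(5) tc(4)] mult_carrier_mat[OF tc(4) tc(5)] x']
            assoc_mult_mat_vec[OF tc(5) tc(4) x'] assoc_mult_mat_vec[OF tc(4) tc(5) x'] ..
        also have "?h j *\<^sub>v (?D (Suc j) *\<^sub>v (- x)) = 0\<^sub>v (m (Suc j))"
          unfolding D0 using tc(4)[of j] by (intro eq_vecI) auto
        also have "?D (Suc i) *\<^sub>v (?h i *\<^sub>v (- x)) + 0\<^sub>v (m (Suc j)) = ?D (Suc i) *\<^sub>v (?h i *\<^sub>v (- x))"
          using mult_mat_vec_carrier[OF tc(5) mult_mat_vec_carrier[OF tc(4) xc(2)]] Suc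
          by (intro right_zero_vec) simp
        finally have "tensor_k (f i * g i - 1\<^sub>m (m i)) *\<^sub>v (- x) = ?D (Suc i) *\<^sub>v (?h i *\<^sub>v (- x))" .
        moreover have "?h i *\<^sub>v (- x) \<in> carrier_vec (m (Suc i))" using tc(4)[of i] xc by auto
        ultimately show ?thesis unfolding tor_boundaries_def m by blast
      qed
      with fg[OF xc(1)] show ?thesis by blast
    qed
  qed
  then show ?thesis by (simp add: betti_def D'_def n_def)
qed


section \<open>Homogeneous components and block triangular differentials\<close>

definition mdeg :: "('v \<Rightarrow>\<^sub>0 nat) \<Rightarrow> nat" where
  "mdeg m = (\<Sum>v\<in>Poly_Mapping.keys m. Poly_Mapping.lookup m v)"

lemma mdeg_superset: "finite A \<Longrightarrow> Poly_Mapping.keys m \<subseteq> A \<Longrightarrow> mdeg m = (\<Sum>v\<in>A. Poly_Mapping.lookup m v)"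
  unfolding mdeg_def by (rule sum.mono_neutral_left) (auto simp: in_keys_iff)

lemma mdeg_add: "mdeg (a + b) = mdeg a + mdeg b"
  unfolding mdeg_superset[of "Poly_Mapping.keys a \<union> Poly_Mapping.keys b" a, simplified]
    mdeg_superset[of "Poly_Mapping.keys a \<union> Poly_Mapping.keys b" b, simplified]
  by (simp add: mdeg_def keys_add_nat lookup_add sum.distrib)

lemma mdeg_zero [simp]: "mdeg 0 = 0" by (simp add: mdeg_def)

definition homog :: "nat \<Rightarrow> ('v, 'k::field) mpoly \<Rightarrow> bool" where
  "homog n p \<longleftrightarrow> (\<forall>m\<in>Poly_Mapping.keys p. mdeg m = n)"

definition hpart :: "nat \<Rightarrow> ('v, 'k::field) mpoly \<Rightarrow> ('v, 'k) mpoly" where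
  "hpart n p = Poly_Mapping.mapp (\<lambda>m c. c when mdeg m = n) p"

lemma lookup_hpart: "Poly_Mapping.lookup (hpart n p) m = (Poly_Mapping.lookup p m when mdeg m = n)"
  by (auto simp: hpart_def lookup_mapp when_def in_keys_iff)

lemma keys_hpart: "Poly_Mapping.keys (hpart n p) = {m \<in> Poly_Mapping.keys p. mdeg m = n}"
  by (auto simp: in_keys_iff lookup_hpart when_def split: if_splits)

lemma homog_hpart: "homog n (hpart n p)"
  by (simp add: homog_def keys_hpart)

lemma hpart_polys: "p \<in> polys V \<Longrightarrow> hpart n p \<in> polys V"
  by (simp add: polys_def keys_hpart)

lemma hpart_homog: "homog n p \<Longrightarrow> hpart n p = p"
  by (rule poly_mapping_eqI) (auto simp: lookup_hpart when_def homog_def in_keys_iff)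

lemma hpart_zero [simp]: "hpart n 0 = 0"
  by (rule poly_mapping_eqI) (simp add: lookup_hpart)

lemma hpart_add: "hpart n (p + q) = hpart n p + hpart n q"
  by (rule poly_mapping_eqI) (simp add: lookup_hpart lookup_add when_add_distrib)

lemma hpart_sum: "hpart n (sum f A) = (\<Sum>x\<in>A. hpart n (f x))"
  by (induction A rule: infinite_finite_induct) (simp_all add: hpart_add)

text \<open>Multiplication by a form of degree \<open>a\<close> shifts the grading by \<open>a\<close>; this
  lets one extract a homogeneous solution from any solution of a homogeneous linear system.\<close>

lemma hpart_mult_homog:
  assumes p: "homog a p"
  shows "hpart (a + n) (p * q) = p * hpart n q"
proof (rule poly_mapping_eqI)
  fix t
  have eq: "(Poly_Mapping.lookup p u * Sum_any (\<lambda>b. Poly_Mapping.lookup q b when t = u + b) when mdeg t = a + n) =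
     Poly_Mapping.lookup p u * Sum_any (\<lambda>b. Poly_Mapping.lookup (hpart n q) b when t = u + b)" for u
  proof (cases "Poly_Mapping.lookup p u = 0")
    case False
    then have u: "mdeg u = a" using p by (simp add: homog_def in_keys_iff)
    show ?thesis
    proof (cases "mdeg t = a + n")
      case True
      then have "(Poly_Mapping.lookup (hpart n q) b when t = u + b) = (Poly_Mapping.lookup q b when t = u + b)" for b
        using u by (auto simp: lookup_hpart when_def mdeg_add)
      then show ?thesis using True by simp
    next
      case False
      then have "(Poly_Mapping.lookup (hpart n q) b when t = u + b) = 0" for b
        using u by (auto simp: lookup_hpart when_def mdeg_add)
      then show ?thesis using False by simp
    qed
  qed simp
  show "Poly_Mapping.lookup (hpart (a + n) (p * q)) t = Poly_Mapping.lookup (p * hpart n q) t"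
    unfolding lookup_hpart[of _ "p * q"] lookup_mult eq[symmetric]
    by (cases "mdeg t = a + n") auto
qed

definition homog_mat :: "nat \<Rightarrow> ('v, 'k::field) mpoly mat \<Rightarrow> bool" where
  "homog_mat n A \<longleftrightarrow> (\<forall>i<dim_row A. \<forall>j<dim_col A. homog n (A $$ (i, j)))"

lemma pmat_hpart: "A \<in> pmat V r c \<Longrightarrow> map_mat (hpart n) A \<in> pmat V r c"
  by (auto simp: pmat_iff hpart_polys)

lemma homog_mat_hpart: "homog_mat n (map_mat (hpart n) A)"
  by (simp add: homog_mat_def homog_hpart)

lemma hpart_homog_mat: "homog_mat n A \<Longrightarrow> map_mat (hpart n) A = A"
  by (intro eq_matI) (auto simp: homog_mat_def hpart_homog)

lemma hpart_mult_homog_mat: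
  assumes A: "A \<in> carrier_mat r n" "homog_mat a A" and B: "B \<in> carrier_mat n c"
  shows "map_mat (hpart (a + k)) (A * B) = A * map_mat (hpart k) B"
proof (rule eq_matI)
  fix i j assume "i < dim_row (A * map_mat (hpart k) B)" "j < dim_col (A * map_mat (hpart k) B)"
  then have ij: "i < r" "j < c" using A B by auto
  have "hpart (a + k) (A $$ (i, l) * B $$ (l, j)) = A $$ (i, l) * hpart k (B $$ (l, j))" if "l < n" for l
    using A that ij by (intro hpart_mult_homog) (auto simp: homog_mat_def)
  then show "map_mat (hpart (a + k)) (A * B) $$ (i, j) = (A * map_mat (hpart k) B) $$ (i, j)"
    using A(1) B ij by (simp add: scalar_prod_def hpart_sum)
qed (use A B in auto)

lemma hpart_mult_homog_mat_right:
  assumes B: "B \<in> carrier_mat r n" and A: "A \<in> carrier_mat n c" "homog_mat a A"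
  shows "map_mat (hpart (a + k)) (B * A) = map_mat (hpart k) B * A"
proof (rule eq_matI)
  fix i j assume "i < dim_row (map_mat (hpart k) B * A)" "j < dim_col (map_mat (hpart k) B * A)"
  then have ij: "i < r" "j < c" using A B by auto
  have "hpart (a + k) (B $$ (i, l) * A $$ (l, j)) = hpart k (B $$ (i, l)) * A $$ (l, j)" if "l < n" for l
    unfolding mult.commute[of _ "A $$ (l, j)"]
    using A that ij by (intro hpart_mult_homog) (auto simp: homog_mat_def)
  then show "map_mat (hpart (a + k)) (B * A) $$ (i, j) = (map_mat (hpart k) B * A) $$ (i, j)"
    using A(1) B ij by (simp add: scalar_prod_def hpart_sum)
qed (use A B in auto)

lemma append_vec_free_mod:
  "u \<in> free_mod V n \<Longrightarrow> w \<in> free_mod V k \<Longrightarrow> u @\<^sub>v w \<in> free_mod V (n + k)"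
  by (auto simp: free_mod_def)

lemma free_mod_append_cases:
  assumes "v \<in> free_mod V (n + k)"
  obtains u w where "u \<in> free_mod V n" "w \<in> free_mod V k" "v = u @\<^sub>v w"
proof
  show "vec_first v n \<in> free_mod V n" "vec_last v k \<in> free_mod V k"
    using assms by (auto simp: free_mod_def vec_first_def vec_last_def)
  show "v = vec_first v n @\<^sub>v vec_last v k"
    using assms by (simp add: free_mod_def)
qed

lemma free_mod_add: "u \<in> free_mod V n \<Longrightarrow> v \<in> free_mod V n \<Longrightarrow> u + v \<in> free_mod V n"
  by (auto simp: free_mod_def intro!: polys_add)

lemma free_mod_uminus: "u \<in> free_mod V n \<Longrightarrow> - u \<in> free_mod V n"
  by (auto simp: free_mod_def intro!: polys_uminus)

text \<open>Exactness of a mapping cone at one spot. From \<open>D1 u + P1 w = 0\<close> and \<open>G1 w =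
  0\<close>, the hypothesis \<open>lift\<close> gives \<open>w = G2 y\<close>; then \<open>D1 (u -
  P2 y) = 0\<close> by anticommutativity, and exactness of \<open>D\<close> finishes. The hypothesis
  \<open>lift\<close> may use both equations: at the bottom of the cone \<open>G1\<close> is the
  zero map on the ring, and it is the first equation that puts \<open>w\<close> into the colon
  ideal.\<close>

lemma block_triangular_exact:
  assumes D1: "D1 \<in> pmat V r n1" and D2: "D2 \<in> pmat V n1 n2"
    and P1: "P1 \<in> pmat V r k1" and P2: "P2 \<in> pmat V n1 k2"
    and G1: "G1 \<in> pmat V s k1" and G2: "G2 \<in> pmat V k1 k2"
    and ex: "{v \<in> free_mod V n1. D1 *\<^sub>v v = 0\<^sub>v r} = {D2 *\<^sub>v w |w. w \<in> free_mod V n2}"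
    and DP: "D1 * P2 = - (P1 * G2)" and GG: "G1 * G2 = 0\<^sub>m s k2"
    and lift: "\<And>u w. u \<in> free_mod V n1 \<Longrightarrow> w \<in> free_mod V k1 \<Longrightarrow> D1 *\<^sub>v u + P1 *\<^sub>v w = 0\<^sub>v r \<Longrightarrow>
        G1 *\<^sub>v w = 0\<^sub>v s \<Longrightarrow> \<exists>y \<in> free_mod V k2. w = G2 *\<^sub>v y"
  shows "{v \<in> free_mod V (n1 + k1). four_block_mat D1 P1 (0\<^sub>m s n1) G1 *\<^sub>v v = 0\<^sub>v (r + s)} =
     {four_block_mat D2 P2 (0\<^sub>m k1 n2) G2 *\<^sub>v w |w. w \<in> free_mod V (n2 + k2)}"
    (is "?L = ?R")
proof -
  note c = pmat_carrier[OF D1] pmat_carrier[OF D2] pmat_carrier[OF P1] pmat_carrier[OF P2]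
    pmat_carrier[OF G1] pmat_carrier[OF G2]
  note fc = free_mod_carrier
  have z: "0\<^sub>m a b *\<^sub>v v = 0\<^sub>v a" if "v \<in> carrier_vec b" for a b and v :: "('a, 'b) mpoly vec"
    using that by (intro eq_vecI) auto
  have z0: "(0\<^sub>v (r + s) :: ('a, 'b) mpoly vec) = 0\<^sub>v r @\<^sub>v 0\<^sub>v s"
    by (intro eq_vecI) auto
  have E1: "four_block_mat D1 P1 (0\<^sub>m s n1) G1 *\<^sub>v (u @\<^sub>v w) = (D1 *\<^sub>v u + P1 *\<^sub>v w) @\<^sub>v (G1 *\<^sub>v w)"
    if "u \<in> free_mod V n1" "w \<in> free_mod V k1" for u w
    using four_block_mat_mult_vec[OF c(1) c(3) zero_carrier_mat c(5) fc[OF that(1)] fc[OF that(2)]]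
      z[OF fc[OF that(1)]] left_zero_vec[OF mult_mat_vec_carrier[OF c(5) fc[OF that(2)]]] by simp
  have E2: "four_block_mat D2 P2 (0\<^sub>m k1 n2) G2 *\<^sub>v (u @\<^sub>v w) = (D2 *\<^sub>v u + P2 *\<^sub>v w) @\<^sub>v (G2 *\<^sub>v w)"
    if "u \<in> free_mod V n2" "w \<in> free_mod V k2" for u w
    using four_block_mat_mult_vec[OF c(2) c(4) zero_carrier_mat c(6) fc[OF that(1)] fc[OF that(2)]]
      z[OF fc[OF that(1)]] left_zero_vec[OF mult_mat_vec_carrier[OF c(6) fc[OF that(2)]]] by simp
  have split: "a @\<^sub>v b = 0\<^sub>v (r + s) \<longleftrightarrow> a = 0\<^sub>v r \<and> b = 0\<^sub>v s"
    if "a \<in> carrier_vec r" for a b :: "('a, 'b) mpoly vec"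
    unfolding z0 using append_vec_eq[OF that zero_carrier_vec, of b "0\<^sub>v s"] .
  have DPv: "D1 *\<^sub>v (P2 *\<^sub>v y) = - (P1 *\<^sub>v (G2 *\<^sub>v y))" if y: "y \<in> free_mod V k2" for y
  proof -
    have "D1 *\<^sub>v (P2 *\<^sub>v y) = (- (P1 * G2)) *\<^sub>v y"
      using assoc_mult_mat_vec[OF c(1) c(4) fc[OF y]] by (simp add: DP)
    also have "\<dots> = - ((P1 * G2) *\<^sub>v y)"
      using c(3,6) fc[OF y] by (intro eq_vecI) auto
    finally show ?thesis unfolding assoc_mult_mat_vec[OF c(3) c(6) fc[OF y]] .
  qed
  have GGv: "G1 *\<^sub>v (G2 *\<^sub>v y) = 0\<^sub>v s" if y: "y \<in> free_mod V k2" for y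
    unfolding assoc_mult_mat_vec[OF c(5) c(6) fc[OF y], symmetric] GG z[OF fc[OF y]] ..
  have D1_add: "D1 *\<^sub>v (u + v) = D1 *\<^sub>v u + D1 *\<^sub>v v" if "u \<in> free_mod V n1" "v \<in> free_mod V n1" for u v
    using mult_add_distrib_mat_vec[OF c(1) fc[OF that(1)] fc[OF that(2)]] .
  have D1c: "D1 *\<^sub>v u \<in> carrier_vec r" for u using c(1) by (intro carrier_vecI) auto
  have P1c: "P1 *\<^sub>v u \<in> carrier_vec r" for u using c(3) by (intro carrier_vecI) auto
  show ?thesis
  proof (rule subset_antisym; rule subsetI)
    fix v assume "v \<in> ?L"
    then obtain u w where uw: "u \<in> free_mod V n1" "w \<in> free_mod V k1" "v = u @\<^sub>v w"
      and eq: "four_block_mat D1 P1 (0\<^sub>m s n1) G1 *\<^sub>v v = 0\<^sub>v (r + s)"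
      by (auto elim: free_mod_append_cases)
    have eqs: "D1 *\<^sub>v u + P1 *\<^sub>v w = 0\<^sub>v r" "G1 *\<^sub>v w = 0\<^sub>v s"
      using eq E1[OF uw(1,2)] split[of "D1 *\<^sub>v u + P1 *\<^sub>v w"] D1c P1c uw(3) by auto
    from lift[OF uw(1,2) eqs] obtain y where y: "y \<in> free_mod V k2" "w = G2 *\<^sub>v y" by blast
    have Py: "P2 *\<^sub>v y \<in> free_mod V n1" by (rule pmat_mult_vec[OF P2 y(1)])
    have "D1 *\<^sub>v (- (P2 *\<^sub>v y)) = P1 *\<^sub>v w"
    proof -
      have "- (P2 *\<^sub>v y) + P2 *\<^sub>v y = 0\<^sub>v n1" using fc[OF Py] by simp
      moreover have "D1 *\<^sub>v 0\<^sub>v n1 = 0\<^sub>v r" using c(1) by (intro eq_vecI) auto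
      ultimately have "D1 *\<^sub>v (- (P2 *\<^sub>v y)) + - (P1 *\<^sub>v w) = 0\<^sub>v r"
        using D1_add[OF free_mod_uminus[OF Py] Py] DPv[OF y(1)] y(2) by simp
      moreover have "a = b" if "a + - b = 0\<^sub>v r" "a \<in> carrier_vec r" "b \<in> carrier_vec r"
        for a b :: "('a, 'b) mpoly vec"
      proof (rule eq_vecI)
        fix i assume "i < dim_vec b"
        then have "a $ i + - (b $ i) = 0" using arg_cong[OF that(1), of "\<lambda>v. v $ i"] that(2,3) by auto
        then show "a $ i = b $ i" by simp
      qed (use that in auto)
      ultimately show ?thesis using D1c P1c by blast
    qed
    then have "D1 *\<^sub>v (u + - (P2 *\<^sub>v y)) = 0\<^sub>v r"
      using D1_add[OF uw(1) free_mod_uminus[OF Py]] eqs(1) by simp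
    then have "u + - (P2 *\<^sub>v y) \<in> {v \<in> free_mod V n1. D1 *\<^sub>v v = 0\<^sub>v r}"
      using free_mod_add[OF uw(1) free_mod_uminus[OF Py]] by simp
    then obtain x where x: "x \<in> free_mod V n2" "u + - (P2 *\<^sub>v y) = D2 *\<^sub>v x" unfolding ex by blast
    have "u = D2 *\<^sub>v x + P2 *\<^sub>v y"
      unfolding x(2)[symmetric] using fc[OF uw(1)] fc[OF Py] by (intro eq_vecI) (auto simp del: index_mult_mat_vec)
    then have "v = four_block_mat D2 P2 (0\<^sub>m k1 n2) G2 *\<^sub>v (x @\<^sub>v y)"
      using E2[OF x(1) y(1)] uw(3) y(2) by simp
    then show "v \<in> ?R" using append_vec_free_mod[OF x(1) y(1)] by blast
  next
    fix v assume "v \<in> ?R"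
    then obtain x y where xy: "x \<in> free_mod V n2" "y \<in> free_mod V k2"
      and v: "v = four_block_mat D2 P2 (0\<^sub>m k1 n2) G2 *\<^sub>v (x @\<^sub>v y)"
      by (auto elim: free_mod_append_cases)
    have f: "D2 *\<^sub>v x \<in> free_mod V n1" "P2 *\<^sub>v y \<in> free_mod V n1" "G2 *\<^sub>v y \<in> free_mod V k1"
      using xy D2 P2 G2 by (auto intro: pmat_mult_vec)
    have "D2 *\<^sub>v x \<in> {v \<in> free_mod V n1. D1 *\<^sub>v v = 0\<^sub>v r}" unfolding ex using xy(1) by blast
    then have "D1 *\<^sub>v (D2 *\<^sub>v x) = 0\<^sub>v r" by simp
    then have "D1 *\<^sub>v (D2 *\<^sub>v x + P2 *\<^sub>v y) + P1 *\<^sub>v (G2 *\<^sub>v y) = 0\<^sub>v r"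
      using D1_add[OF f(1,2)] DPv[OF xy(2)] P1c[of "G2 *\<^sub>v y"] by simp
    then have "four_block_mat D1 P1 (0\<^sub>m s n1) G1 *\<^sub>v v = 0\<^sub>v (r + s)"
      unfolding v E2[OF xy] E1[OF free_mod_add[OF f(1,2)] f(3)] GGv[OF xy(2)] z0 by simp
    moreover have "v \<in> free_mod V (n1 + k1)"
      unfolding v E2[OF xy] by (intro append_vec_free_mod free_mod_add f)
    ultimately show "v \<in> ?L" by simp
  qed
qed


section \<open>Linear resolutions and mapping cones\<close>

text \<open>The rank in homological degree \<open>i - 1\<close>, where the ring itself sits in degree
  \<open>-1\<close> as the target of the augmentation. It is also the rank sequence of the
  resolution of \<open>S / I\<close> that extends one of \<open>I\<close>.\<close>

fun rank_below :: "(nat \<Rightarrow> nat) \<Rightarrow> nat \<Rightarrow> nat" where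
  "rank_below b 0 = 1"
| "rank_below b (Suc i) = b i"

text \<open>A free resolution of an ideal generated in degree \<open>d\<close> whose higher differentials
  consist of linear forms. The ranks \<open>b\<close> are a parameter, so that a construction can
  prescribe them.\<close>

definition linear_resolution ::
  "'v set \<Rightarrow> ('v, 'k::field) mpoly set \<Rightarrow> nat \<Rightarrow> (nat \<Rightarrow> nat) \<Rightarrow> (nat \<Rightarrow> ('v, 'k) mpoly mat) \<Rightarrow> bool" where
  "linear_resolution V I d b D \<longleftrightarrow>
     (\<forall>i. D i \<in> pmat V (rank_below b i) (b i)) \<and>
     homog_mat d (D 0) \<and> (\<forall>i. homog_mat 1 (D (Suc i))) \<and>
     {(D 0 *\<^sub>v v) $ 0 | v. v \<in> free_mod V (b 0)} = I \<and>
     (\<forall>i. {v \<in> free_mod V (b i). D i *\<^sub>v v = 0\<^sub>v (rank_below b i)} =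
          {D (Suc i) *\<^sub>v w | w. w \<in> free_mod V (b (Suc i))})"

lemma linear_resolutionD:
  assumes "linear_resolution V I d b D"
  shows "D i \<in> pmat V (rank_below b i) (b i)" "homog_mat d (D 0)" "homog_mat 1 (D (Suc i))"
    "{(D 0 *\<^sub>v v) $ 0 | v. v \<in> free_mod V (b 0)} = I"
    "{v \<in> free_mod V (b i). D i *\<^sub>v v = 0\<^sub>v (rank_below b i)} =
          {D (Suc i) *\<^sub>v w | w. w \<in> free_mod V (b (Suc i))}"
  using assms unfolding linear_resolution_def by blast+

lemma linear_resolution_dim_col:
  assumes "linear_resolution V I d b D"
  shows "dim_col (D i) = b i" "dim_row (D i) = rank_below b i"
  using pmat_carrier[OF linear_resolutionD(1)[OF assms, of i]] by auto

lemma linear_resolution_free: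
  assumes "linear_resolution V I d b D"
  shows "free_resolution V I D"
  unfolding free_resolution_def linear_resolution_dim_col[OF assms] rank_below.simps
  by (intro conjI allI refl linear_resolutionD(4,5)[OF assms])
     (use linear_resolutionD(1)[OF assms] in \<open>auto simp: pmat_def\<close>)

text \<open>Linear forms have no constant term, so a linear resolution is minimal.\<close>

lemma betti_linear_resolution:
  assumes "linear_resolution V I d b D"
  shows "betti V I i = b i"
proof -
  have "Poly_Mapping.lookup p 0 = 0" if "homog 1 p" for p :: "('a, 'b) mpoly"
    using that by (metis homog_def in_keys_iff mdeg_zero zero_neq_one)
  then have "tensor_k (D (Suc j)) = 0\<^sub>m (dim_col (D j)) (dim_col (D (Suc j)))" for j
    using linear_resolutionD(3)[OF assms, of j]
    by (intro eq_matI) (auto simp: tensor_k_def homog_mat_def linear_resolution_dim_col[OF assms])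
  then have "betti V I i = dim_col (D i)"
    by (rule betti_eq_of_minimal_resolution[OF linear_resolution_free[OF assms]])
  then show ?thesis by (simp add: linear_resolution_dim_col[OF assms])
qed

lemma linear_resolution_zero_ideal:
  "linear_resolution V {0} d (\<lambda>_. 0) (\<lambda>i. 0\<^sub>m (rank_below (\<lambda>_. 0) i) 0)"
proof -
  have fm: "free_mod V 0 = {0\<^sub>v 0}" by (auto simp: free_mod_def)
  have z: "0\<^sub>m a 0 *\<^sub>v v = 0\<^sub>v a" if "dim_vec v = 0" for a and v :: "('a, 'b) mpoly vec"
    using that by (intro eq_vecI) (auto simp: scalar_prod_def)
  show ?thesis unfolding linear_resolution_def fm
    by (auto simp: homog_mat_def z)
qed

lemma four_block_pmat:
  assumes "A \<in> pmat V r1 c1" "B \<in> pmat V r1 c2" "C \<in> pmat V r2 c1" "D \<in> pmat V r2 c2"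
  shows "four_block_mat A B C D \<in> pmat V (r1 + r2) (c1 + c2)"
  using assms by (auto simp: pmat_iff)

lemma homog_mat_uminus: "homog_mat n A \<Longrightarrow> homog_mat n (- A)"
  by (auto simp: homog_mat_def homog_def in_keys_iff)

lemma homog_zero [simp]: "homog n 0"
  by (simp add: homog_def)

lemma homog_mat_four_block:
  assumes "A \<in> carrier_mat r1 c1" "B \<in> carrier_mat r1 c2" "C \<in> carrier_mat r2 c1" "D \<in> carrier_mat r2 c2"
    and "homog_mat n A" "homog_mat n B" "homog_mat n C" "homog_mat n D"
  shows "homog_mat n (four_block_mat A B C D)"
  using assms by (auto simp: homog_mat_def)

lemma homog_mult: "homog a p \<Longrightarrow> homog b q \<Longrightarrow> homog (a + b) (p * q)"
  using homog_hpart[of "a + b" "p * q"] hpart_mult_homog[of a p b q] hpart_homog[of b q] by simp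

text \<open>Multiplication by \<open>m\<close> maps \<open>Q = I : m\<close> into \<open>I\<close> and lifts
  to the resolutions. The minus sign makes the blocks of the cone anticommute; it is obtained by
  lifting along the complex with differentials \<open>- G\<close>. All equations for the lift are
  homogeneous, so the component of degree one of an arbitrary lift is again a lift.\<close>

lemma linear_lift_exists:
  assumes D: "linear_resolution V I d b D" and G: "linear_resolution V Q 1 g G"
    and Q: "Q = {q \<in> polys V. q * m \<in> I}" and m: "m \<in> polys V" "homog d m"
  shows "\<exists>f. (\<forall>i. f i \<in> pmat V (b i) (g i)) \<and> (\<forall>i. homog_mat 1 (f i)) \<and> D 0 * f 0 = m \<cdot>\<^sub>m G 0 \<and>
           (\<forall>i. D (Suc i) * f (Suc i) = - (f i * G (Suc i)))"
proof -
  note D' = linear_resolution_free[OF D] and G' = linear_resolution_free[OF G]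
  note n = linear_resolution_dim_col[OF D] and k = linear_resolution_dim_col[OF G]
  have Dc: "D 0 \<in> pmat V 1 (b 0)" "D (Suc i) \<in> pmat V (b i) (b (Suc i))" for i
    using linear_resolutionD(1)[OF D, of 0] linear_resolutionD(1)[OF D, of "Suc i"] by simp_all
  have Gc: "G 0 \<in> pmat V 1 (g 0)" "G (Suc i) \<in> pmat V (g i) (g (Suc i))" for i
    using linear_resolutionD(1)[OF G, of 0] linear_resolutionD(1)[OF G, of "Suc i"] by simp_all
  note dc = Dc[THEN pmat_carrier] and gc = Gc[THEN pmat_carrier]
  have GG: "G i * G (Suc i) = 0\<^sub>m (rank_below g i) (g (Suc i))" for i
    using free_resolution_complex[OF G', of i] by (simp add: k)
  have kk: "dim_col (- G i) = g i" for i by (simp add: k)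
  have mG: "m \<cdot>\<^sub>m G 0 \<in> pmat V 1 (g 0)"
    using Gc(1) m(1) by (auto simp: pmat_iff intro!: polys_mult)
  have "\<exists>f. (\<forall>i. f i \<in> pmat V (b i) (g i)) \<and> D 0 * f 0 = m \<cdot>\<^sub>m G 0 \<and>
           (\<forall>i. D (Suc i) * f (Suc i) = f i * (- G (Suc i)))"
  proof (rule chain_map_exists[OF D', of "\<lambda>i. - G i", unfolded n kk, OF _ _ mG])
    show "- G (Suc i) \<in> pmat V (g i) (g (Suc i))" for i by (rule pmat_uminus[OF Gc(2)])
    show "- G (Suc i) * - G (Suc (Suc i)) = 0\<^sub>m (g i) (g (Suc (Suc i)))" for i
    proof -
      have "- G (Suc i) * - G (Suc (Suc i)) = - (- (G (Suc i) * G (Suc (Suc i))))"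
        using gc(2)[of i] gc(2)[of "Suc i"] uminus_mult_left_mat[of "G (Suc i)" "- G (Suc (Suc i))"]
          uminus_mult_right_mat[of "G (Suc i)" "G (Suc (Suc i))"] by simp
      also have "\<dots> = 0\<^sub>m (g i) (g (Suc (Suc i)))" unfolding GG[of "Suc i"] by (intro eq_matI) auto
      finally show ?thesis .
    qed
    show "(m \<cdot>\<^sub>m G 0) $$ (0, j) \<in> I" if j: "j < g 0" for j
    proof -
      have "G 0 $$ (0, j) \<in> Q" using free_resolution_augmentation_entries[OF G'] j by (simp add: k)
      then show ?thesis using j gc(1) by (simp add: Q mult.commute)
    qed
    show "(m \<cdot>\<^sub>m G 0) * - G (Suc 0) = 0\<^sub>m 1 (g (Suc 0))"
    proof -
      have "(m \<cdot>\<^sub>m G 0) * - G (Suc 0) = - (m \<cdot>\<^sub>m (G 0 * G (Suc 0)))"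
        using gc(1) gc(2)[of 0] mult_smult_assoc_mat[OF gc(1) gc(2)] by simp
      then show ?thesis unfolding GG[of 0] by (auto intro!: eq_matI)
    qed
  qed
  \<comment> \<open>The component of degree one of this lift has linear entries and satisfies the same equations.\<close>
  then obtain f where f: "\<And>i. f i \<in> pmat V (b i) (g i)" "D 0 * f 0 = m \<cdot>\<^sub>m G 0"
    "\<And>i. D (Suc i) * f (Suc i) = f i * (- G (Suc i))" by blast
  note fc = f(1)[THEN pmat_carrier]
  define f' where "f' i = map_mat (hpart 1) (f i)" for i
  have f'c: "f' i \<in> pmat V (b i) (g i)" for i unfolding f'_def by (rule pmat_hpart[OF f(1)])
  have "homog_mat (d + 1) (m \<cdot>\<^sub>m G 0)"
    using linear_resolutionD(2)[OF G] m(2) homog_mult[of d m 1] unfolding homog_mat_def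
    by auto
  then have "D 0 * f' 0 = m \<cdot>\<^sub>m G 0"
    unfolding f'_def hpart_mult_homog_mat[OF dc(1) linear_resolutionD(2)[OF D] fc, symmetric] f(2)
    by (rule hpart_homog_mat)
  moreover have "D (Suc i) * f' (Suc i) = - (f' i * G (Suc i))" for i
  proof -
    have "homog_mat 1 (- G (Suc i))" by (rule homog_mat_uminus[OF linear_resolutionD(3)[OF G]])
    from hpart_mult_homog_mat_right[OF fc uminus_carrier_mat[OF gc(2)] this, of 1]
    have "D (Suc i) * f' (Suc i) = f' i * (- G (Suc i))"
      unfolding f'_def hpart_mult_homog_mat[OF dc(2) linear_resolutionD(3)[OF D] fc, symmetric] f(3) by simp
    also have "\<dots> = - (f' i * G (Suc i))"
      using pmat_carrier[OF f'c[of i]] gc(2)[of i] by (intro uminus_mult_right_mat) auto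
    finally show ?thesis .
  qed
  moreover have "homog_mat 1 (f' i)" for i unfolding f'_def by (rule homog_mat_hpart)
  ultimately show ?thesis using f'c by blast
qed

text \<open>The sequence \<open>0 \<rightarrow> S / (I : m) \<rightarrow> S / I \<rightarrow> S / (I + (m))
  \<rightarrow> 0\<close>, with the first map multiplication by \<open>m\<close>, makes the mapping
  cone of the lift a resolution of \<open>I + (m)\<close>. The second complex is the resolution of
  \<open>S / Q\<close>, whence the ranks \<open>rank_below g\<close>.\<close>

lemma linear_resolution_mapping_cone:
  assumes D: "linear_resolution V I d b D" and G: "linear_resolution V Q 1 g G"
    and Q: "Q = {q \<in> polys V. q * m \<in> I}" and m: "m \<in> polys V" "homog d m"
  shows "\<exists>E. linear_resolution V {a + q * m | a q. a \<in> I \<and> q \<in> polys V} d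
           (\<lambda>i. b i + rank_below g i) E"
proof -
  obtain f where f: "\<And>i. f i \<in> pmat V (b i) (g i)" "\<And>i. homog_mat 1 (f i)" "D 0 * f 0 = m \<cdot>\<^sub>m G 0"
    "\<And>i. D (Suc i) * f (Suc i) = - (f i * G (Suc i))"
    using linear_lift_exists[OF D G Q m] by blast
  \<comment> \<open>\<open>G'\<close> is the resolution of \<open>S / Q\<close>: the ring, mapped to a zero module, followed by \<open>G\<close>.
    The entry \<open>- m\<close> of \<open>f'\<close> makes its lowest square anticommute like the others.\<close>
  define s where "s i = (case i of 0 \<Rightarrow> 0 | Suc i \<Rightarrow> rank_below g i)" for i :: nat
  define G' where "G' i = (case i of 0 \<Rightarrow> 0\<^sub>m 0 1 | Suc i \<Rightarrow> G i)" for i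
  define f' where "f' i = (case i of 0 \<Rightarrow> mat 1 1 (\<lambda>_. - m) | Suc i \<Rightarrow> f i)" for i
  define E where "E i = four_block_mat (D i) (f' i) (0\<^sub>m (s i) (b i)) (G' i)" for i
  define c where "c i = b i + rank_below g i" for i
  note Dc = linear_resolutionD(1)[OF D] and Gc = linear_resolutionD(1)[OF G]
  have m1: "mat 1 1 (\<lambda>_. - m) \<in> pmat V 1 1" using m(1) by (auto simp: pmat_iff polys_uminus)
  have G'c: "G' i \<in> pmat V (s i) (rank_below g i)" for i
    using Gc by (cases i) (auto simp: G'_def s_def)
  have f'c: "f' i \<in> pmat V (rank_below b i) (rank_below g i)" for i
    using m1 f(1) by (cases i) (auto simp: f'_def)
  have rb: "rank_below c i = rank_below b i + s i" for i by (cases i) (auto simp: c_def s_def)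
  have Ec: "E i \<in> pmat V (rank_below c i) (c i)" for i
    unfolding E_def rb c_def by (rule four_block_pmat[OF Dc f'c pmat_zero G'c])
  have mv: "(mat 1 1 (\<lambda>_. - m) *\<^sub>v w) $ 0 = - (m * w $ 0)" if "w \<in> free_mod V 1" for w
    using that by (auto simp: free_mod_def scalar_prod_def)
  have lift: "\<exists>y \<in> free_mod V (g i). w = G' (Suc i) *\<^sub>v y"
    if u: "u \<in> free_mod V (b i)" and w: "w \<in> free_mod V (rank_below g i)"
      and eq: "D i *\<^sub>v u + f' i *\<^sub>v w = 0\<^sub>v (rank_below b i)" and Gw: "G' i *\<^sub>v w = 0\<^sub>v (s i)" for i u w
  proof (cases i)
    case 0
    have w1: "w \<in> free_mod V 1" and wV: "w $ 0 \<in> polys V" using w 0 by (auto simp: free_mod_def)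
    have "(D 0 *\<^sub>v u) $ 0 + (f' 0 *\<^sub>v w) $ 0 = 0"
      using arg_cong[OF eq, of "\<lambda>v. v $ 0"] f'c[of 0] 0 unfolding pmat_def by auto
    then have "(D 0 *\<^sub>v u) $ 0 - m * w $ 0 = 0"
      by (simp add: f'_def mv[OF w1] del: index_mult_mat_vec One_nat_def)
    then have "w $ 0 * m = (D 0 *\<^sub>v u) $ 0" by (metis eq_iff_diff_eq_0 mult.commute)
    also have "\<dots> \<in> I" unfolding linear_resolutionD(4)[OF D, symmetric] using u 0 by blast
    finally have "w $ 0 \<in> Q" using wV by (simp add: Q)
    then obtain y where y: "y \<in> free_mod V (g 0)" "w $ 0 = (G 0 *\<^sub>v y) $ 0"
      unfolding linear_resolutionD(4)[OF G, symmetric] by blast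
    have "w = G' (Suc 0) *\<^sub>v y"
      using y(2) w1 Gc[of 0] by (intro eq_vecI) (auto simp: G'_def free_mod_def pmat_def simp del: index_mult_mat_vec)
    then show ?thesis using y(1) 0 by blast
  next
    case (Suc j)
    have "w \<in> {v \<in> free_mod V (g j). G j *\<^sub>v v = 0\<^sub>v (rank_below g j)}"
      using w Gw by (simp add: Suc G'_def s_def)
    then show ?thesis unfolding linear_resolutionD(5)[OF G] by (auto simp: Suc G'_def)
  qed
  have "linear_resolution V {a + q * m | a q. a \<in> I \<and> q \<in> polys V} d c E"
    unfolding linear_resolution_def
  proof (intro conjI allI Ec)
    show "homog_mat d (E 0)"
      unfolding E_def
    proof (rule homog_mat_four_block[OF pmat_carrier[OF Dc] pmat_carrier[OF f'c] zero_carrier_mat pmat_carrier[OF G'c]])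
      show "homog_mat d (D 0)" by (rule linear_resolutionD(2)[OF D])
      show "homog_mat d (f' 0)" using m(2) by (auto simp: homog_mat_def f'_def homog_def in_keys_iff)
    qed (simp_all add: homog_mat_def s_def G'_def)
    show "homog_mat 1 (E (Suc i))" for i
    proof -
      have "homog_mat 1 (G i)" using linear_resolutionD(2,3)[OF G] by (cases i) auto
      then show ?thesis unfolding E_def using f(2) linear_resolutionD(3)[OF D]
        by (intro homog_mat_four_block[OF pmat_carrier[OF Dc] pmat_carrier[OF f'c] zero_carrier_mat pmat_carrier[OF G'c]])
          (simp_all add: f'_def G'_def, simp add: homog_mat_def)
    qed
    have DP: "D i * f' (Suc i) = - (f' i * G' (Suc i))" for i
    proof (cases i)
      case 0
      have "m \<cdot>\<^sub>m G 0 = - (mat 1 1 (\<lambda>_. - m) * G 0)"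
        using pmat_carrier[OF Gc[of 0]] by (intro eq_matI) (auto simp: scalar_prod_def)
      then show ?thesis using f(3) 0 by (simp add: f'_def G'_def)
    next
      case (Suc j)
      then show ?thesis using f(4) by (simp add: f'_def G'_def)
    qed
    have GG: "G' i * G' (Suc i) = 0\<^sub>m (s i) (g i)" for i
    proof (cases i)
      case 0
      then show ?thesis using pmat_carrier[OF Gc[of 0]] by (simp add: G'_def s_def)
    next
      case (Suc j)
      then show ?thesis using free_resolution_complex[OF linear_resolution_free[OF G], of j]
        by (simp add: G'_def s_def linear_resolution_dim_col[OF G])
    qed
    have s: "s (Suc i) = rank_below g i" for i by (simp add: s_def)
    show "{v \<in> free_mod V (c i). E i *\<^sub>v v = 0\<^sub>v (rank_below c i)} =
          {E (Suc i) *\<^sub>v w |w. w \<in> free_mod V (c (Suc i))}" for i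
      unfolding E_def c_def rb[unfolded c_def] s rank_below.simps
      by (rule block_triangular_exact[OF Dc Dc[of "Suc i", unfolded rank_below.simps] f'c
            f'c[of "Suc i", unfolded rank_below.simps] G'c G'c[of "Suc i", unfolded s rank_below.simps]
            linear_resolutionD(5)[OF D] DP GG lift])
    show "{(E 0 *\<^sub>v v) $ 0 |v. v \<in> free_mod V (c 0)} = {a + q * m | a q. a \<in> I \<and> q \<in> polys V}"
    proof -
      have E0: "(E 0 *\<^sub>v (u @\<^sub>v w)) $ 0 = (D 0 *\<^sub>v u) $ 0 + (- w $ 0) * m"
        if u: "u \<in> free_mod V (b 0)" and w: "w \<in> free_mod V 1" for u w
      proof -
        have r: "dim_row (D 0) = 1" by (simp add: linear_resolution_dim_col[OF D])
        have "E 0 *\<^sub>v (u @\<^sub>v w) = (D 0 *\<^sub>v u + mat 1 1 (\<lambda>_. - m) *\<^sub>v w) @\<^sub>v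
           (0\<^sub>m 0 (b 0) *\<^sub>v u + 0\<^sub>m 0 1 *\<^sub>v w)"
          using four_block_mat_mult_vec[OF pmat_carrier[OF Dc[of 0]] pmat_carrier[OF f'c[of 0]]
              zero_carrier_mat pmat_carrier[OF G'c[of 0]] free_mod_carrier[OF u], of w]
            free_mod_carrier[OF w] by (simp add: E_def s_def f'_def G'_def)
        then show ?thesis using mv[OF w] r by (simp add: mult.commute del: index_mult_mat_vec)
      qed
      have c0: "c 0 = b 0 + 1" by (simp add: c_def)
      show ?thesis
      proof (rule subset_antisym; rule subsetI)
        fix x assume "x \<in> {(E 0 *\<^sub>v v) $ 0 |v. v \<in> free_mod V (c 0)}"
        then obtain v where v: "v \<in> free_mod V (b 0 + 1)" "x = (E 0 *\<^sub>v v) $ 0"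
          unfolding c0 by blast
        from v(1) obtain u w where uw: "u \<in> free_mod V (b 0)" "w \<in> free_mod V 1" "v = u @\<^sub>v w"
          by (rule free_mod_append_cases)
        have "(D 0 *\<^sub>v u) $ 0 \<in> I" unfolding linear_resolutionD(4)[OF D, symmetric] using uw(1) by blast
        moreover have "- w $ 0 \<in> polys V" using uw(2) by (auto simp: free_mod_def polys_uminus)
        ultimately show "x \<in> {a + q * m | a q. a \<in> I \<and> q \<in> polys V}" using E0[OF uw(1,2)] uw(3) v(2) by blast
      next
        fix x assume "x \<in> {a + q * m | a q. a \<in> I \<and> q \<in> polys V}"
        then obtain u q where u: "u \<in> free_mod V (b 0)" and q: "q \<in> polys V" and x: "x = (D 0 *\<^sub>v u) $ 0 + q * m"
          unfolding linear_resolutionD(4)[OF D, symmetric] by blast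
        define w where "w = vec 1 (\<lambda>_. - q)"
        have w: "w \<in> free_mod V 1" "- w $ 0 = q" using q by (auto simp: w_def free_mod_def polys_uminus)
        have "x = (E 0 *\<^sub>v (u @\<^sub>v w)) $ 0" using E0[OF u w(1)] w(2) x by simp
        then show "x \<in> {(E 0 *\<^sub>v v) $ 0 |v. v \<in> free_mod V (c 0)}"
          unfolding c0 using append_vec_free_mod[OF u w(1)] by blast
      qed
    qed
  qed
  then show ?thesis unfolding c_def[abs_def] by blast
qed


section \<open>Monomial ideals with linear quotients\<close>

definition mdvd :: "('v \<Rightarrow>\<^sub>0 nat) \<Rightarrow> ('v \<Rightarrow>\<^sub>0 nat) \<Rightarrow> bool" where
  "mdvd g t \<longleftrightarrow> (\<forall>v. Poly_Mapping.lookup g v \<le> Poly_Mapping.lookup t v)"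

lemma mdvd_add_cancel: "mdvd g t \<Longrightarrow> (t - g) + g = t"
  by (rule poly_mapping_eqI) (simp add: mdvd_def lookup_add lookup_minus)

lemma mdvd_refl [simp]: "mdvd g g"
  by (simp add: mdvd_def)

lemma mdvd_trans: "mdvd a b \<Longrightarrow> mdvd b c \<Longrightarrow> mdvd a c"
  unfolding mdvd_def using le_trans by blast

lemma mdvd_add: "mdvd g t \<Longrightarrow> mdvd g (s + t)"
  by (simp add: mdvd_def lookup_add trans_le_add2)

lemma mdvd_same_mdeg_eq:
  assumes "mdvd g t" "mdeg g = mdeg t"
  shows "g = t"
proof -
  have "mdeg (t - g) + mdeg g = mdeg t" using mdvd_add_cancel[OF assms(1)] mdeg_add by metis
  then have "mdeg (t - g) = 0" using assms(2) by simp
  then have "t - g = 0" by (intro poly_mapping_eqI) (auto simp: mdeg_def in_keys_iff)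
  then show ?thesis using mdvd_add_cancel[OF assms(1)] by simp
qed

text \<open>The ideal generated by the monomials of \<open>G\<close>, in the form in which membership is
  decided term by term; \<open>genideal_pmonom\<close> identifies the two.\<close>

definition mono_ideal :: "'v set \<Rightarrow> ('v \<Rightarrow>\<^sub>0 nat) set \<Rightarrow> ('v, 'k::field) mpoly set" where
  "mono_ideal V G = {p \<in> polys V. \<forall>t\<in>Poly_Mapping.keys p. \<exists>g\<in>G. mdvd g t}"

lemma lookup_mult_pmonom:
  fixes p :: "('v, 'k::field) mpoly"
  shows "Poly_Mapping.lookup (p * pmonom m) (s + m) = Poly_Mapping.lookup p s"
proof -
  have "Poly_Mapping.lookup (p * pmonom m) (s + m) = Sum_any (\<lambda>a. Poly_Mapping.lookup p a *
     Sum_any (\<lambda>b. Poly_Mapping.lookup (pmonom m) b when s + m = a + b))"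
    by (simp add: lookup_mult)
  also have "\<dots> = Sum_any (\<lambda>a. Poly_Mapping.lookup p a when a = s)"
  proof (intro Sum_any.cong)
    fix a
    have "Sum_any (\<lambda>b. Poly_Mapping.lookup (pmonom m :: ('v, 'k) mpoly) b when s + m = a + b) =
       Sum_any (\<lambda>b. (1 when a = s) when b = m)"
      by (intro Sum_any.cong) (auto simp: pmonom_def lookup_single when_def)
    then show "Poly_Mapping.lookup p a * Sum_any (\<lambda>b. Poly_Mapping.lookup (pmonom m) b when s + m = a + b) =
       (Poly_Mapping.lookup p a when a = s)"
      by (simp add: when_def)
  qed
  finally show ?thesis by simp
qed

lemma keys_mult_pmonom: "Poly_Mapping.keys (p * pmonom m) = (\<lambda>s. s + m) ` Poly_Mapping.keys p"
proof (rule subset_antisym; rule subsetI)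
  fix t assume "t \<in> Poly_Mapping.keys (p * pmonom m)"
  then show "t \<in> (\<lambda>s. s + m) ` Poly_Mapping.keys p"
    using keys_mult[of p "pmonom m"] by (auto simp: pmonom_def split: if_splits)
next
  fix t assume "t \<in> (\<lambda>s. s + m) ` Poly_Mapping.keys p"
  then show "t \<in> Poly_Mapping.keys (p * pmonom m)"
    by (auto simp: in_keys_iff lookup_mult_pmonom)
qed

lemma pmonom_polys: "pmonom m \<in> polys V \<longleftrightarrow> Poly_Mapping.keys m \<subseteq> V"
  by (simp add: polys_def pmonom_def)

lemma homog_pmonom: "homog (mdeg m) (pmonom m)"
  by (simp add: homog_def pmonom_def)

lemma pmonom_mem_mono_ideal:
  "pmonom m \<in> mono_ideal V G \<longleftrightarrow> Poly_Mapping.keys m \<subseteq> V \<and> (\<exists>g\<in>G. mdvd g m)"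
  by (simp add: mono_ideal_def pmonom_polys) (simp add: pmonom_def)

lemma mono_ideal_zero [simp]: "0 \<in> mono_ideal V G"
  by (simp add: mono_ideal_def)

lemma mono_ideal_add:
  assumes "p \<in> mono_ideal V G" "q \<in> mono_ideal V G"
  shows "p + q \<in> mono_ideal V G"
proof -
  have "\<exists>g\<in>G. mdvd g t" if "t \<in> Poly_Mapping.keys (p + q)" for t
    using that assms keys_add[of p q] unfolding mono_ideal_def by blast
  then show ?thesis using assms by (simp add: mono_ideal_def polys_add)
qed

lemma mono_ideal_mult:
  assumes "p \<in> mono_ideal V G" "q \<in> polys V"
  shows "q * p \<in> mono_ideal V G"
proof -
  have "\<exists>g\<in>G. mdvd g t" if t: "t \<in> Poly_Mapping.keys (q * p)" for t
  proof -
    from t obtain a b where "t = a + b" "b \<in> Poly_Mapping.keys p" using keys_mult[of q p] by blast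
    then show ?thesis using assms(1) mdvd_add unfolding mono_ideal_def by blast
  qed
  then show ?thesis using assms by (simp add: mono_ideal_def polys_mult)
qed

lemma mono_ideal_mono: "G \<subseteq> H \<Longrightarrow> mono_ideal V G \<subseteq> mono_ideal V H"
  unfolding mono_ideal_def by blast

lemma mono_ideal_empty: "mono_ideal V {} = {0}"
  by (auto simp: mono_ideal_def)

lemma poly_mapping_eq_sum_single: "p = (\<Sum>t\<in>Poly_Mapping.keys p. Poly_Mapping.single t (Poly_Mapping.lookup p t))"
  by (rule poly_mapping_eqI)
     (auto simp: lookup_sum lookup_single when_def sum.delta' in_keys_iff)

lemma single_polys: "Poly_Mapping.keys t \<subseteq> V \<Longrightarrow> Poly_Mapping.single t c \<in> polys V"
  by (simp add: polys_def)

lemma keys_minus_subset: "Poly_Mapping.keys (t - g) \<subseteq> Poly_Mapping.keys (t :: 'v \<Rightarrow>\<^sub>0 nat)"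
  by (auto simp: in_keys_iff lookup_minus)

lemma single_eq_mult_pmonom:
  assumes "mdvd g t"
  shows "Poly_Mapping.single t c = Poly_Mapping.single (t - g) c * pmonom g"
  by (simp add: pmonom_def mult_single mdvd_add_cancel[OF assms])

text \<open>The terms of a polynomial are sorted into those divisible by an old generator and the others,
  which are multiples of \<open>m\<close>.\<close>

lemma mono_ideal_insert:
  assumes m: "Poly_Mapping.keys m \<subseteq> V"
  shows "mono_ideal V (insert m G) = {a + q * pmonom m | a q. a \<in> mono_ideal V G \<and> q \<in> polys V}"
proof (rule subset_antisym; rule subsetI)
  fix p :: "('a, 'b) mpoly" assume p: "p \<in> mono_ideal V (insert m G)"
  let ?A = "{t \<in> Poly_Mapping.keys p. \<exists>g\<in>G. mdvd g t}"
  let ?s = "\<lambda>t. Poly_Mapping.single t (Poly_Mapping.lookup p t)"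
  have pV: "Poly_Mapping.keys t \<subseteq> V" if "t \<in> Poly_Mapping.keys p" for t
    using p that by (auto simp: mono_ideal_def polys_def)
  have p1: "p = sum ?s ?A + sum ?s (Poly_Mapping.keys p - ?A)"
    by (subst poly_mapping_eq_sum_single) (rule sum.subset_diff[THEN trans[OF _ add.commute]], auto)
  have p2: "sum ?s (Poly_Mapping.keys p - ?A) =
     (\<Sum>t\<in>Poly_Mapping.keys p - ?A. Poly_Mapping.single (t - m) (Poly_Mapping.lookup p t)) * pmonom m"
    unfolding sum_distrib_right
  proof (rule sum.cong[OF refl])
    fix t assume "t \<in> Poly_Mapping.keys p - ?A"
    then have "mdvd m t" using p by (auto simp: mono_ideal_def)
    then show "?s t = Poly_Mapping.single (t - m) (Poly_Mapping.lookup p t) * pmonom m"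
      by (rule single_eq_mult_pmonom)
  qed
  have p3: "sum ?s ?A \<in> mono_ideal V G"
  proof -
    have "sum ?s B \<in> mono_ideal V G" if "finite B" "B \<subseteq> ?A" for B
      using that
    proof (induction B rule: finite_induct)
      case (insert t B)
      have "?s t \<in> mono_ideal V G"
        using insert.prems pV by (auto simp: mono_ideal_def intro: single_polys)
      then show ?case using insert by (simp add: mono_ideal_add)
    qed simp
    then show ?thesis by simp
  qed
  have p4: "(\<Sum>t\<in>Poly_Mapping.keys p - ?A. Poly_Mapping.single (t - m) (Poly_Mapping.lookup p t)) \<in> polys V"
    by (intro polys_sum single_polys subset_trans[OF keys_minus_subset] pV) simp
  show "p \<in> {a + q * pmonom m | a q. a \<in> mono_ideal V G \<and> q \<in> polys V}"
    by (rule CollectI, intro exI conjI) (rule p1[unfolded p2], rule p3, rule p4)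
next
  fix p :: "('a, 'b) mpoly" assume "p \<in> {a + q * pmonom m | a q. a \<in> mono_ideal V G \<and> q \<in> polys V}"
  then obtain a q where p: "p = a + q * pmonom m" "a \<in> mono_ideal V G" "q \<in> polys V" by blast
  have "a \<in> mono_ideal V (insert m G)" using p(2) mono_ideal_mono[of G "insert m G" V] by blast
  moreover have "(pmonom m :: ('a, 'b) mpoly) \<in> mono_ideal V (insert m G)" using m by (auto simp: pmonom_mem_mono_ideal)
  ultimately show "p \<in> mono_ideal V (insert m G)" unfolding p(1) using p(3)
    by (intro mono_ideal_add mono_ideal_mult)
qed

lemma mono_ideal_colon:
  assumes m: "Poly_Mapping.keys m \<subseteq> V"
    and X: "\<And>t. Poly_Mapping.keys t \<subseteq> V \<Longrightarrow> (\<exists>g\<in>G. mdvd g (t + m)) \<longleftrightarrow> (\<exists>h\<in>H. mdvd h t)"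
  shows "mono_ideal V H = {q \<in> polys V. q * pmonom m \<in> mono_ideal V G}"
proof -
  have "q * pmonom m \<in> polys V" if "q \<in> polys V" for q :: "('a, 'b) mpoly"
    using that m by (intro polys_mult) (auto simp: pmonom_polys)
  then show ?thesis
    using X by (auto simp: mono_ideal_def keys_mult_pmonom polys_def)
qed

abbreviation var_exps :: "'v set \<Rightarrow> ('v \<Rightarrow>\<^sub>0 nat) set" where
  "var_exps X \<equiv> (\<lambda>x. Poly_Mapping.single x 1) ` X"

lemma mdvd_single_iff: "mdvd (Poly_Mapping.single x 1) t \<longleftrightarrow> x \<in> Poly_Mapping.keys t"
  by (auto simp: mdvd_def lookup_single when_def in_keys_iff Suc_le_eq)

lemma rank_below_choose: "rank_below (\<lambda>i. c choose Suc i) i = c choose i"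
  by (cases i) auto

lemma linear_resolution_extend:
  assumes I: "\<exists>D. linear_resolution V (mono_ideal V G :: ('v, 'k::field) mpoly set) (mdeg m) b D"
    and X: "\<exists>D. linear_resolution V (mono_ideal V (var_exps X) :: ('v, 'k) mpoly set) 1 (\<lambda>i. c choose Suc i) D"
    and m: "Poly_Mapping.keys m \<subseteq> V"
    and colon: "\<And>t. Poly_Mapping.keys t \<subseteq> V \<Longrightarrow> (\<exists>g\<in>G. mdvd g (t + m)) \<longleftrightarrow> (\<exists>x\<in>X. x \<in> Poly_Mapping.keys t)"
  shows "\<exists>D. linear_resolution V (mono_ideal V (insert m G) :: ('v, 'k) mpoly set) (mdeg m) (\<lambda>i. b i + (c choose i)) D"
proof -
  have quot: "mono_ideal V (var_exps X) = {q \<in> polys V. q * (pmonom m :: ('v, 'k) mpoly) \<in> mono_ideal V G}"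
    using colon by (intro mono_ideal_colon[OF m]) (simp add: mdvd_single_iff[unfolded One_nat_def])
  obtain D where D: "linear_resolution V (mono_ideal V G :: ('v, 'k) mpoly set) (mdeg m) b D"
    using I by blast
  obtain D' where D':
    "linear_resolution V (mono_ideal V (var_exps X) :: ('v, 'k) mpoly set) 1 (\<lambda>i. c choose Suc i) D'"
    using X by blast
  have "(pmonom m :: ('v, 'k) mpoly) \<in> polys V" using m by (simp add: pmonom_polys)
  from linear_resolution_mapping_cone[OF D D' quot this homog_pmonom]
  show ?thesis unfolding mono_ideal_insert[OF m] rank_below_choose .
qed

text \<open>The ranks of the Koszul complex, obtained by adding one variable at a time: the colon ideal of the
  old variables by a new one is again the ideal of the old variables, and the ranks satisfy the
  recursion of Pascal.\<close>

lemma linear_resolution_variables: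
  assumes "finite X" "X \<subseteq> V"
  shows "\<exists>D. linear_resolution V (mono_ideal V (var_exps X) :: ('v, 'k::field) mpoly set) 1 (\<lambda>i. card X choose Suc i) D"
  using assms
proof (induction X rule: finite_induct)
  case empty
  show ?case using linear_resolution_zero_ideal by (auto simp: mono_ideal_empty)
next
  case (insert x X)
  have deg: "mdeg (Poly_Mapping.single x 1) = 1" by (simp add: mdeg_def)
  have IH: "\<exists>D. linear_resolution V (mono_ideal V (var_exps X) :: ('v, 'k) mpoly set) 1 (\<lambda>i. card X choose Suc i) D"
    using insert by simp
  have "\<exists>D. linear_resolution V (mono_ideal V (insert (Poly_Mapping.single x 1) (var_exps X)) :: ('v, 'k) mpoly set)
     (mdeg (Poly_Mapping.single x 1)) (\<lambda>i. (card X choose Suc i) + (card X choose i)) D"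
  proof (rule linear_resolution_extend[OF _ IH])
    show "Poly_Mapping.keys (Poly_Mapping.single x 1) \<subseteq> V" using insert.prems by simp
    show "(\<exists>g\<in>var_exps X. mdvd g (t + Poly_Mapping.single x 1)) \<longleftrightarrow> (\<exists>y\<in>X. y \<in> Poly_Mapping.keys t)" for t
      using insert.hyps(2) by (auto simp: mdvd_single_iff[unfolded One_nat_def] keys_add_nat)
  qed (use IH deg in simp)
  then show ?case using insert.hyps deg by (simp add: add.commute)
qed

text \<open>Generators are added in an order that refines \<open>rank\<close>. The two conditions say that the
  colon ideal of the generators already present by \<open>ex u\<close> is generated by the variables
  \<open>X u\<close>: \<open>quot\<close> puts these variables into it, and \<open>colon\<close>
  shows that each monomial in it is divisible by one of them. Ties in the rank are harmless because
  \<open>quot\<close> produces a generator of strictly smaller rank while \<open>colon\<close>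
  covers equal ranks.\<close>

theorem linear_quotients_resolution:
  fixes ex :: "'u \<Rightarrow> ('v \<Rightarrow>\<^sub>0 nat)" and rank :: "'u \<Rightarrow> nat"
  assumes L: "finite L"
    and deg: "\<And>u. u \<in> L \<Longrightarrow> mdeg (ex u) = d" and keys: "\<And>u. u \<in> L \<Longrightarrow> Poly_Mapping.keys (ex u) \<subseteq> V"
    and X: "\<And>u. u \<in> L \<Longrightarrow> X u \<subseteq> V" "\<And>u. u \<in> L \<Longrightarrow> finite (X u)"
    and quot: "\<And>u x. u \<in> L \<Longrightarrow> x \<in> X u \<Longrightarrow> \<exists>v\<in>L. rank v < rank u \<and> mdvd (ex v) (Poly_Mapping.single x 1 + ex u)"
    and colon: "\<And>u g. u \<in> L \<Longrightarrow> g \<in> L \<Longrightarrow> g \<noteq> u \<Longrightarrow> rank g \<le> rank u \<Longrightarrow>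
       \<exists>x\<in>X u. Poly_Mapping.lookup (ex u) x < Poly_Mapping.lookup (ex g) x"
  shows "\<exists>D. linear_resolution V (mono_ideal V (ex ` L) :: ('v, 'k::field) mpoly set) d (\<lambda>i. \<Sum>u\<in>L. card (X u) choose i) D"
proof -
  have "\<exists>D. linear_resolution V (mono_ideal V (ex ` S) :: ('v, 'k) mpoly set) d (\<lambda>i. \<Sum>u\<in>S. card (X u) choose i) D"
    if "S \<subseteq> L" "\<And>u v. u \<in> S \<Longrightarrow> v \<in> L \<Longrightarrow> rank v < rank u \<Longrightarrow> v \<in> S" for S
    using finite_subset[OF that(1) L] that
  proof (induction S rule: finite_psubset_induct)
    case (psubset S)
    show ?case
    proof (cases "S = {}")
      case True
      then show ?thesis using linear_resolution_zero_ideal by (auto simp: mono_ideal_empty)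
    next
      case False
      \<comment> \<open>A generator of largest rank is added last: the others are again closed under smaller rank.\<close>
      have "Max (rank ` S) \<in> rank ` S" using psubset.hyps False by (intro Max_in) auto
      then obtain u where u: "u \<in> S" "rank u = Max (rank ` S)" by auto
      have top: "rank v \<le> rank u" if "v \<in> S" for v unfolding u(2) using that psubset.hyps by simp
      let ?T = "S - {u}"
      have uL: "u \<in> L" using u psubset.prems by blast
      have IH: "\<exists>D. linear_resolution V (mono_ideal V (ex ` ?T) :: ('v, 'k) mpoly set) (mdeg (ex u))
          (\<lambda>i. \<Sum>u\<in>?T. card (X u) choose i) D"
        unfolding deg[OF uL]
      proof (rule psubset.IH)
        show "?T \<subset> S" "?T \<subseteq> L" using u psubset.prems by auto
        fix w v assume "w \<in> ?T" "v \<in> L" "rank v < rank w"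
        then show "v \<in> ?T" using psubset.prems(2)[of w v] top[of w] by auto
      qed
      have "\<exists>D. linear_resolution V (mono_ideal V (insert (ex u) (ex ` ?T)) :: ('v, 'k) mpoly set) (mdeg (ex u))
          (\<lambda>i. (\<Sum>u\<in>?T. card (X u) choose i) + (card (X u) choose i)) D"
      proof (rule linear_resolution_extend[OF IH linear_resolution_variables[OF X(2)[OF uL] X(1)[OF uL]] keys[OF uL]])
        fix t :: "'v \<Rightarrow>\<^sub>0 nat"
        show "(\<exists>g\<in>ex ` ?T. mdvd g (t + ex u)) \<longleftrightarrow> (\<exists>x\<in>X u. x \<in> Poly_Mapping.keys t)"
        proof
          assume "\<exists>g\<in>ex ` ?T. mdvd g (t + ex u)"
          then obtain g where g: "g \<in> ?T" "mdvd (ex g) (t + ex u)" by blast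
          from g(1) colon[OF uL, of g] psubset.prems top obtain x where
            x: "x \<in> X u" "Poly_Mapping.lookup (ex u) x < Poly_Mapping.lookup (ex g) x" by blast
          have "Poly_Mapping.lookup (ex g) x \<le> Poly_Mapping.lookup t x + Poly_Mapping.lookup (ex u) x"
            using g(2) by (simp add: mdvd_def lookup_add)
          with x(2) have "x \<in> Poly_Mapping.keys t" by (simp add: in_keys_iff)
          with x(1) show "\<exists>x\<in>X u. x \<in> Poly_Mapping.keys t" ..
        next
          assume "\<exists>x\<in>X u. x \<in> Poly_Mapping.keys t"
          then obtain x where x: "x \<in> X u" "x \<in> Poly_Mapping.keys t" by blast
          from quot[OF uL x(1)] obtain v where v: "v \<in> L" "rank v < rank u"
            "mdvd (ex v) (Poly_Mapping.single x 1 + ex u)" by blast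
          have "mdvd (Poly_Mapping.single x 1 + ex u) (t + ex u)"
            using x(2) by (auto simp: mdvd_def lookup_add lookup_single when_def in_keys_iff Suc_le_eq)
          moreover have "v \<in> ?T" using psubset.prems(2)[OF u(1) v(1,2)] v(2) by auto
          ultimately show "\<exists>g\<in>ex ` ?T. mdvd g (t + ex u)" using mdvd_trans[OF v(3)] by blast
        qed
      qed
      moreover have "insert (ex u) (ex ` ?T) = ex ` S" using u(1) by auto
      moreover have "(\<Sum>u\<in>?T. card (X u) choose i) + (card (X u) choose i) = (\<Sum>u\<in>S. card (X u) choose i)" for i
        using sum.remove[OF psubset.hyps u(1), of "\<lambda>u. card (X u) choose i"] by simp
      ultimately show ?thesis using deg[OF uL] by simp
    qed
  qed
  from this[of L] show ?thesis by blast
qed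

text \<open>Monomials of the same degree do not divide each other unless they are equal.\<close>

lemma min_gens_mono_ideal:
  assumes "\<And>g. g \<in> G \<Longrightarrow> Poly_Mapping.keys g \<subseteq> V" "\<And>g. g \<in> G \<Longrightarrow> mdeg g = d"
  shows "min_gens (mono_ideal V G :: ('v, 'k::field) mpoly set) = G"
proof (rule subset_antisym; rule subsetI)
  fix m assume m: "m \<in> min_gens (mono_ideal V G :: ('v, 'k) mpoly set)"
  then obtain g where g: "g \<in> G" "mdvd g m" by (auto simp: min_gens_def pmonom_mem_mono_ideal)
  have "(pmonom g :: ('v, 'k) mpoly) \<in> mono_ideal V G"
    using g(1) assms(1) mdvd_refl unfolding pmonom_mem_mono_ideal by blast
  then have "g = m" using m g(2) by (auto simp: min_gens_def mdvd_def)
  then show "m \<in> G" using g(1) by simp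
next
  fix m assume m: "m \<in> G"
  have "t = m" if t: "(pmonom t :: ('v, 'k) mpoly) \<in> mono_ideal V G" "mdvd t m" for t
  proof -
    from t(1) obtain g where g: "g \<in> G" "mdvd g t" by (auto simp: pmonom_mem_mono_ideal)
    have "g = m" using mdvd_same_mdeg_eq[OF mdvd_trans[OF g(2) t(2)]] assms(2) g(1) m by metis
    with g(2) t(2) show ?thesis by (intro poly_mapping_eqI) (auto simp: mdvd_def intro: le_antisym)
  qed
  then show "m \<in> min_gens (mono_ideal V G :: ('v, 'k) mpoly set)"
    using m assms(1) mdvd_refl unfolding min_gens_def pmonom_mem_mono_ideal mdvd_def by blast
qed

lemma poly_ring_cring: "cring (poly_ring V :: ('v, 'k::field) mpoly ring)"
proof (rule cringI)
  show "abelian_group (poly_ring V :: ('v, 'k) mpoly ring)"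
    by (rule abelian_groupI)
       (auto simp: poly_ring_def polys_add add.assoc add.commute intro!: bexI[OF _ polys_uminus])
  show "comm_monoid (poly_ring V :: ('v, 'k) mpoly ring)"
    by (rule comm_monoidI) (auto simp: poly_ring_def polys_mult mult.assoc mult.commute)
qed (auto simp: poly_ring_def distrib_right)

lemma mono_ideal_is_ideal: "ideal (mono_ideal V G) (poly_ring V :: ('v, 'k::field) mpoly ring)"
proof (rule idealI)
  interpret cring "poly_ring V :: ('v, 'k) mpoly ring" by (rule poly_ring_cring)
  show "ring (poly_ring V :: ('v, 'k) mpoly ring)" by (rule ring_axioms)
  have "a_inv (poly_ring V) p = - p" if "p \<in> polys V" for p :: "('v, 'k) mpoly"
    using minus_equality[of "- p" p] that by (simp add: poly_ring_def polys_uminus)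
  moreover have "- p \<in> mono_ideal V G" if "p \<in> mono_ideal V G" for p :: "('v, 'k) mpoly"
    using mono_ideal_mult[OF that, of "- 1"] by (simp add: polys_uminus)
  moreover have "mono_ideal V G \<noteq> ({} :: ('v, 'k) mpoly set)" "mono_ideal V G \<subseteq> (polys V :: ('v, 'k) mpoly set)"
    using mono_ideal_zero by (blast, auto simp: mono_ideal_def)
  ultimately show "subgroup (mono_ideal V G) (add_monoid (poly_ring V :: ('v, 'k) mpoly ring))"
    by (intro add.subgroupI) (auto simp: poly_ring_def a_inv_def mono_ideal_add)
  fix p q :: "('v, 'k) mpoly" assume "p \<in> mono_ideal V G" "q \<in> carrier (poly_ring V)"
  then have "q * p \<in> mono_ideal V G" by (intro mono_ideal_mult) (simp_all add: poly_ring_def)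
  then show "q \<otimes>\<^bsub>poly_ring V\<^esub> p \<in> mono_ideal V G" "p \<otimes>\<^bsub>poly_ring V\<^esub> q \<in> mono_ideal V G"
    by (simp_all add: poly_ring_def mult.commute)
qed

lemma genideal_pmonom:
  assumes "\<And>g. g \<in> G \<Longrightarrow> Poly_Mapping.keys g \<subseteq> V"
  shows "Idl\<^bsub>poly_ring V\<^esub> (pmonom ` G :: ('v, 'k::field) mpoly set) = mono_ideal V G"
proof (rule subset_antisym)
  interpret cring "poly_ring V :: ('v, 'k) mpoly ring" by (rule poly_ring_cring)
  show "Idl\<^bsub>poly_ring V\<^esub> (pmonom ` G :: ('v, 'k) mpoly set) \<subseteq> mono_ideal V G"
  proof (intro genideal_minimal mono_ideal_is_ideal image_subsetI)
    fix g assume "g \<in> G"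
    then show "(pmonom g :: ('v, 'k) mpoly) \<in> mono_ideal V G"
      unfolding pmonom_mem_mono_ideal using assms mdvd_refl by blast
  qed
  have sub: "(pmonom ` G :: ('v, 'k) mpoly set) \<subseteq> carrier (poly_ring V)"
    using assms by (auto simp: poly_ring_def pmonom_polys)
  interpret J: ideal "Idl\<^bsub>poly_ring V\<^esub> (pmonom ` G)" "poly_ring V :: ('v, 'k) mpoly ring"
    by (rule genideal_ideal[OF sub])
  show "mono_ideal V G \<subseteq> Idl\<^bsub>poly_ring V\<^esub> (pmonom ` G :: ('v, 'k) mpoly set)"
  proof
    fix p :: "('v, 'k) mpoly" assume p: "p \<in> mono_ideal V G"
    let ?J = "Idl\<^bsub>poly_ring V\<^esub> (pmonom ` G :: ('v, 'k) mpoly set)"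
    have add: "x + y \<in> ?J" if "x \<in> ?J" "y \<in> ?J" for x y
      using J.a_closed[OF that] by (simp add: poly_ring_def)
    have mult: "x * y \<in> ?J" if "y \<in> ?J" "x \<in> polys V" for x y
      using J.I_l_closed[of y x] that by (simp add: poly_ring_def)
    have zero: "0 \<in> ?J" using J.zero_closed by (simp add: poly_ring_def)
    have mono: "Poly_Mapping.single t (Poly_Mapping.lookup p t) \<in> ?J" if t: "t \<in> Poly_Mapping.keys p" for t
    proof -
      from p t obtain g where g: "g \<in> G" "mdvd g t" by (auto simp: mono_ideal_def)
      have "pmonom g \<in> ?J" using genideal_self[OF sub] g(1) by blast
      moreover have "Poly_Mapping.single (t - g) (Poly_Mapping.lookup p t) \<in> polys V"
        using p t keys_minus_subset[of t g] by (auto simp: mono_ideal_def polys_def)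
      ultimately show ?thesis
        unfolding single_eq_mult_pmonom[OF g(2), of "Poly_Mapping.lookup p t"] by (rule mult)
    qed
    have "(\<Sum>t\<in>B. Poly_Mapping.single t (Poly_Mapping.lookup p t)) \<in> ?J"
      if "finite B" "B \<subseteq> Poly_Mapping.keys p" for B
      using that by (induction B rule: finite_induct) (auto intro!: add zero mono)
    from this[of "Poly_Mapping.keys p"] show "p \<in> ?J"
      unfolding poly_mapping_eq_sum_single[of p, symmetric] by simp
  qed
qed


section \<open>Gale down-sets of increasing lists\<close>

text \<open>For \<open>c = 0\<close> these are the weakly increasing lists, for \<open>c = 1\<close> the
  strictly increasing ones. The shift \<open>u\<^sub>j \<mapsto> u\<^sub>j + j\<close> passes from
  the first to the second.\<close>

definition gapped :: "nat \<Rightarrow> nat \<Rightarrow> nat list \<Rightarrow> bool" where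
  "gapped c d u \<longleftrightarrow> length u = d \<and> (\<forall>j<d. 1 \<le> u ! j) \<and> (\<forall>j. Suc j < d \<longrightarrow> u ! j + c \<le> u ! Suc j)"

lemma gapped_mono: "gapped c d u \<Longrightarrow> i \<le> j \<Longrightarrow> j < d \<Longrightarrow> u ! i \<le> u ! j"
proof (induction j)
  case (Suc j)
  then have "u ! j + c \<le> u ! Suc j" by (simp add: gapped_def)
  then show ?case using Suc by (cases "i = Suc j") auto
qed simp

lemma gapped_less:
  assumes "gapped c d u" "i < j" "j < d"
  shows "u ! i + c \<le> u ! j"
proof -
  have "u ! i + c \<le> u ! Suc i" using assms by (simp add: gapped_def)
  also have "\<dots> \<le> u ! j" using assms by (intro gapped_mono[OF assms(1)]) auto
  finally show ?thesis .
qed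

text \<open>The pairs of a position and a smaller value to which the entry there can be lowered while the list
  stays gapped. Positions start at \<open>0\<close>.\<close>

definition slots :: "nat \<Rightarrow> nat list \<Rightarrow> (nat \<times> nat) set" where
  "slots c u = (SIGMA j:{..<length u}. {(case j of 0 \<Rightarrow> 1 | Suc i \<Rightarrow> u ! i + c)..<u ! j})"

lemma finite_slots [simp]: "finite (slots c u)"
  by (simp add: slots_def)

lemma slotsD:
  assumes "(j, i) \<in> slots c u"
  shows "j < length u" "i < u ! j" "j = 0 \<Longrightarrow> 1 \<le> i" "\<And>k. j = Suc k \<Longrightarrow> u ! k + c \<le> i"
  using assms by (auto simp: slots_def)

text \<open>The intervals of slots fill the integers from \<open>1\<close> to the last entry, except for the
  last entry itself and \<open>c\<close> integers after each entry but the last.\<close>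

lemma card_slots:
  assumes u: "gapped c d u" and d: "1 \<le> d"
  shows "card (slots c u) = u ! (d - 1) - 1 - c * (d - 1)"
proof -
  have "(\<Sum>j<Suc k. u ! j - (case j of 0 \<Rightarrow> 1 | Suc i \<Rightarrow> u ! i + c)) + 1 + c * k = u ! k" if "k < d" for k
    using that
  proof (induction k)
    case 0
    then have "1 \<le> u ! 0" using u by (simp add: gapped_def)
    then show ?case by simp
  next
    case (Suc k)
    have "u ! k + c \<le> u ! Suc k" using u Suc.prems by (simp add: gapped_def)
    then show ?case using Suc by simp
  qed
  from this[of "d - 1"] have "(\<Sum>j<d. u ! j - (case j of 0 \<Rightarrow> 1 | Suc i \<Rightarrow> u ! i + c)) = u ! (d - 1) - 1 - c * (d - 1)"
    using d by simp
  then show ?thesis using u by (simp add: slots_def gapped_def)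
qed

lemma slot_pos:
  assumes u: "gapped c d u" and s: "(p, i) \<in> slots c u"
  shows "1 \<le> i"
proof (cases p)
  case 0
  then show ?thesis using slotsD(3)[OF s] by simp
next
  case (Suc k)
  then have "1 \<le> u ! k" "u ! k + c \<le> i" using u slotsD(1)[OF s] slotsD(4)[OF s Suc] by (auto simp: gapped_def)
  then show ?thesis by simp
qed

lemma slot_replacement:
  assumes u: "gapped c d u" and s: "(p, i) \<in> slots c u"
  shows "gapped c d (u[p := i])" "list_all2 (\<le>) (u[p := i]) u" "sum_list (u[p := i]) < sum_list u"
proof -
  have len: "length u = d" using u by (simp add: gapped_def)
  have p: "p < d" "i < u ! p" using slotsD[OF s] len by auto
  have i1: "1 \<le> i" by (rule slot_pos[OF u s])
  have "u[p := i] ! j + c \<le> u[p := i] ! Suc j" if "Suc j < d" for j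
  proof -
    have "u ! j + c \<le> u ! Suc j" using u that by (simp add: gapped_def)
    then show ?thesis using that p len slotsD(4)[OF s, of j] by (auto simp: nth_list_update)
  qed
  then show "gapped c d (u[p := i])" using u i1 p len by (auto simp: gapped_def nth_list_update)
  show "list_all2 (\<le>) (u[p := i]) u"
    using p len by (auto simp: list_all2_conv_all_nth nth_list_update)
  have "sum_list (u[p := i]) = sum_list u + i - u ! p" using p len by (simp add: sum_list_update)
  moreover have "u ! p \<le> sum_list u" using p len by (intro member_le_sum_list) auto
  ultimately show "sum_list (u[p := i]) < sum_list u" using p by linarith
qed

text \<open>The sum of the entries is strictly monotone for the Gale order.\<close>

lemma sum_list_le_imp_eq:
  fixes u g :: "nat list"
  assumes "length u = d" "length g = d" "\<And>j. j < d \<Longrightarrow> u ! j \<le> g ! j" "sum_list g \<le> sum_list u"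
  shows "g = u"
proof (rule nth_equalityI)
  fix j assume j: "j < length g"
  show "g ! j = u ! j"
  proof (rule ccontr)
    assume "g ! j \<noteq> u ! j"
    then have "u ! j < g ! j" using assms(2,3) j by (metis le_neq_implies_less)
    then have "(\<Sum>i=0..<d. u ! i) < (\<Sum>i=0..<d. g ! i)"
      using assms j by (intro sum_strict_mono_ex1) auto
    then show False using assms by (simp add: sum_list_sum_nth)
  qed
qed (use assms in simp)

text \<open>At the first position where \<open>g\<close> is below \<open>u\<close>, the entry of
  \<open>g\<close> exceeds its predecessor in \<open>g\<close>, hence also the predecessor in
  \<open>u\<close>, by at least \<open>c\<close>. Such a position exists, since otherwise
  \<open>g\<close> would be Gale above \<open>u\<close> with no larger sum.\<close>

lemma first_drop:
  assumes u: "gapped c d u" and g: "gapped c d g" and ne: "g \<noteq> u" and le: "sum_list g \<le> sum_list u"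
  obtains j where "(j, g ! j) \<in> slots c u" "\<And>p. p < j \<Longrightarrow> u ! p \<le> g ! p"
proof -
  have len: "length u = d" "length g = d" using u g by (auto simp: gapped_def)
  have "\<exists>j. j < d \<and> g ! j < u ! j"
    using sum_list_le_imp_eq[OF len _ le] ne by (meson not_le)
  then obtain j where j: "j < d" "g ! j < u ! j" "\<And>p. p < j \<Longrightarrow> \<not> (p < d \<and> g ! p < u ! p)"
    using exists_least_iff[of "\<lambda>j. j < d \<and> g ! j < u ! j"] by blast
  have below: "u ! p \<le> g ! p" if "p < j" for p using j(3)[OF that] j(1) that by auto
  have "(case j of 0 \<Rightarrow> 1 | Suc i \<Rightarrow> u ! i + c) \<le> g ! j"
  proof (cases j)
    case 0
    then show ?thesis using g j(1) by (simp add: gapped_def)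
  next
    case (Suc i)
    then have "u ! i + c \<le> g ! i + c" using below[of i] by simp
    also have "\<dots> \<le> g ! j" using g j(1) Suc by (simp add: gapped_def)
    finally show ?thesis using Suc by simp
  qed
  then have "(j, g ! j) \<in> slots c u" using j len by (simp add: slots_def)
  then show ?thesis using that below by blast
qed

text \<open>The exponent vector of the monomial of a list when entry \<open>i\<close> in position
  \<open>j\<close> stands for the variable \<open>\<phi> j i\<close>.\<close>

definition exp_of :: "(nat \<Rightarrow> nat \<Rightarrow> 'v) \<Rightarrow> nat list \<Rightarrow> ('v \<Rightarrow>\<^sub>0 nat)" where
  "exp_of \<phi> u = (\<Sum>j<length u. Poly_Mapping.single (\<phi> j (u ! j)) 1)"

lemma lookup_exp_of: "Poly_Mapping.lookup (exp_of \<phi> u) x = card {j. j < length u \<and> \<phi> j (u ! j) = x}"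
proof -
  have "Poly_Mapping.lookup (exp_of \<phi> u) x = (\<Sum>j<length u. if \<phi> j (u ! j) = x then 1 else 0)"
    by (simp add: exp_of_def lookup_sum lookup_single when_def del: One_nat_def)
  also have "\<dots> = card ({..<length u} \<inter> {j. \<phi> j (u ! j) = x})"
    by (simp add: sum.If_cases)
  also have "{..<length u} \<inter> {j. \<phi> j (u ! j) = x} = {j. j < length u \<and> \<phi> j (u ! j) = x}" by auto
  finally show ?thesis .
qed

lemma mdeg_sum: "mdeg (sum f A) = (\<Sum>x\<in>A. mdeg (f x))"
  by (induction A rule: infinite_finite_induct) (auto simp: mdeg_add)

lemma mdeg_exp_of: "mdeg (exp_of \<phi> u) = length u"
  unfolding exp_of_def mdeg_sum by (simp add: mdeg_def)

lemma keys_exp_of: "Poly_Mapping.keys (exp_of \<phi> u) = (\<lambda>j. \<phi> j (u ! j)) ` {..<length u}"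
proof -
  have "x \<in> Poly_Mapping.keys (exp_of \<phi> u) \<longleftrightarrow> {j. j < length u \<and> \<phi> j (u ! j) = x} \<noteq> {}" for x
    by (auto simp: in_keys_iff lookup_exp_of card_eq_0_iff)
  then show ?thesis by auto
qed

lemma pmonom_add: "pmonom (a + b) = pmonom a * pmonom b"
  by (simp add: pmonom_def mult_single)

lemma prod_pvar_exp_of:
  "(\<Prod>j<length u. pvar (\<phi> j (u ! j))) = (pmonom (exp_of \<phi> u) :: ('v, 'k::field) mpoly)"
proof -
  have "(\<Prod>j\<in>A. pvar (\<phi> j (u ! j)) :: ('v, 'k) mpoly) = pmonom (\<Sum>j\<in>A. Poly_Mapping.single (\<phi> j (u ! j)) 1)" if "finite A" for A
    using that by (induction A rule: finite_induct) (auto simp: pvar_def pmonom_add, simp add: pmonom_def)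
  then show ?thesis by (simp add: exp_of_def)
qed

lemma exp_of_update:
  assumes "p < length u"
  shows "mdvd (exp_of \<phi> (u[p := i])) (Poly_Mapping.single (\<phi> p i) 1 + exp_of \<phi> u)"
proof -
  let ?s = "\<lambda>u j. Poly_Mapping.single (\<phi> j (u ! j)) (1 :: nat)"
  have "exp_of \<phi> v = ?s v p + (\<Sum>j\<in>{..<length u} - {p}. ?s v j)" if "length v = length u" for v
    unfolding exp_of_def that using assms by (intro sum.remove) auto
  from this[of "u[p := i]"] this[of u]
  have "exp_of \<phi> (u[p := i]) + ?s u p = Poly_Mapping.single (\<phi> p i) 1 + exp_of \<phi> u"
    using assms by (simp add: ac_simps)
  then show ?thesis by (metis mdvd_add mdvd_refl add.commute)
qed

text \<open>Variables of different entries differ, whatever the positions. Two positions may share variables,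
  as for \<open>\<phi> j i = i\<close>, or have variables of their own, as for \<open>\<phi> j i =
  (j, i)\<close>.\<close>

definition column_faithful :: "(nat \<Rightarrow> nat \<Rightarrow> 'v) \<Rightarrow> bool" where
  "column_faithful \<phi> \<longleftrightarrow> (\<forall>p q a b. \<phi> p a = \<phi> q b \<longrightarrow> a = b)"

lemma column_faithfulD: "column_faithful \<phi> \<Longrightarrow> \<phi> p a = \<phi> q b \<Longrightarrow> a = b"
  unfolding column_faithful_def by blast

text \<open>Let \<open>j\<close> be the first drop. A position \<open>p\<close> where \<open>u\<close> shows
  the variable of \<open>g ! j\<close> has \<open>u ! p = g ! j < u ! j\<close>, so it comes before
  \<open>j\<close>, and \<open>u ! p \<le> g ! p \<le> g ! j\<close> forces \<open>g\<close> to show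
  the same variable there. In addition \<open>g\<close> shows it in position \<open>j\<close>, so
  its exponent is larger in \<open>g\<close>. This covers shared variables and variables separated
  by position alike.\<close>

lemma lookup_exp_of_first_drop:
  assumes \<phi>: "column_faithful \<phi>"
    and u: "gapped c d u" and g: "gapped c d g" and ne: "g \<noteq> u" and le: "sum_list g \<le> sum_list u"
  shows "\<exists>j i. (j, i) \<in> slots c u \<and> Poly_Mapping.lookup (exp_of \<phi> u) (\<phi> j i) < Poly_Mapping.lookup (exp_of \<phi> g) (\<phi> j i)"
proof -
  have len: "length u = d" "length g = d" using u g by (auto simp: gapped_def)
  obtain j where j: "(j, g ! j) \<in> slots c u" "\<And>p. p < j \<Longrightarrow> u ! p \<le> g ! p"
    using first_drop[OF u g ne le] by blast
  note jd = slotsD(1,2)[OF j(1)]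
  have "\<phi> p (g ! p) = \<phi> j (g ! j)" if p: "p < d" "\<phi> p (u ! p) = \<phi> j (g ! j)" for p
  proof -
    have eq: "u ! p = g ! j" by (rule column_faithfulD[OF \<phi> p(2)])
    have "p < j"
    proof (rule ccontr)
      assume "\<not> p < j"
      then have "u ! j \<le> u ! p" using gapped_mono[OF u] p(1) by simp
      then show False using eq jd(2) by simp
    qed
    then have "g ! p \<le> g ! j" "u ! p \<le> g ! p" using gapped_mono[OF g] jd(1) len j(2) by auto
    then show ?thesis using p(2) eq by simp
  qed
  then have sub: "{p. p < length u \<and> \<phi> p (u ! p) = \<phi> j (g ! j)} \<subseteq> {p. p < length g \<and> \<phi> p (g ! p) = \<phi> j (g ! j)}"
    (is "?A \<subseteq> ?B") unfolding len by (intro Collect_mono) simp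
  have "\<phi> j (u ! j) \<noteq> \<phi> j (g ! j)" using column_faithfulD[OF \<phi>, of j "u ! j" j "g ! j"] jd(2) by linarith
  then have "j \<notin> ?A" by simp
  moreover have jB: "j \<in> ?B" using len jd(1) by simp
  ultimately have "?A \<noteq> ?B" by (elim contrapos_nn) (simp only: jB)
  with sub have "?A \<subset> ?B" by (rule psubsetI)
  then have "Poly_Mapping.lookup (exp_of \<phi> u) (\<phi> j (g ! j)) < Poly_Mapping.lookup (exp_of \<phi> g) (\<phi> j (g ! j))"
    unfolding lookup_exp_of by (intro psubset_card_mono) auto
  with j(1) show ?thesis by blast
qed

text \<open>The intervals of different positions are disjoint, so even when positions share their variables no
  two slots give the same one.\<close>

lemma slots_unique:
  assumes u: "gapped c d u" and "(p, i) \<in> slots c u" "(q, i) \<in> slots c u"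
  shows "p = q"
proof -
  have len: "length u = d" using u by (simp add: gapped_def)
  have False if pq: "p < q" "(p, i) \<in> slots c u" "(q, i) \<in> slots c u" for p q
  proof -
    obtain k where k: "q = Suc k" using pq(1) by (cases q) auto
    have "u ! p \<le> u ! k" using gapped_mono[OF u] pq(1) k slotsD(1)[OF pq(3)] len by simp
    also have "\<dots> \<le> i" using slotsD(4)[OF pq(3) k] by simp
    finally show False using slotsD(2)[OF pq(2)] by simp
  qed
  with assms show ?thesis by (meson linorder_neqE_nat)
qed

text \<open>Of two different lists one has no larger sum, and then an exponent tells them apart.\<close>

lemma exp_of_inj_on:
  assumes \<phi>: "column_faithful \<phi>" and L: "\<And>u. u \<in> L \<Longrightarrow> gapped c d u"
  shows "inj_on (exp_of \<phi>) L"
proof (rule inj_onI, rule ccontr)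
  fix u g assume "u \<in> L" "g \<in> L" and eq: "exp_of \<phi> u = exp_of \<phi> g" and ne: "u \<noteq> g"
  then have gu: "gapped c d u" "gapped c d g" using L by auto
  show False
  proof (cases "sum_list g \<le> sum_list u")
    case True
    from lookup_exp_of_first_drop[OF \<phi> gu(1) gu(2) ne[symmetric] this] show False
      unfolding eq by simp
  next
    case False
    then have "sum_list u \<le> sum_list g" by simp
    from lookup_exp_of_first_drop[OF \<phi> gu(2) gu(1) ne this] show False
      unfolding eq by simp
  qed
qed

definition gen_ideal :: "(nat \<Rightarrow> nat \<Rightarrow> 'v) \<Rightarrow> 'v set \<Rightarrow> nat list set \<Rightarrow> ('v, 'k::field) mpoly set" where
  "gen_ideal \<phi> V L = Idl\<^bsub>poly_ring V\<^esub> {\<Prod>j<length u. pvar (\<phi> j (u ! j)) | u. u \<in> L}"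

definition gale_down_set :: "nat \<Rightarrow> nat \<Rightarrow> nat list set \<Rightarrow> bool" where
  "gale_down_set c d L \<longleftrightarrow> (\<forall>u\<in>L. gapped c d u) \<and> (\<forall>u\<in>L. \<forall>v. gapped c d v \<and> gale_le v u \<longrightarrow> v \<in> L)"

text \<open>The quotient of the generator \<open>u\<close> has as many variables as \<open>u\<close> has
  slots.\<close>

theorem gen_ideal_invariants:
  assumes \<phi>: "column_faithful \<phi>"
    and d: "1 \<le> d" and fin: "finite L" and down: "gale_down_set c d L"
    and vars: "\<forall>u\<in>L. \<forall>j<d. \<phi> j ` {1..u ! j} \<subseteq> V"
  shows "card (min_gens (gen_ideal \<phi> V L :: ('v, 'k::field) mpoly set)) = card L" (is ?card)
    and "betti V (gen_ideal \<phi> V L :: ('v, 'k) mpoly set) i = (\<Sum>u\<in>L. (u ! (d - 1) - 1 - c * (d - 1)) choose i)" (is ?betti)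
proof -
  have L: "gapped c d u" if "u \<in> L" for u using down that by (simp add: gale_down_set_def)
  have stable: "v \<in> L" if "u \<in> L" "gapped c d v" "gale_le v u" for u v
    using down that unfolding gale_down_set_def by blast
  have V: "\<phi> j i \<in> V" if u: "u \<in> L" and j: "j < d" and i: "1 \<le> i" "i \<le> u ! j" for u j i
  proof -
    have "\<phi> j ` {1..u ! j} \<subseteq> V" using vars u j by simp
    then show ?thesis using imageI[of i "{1..u ! j}" "\<phi> j"] i by auto
  qed
  have len: "length u = d" if "u \<in> L" for u using L[OF that] by (simp add: gapped_def)
  have pos: "1 \<le> u ! j" if "u \<in> L" "j < d" for u j using L[OF that(1)] that(2) by (simp add: gapped_def)
  have keys: "Poly_Mapping.keys (exp_of \<phi> u) \<subseteq> V" if "u \<in> L" for u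
    unfolding keys_exp_of using V[OF that] pos[OF that] len[OF that] by auto
  have "{\<Prod>j<length u. pvar (\<phi> j (u ! j)) | u. u \<in> L} = (pmonom ` exp_of \<phi> ` L :: ('v, 'k) mpoly set)"
    by (auto simp: prod_pvar_exp_of)
  then have I: "gen_ideal \<phi> V L = (mono_ideal V (exp_of \<phi> ` L) :: ('v, 'k) mpoly set)"
    unfolding gen_ideal_def using genideal_pmonom[of "exp_of \<phi> ` L" V] keys by auto
  have "min_gens (mono_ideal V (exp_of \<phi> ` L) :: ('v, 'k) mpoly set) = exp_of \<phi> ` L"
    using keys len by (intro min_gens_mono_ideal[of _ _ d]) (auto simp: mdeg_exp_of)
  then show ?card unfolding I using card_image[OF exp_of_inj_on[OF \<phi> L]] by simp
  let ?X = "\<lambda>u. (\<lambda>(j, i). \<phi> j i) ` slots c u"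
  have "\<exists>D. linear_resolution V (mono_ideal V (exp_of \<phi> ` L) :: ('v, 'k) mpoly set) d (\<lambda>i. \<Sum>u\<in>L. card (?X u) choose i) D"
  proof (rule linear_quotients_resolution[OF fin, of _ _ _ _ sum_list])
    fix u assume u: "u \<in> L"
    show "mdeg (exp_of \<phi> u) = d" using len[OF u] by (simp add: mdeg_exp_of)
    show "Poly_Mapping.keys (exp_of \<phi> u) \<subseteq> V" by (rule keys[OF u])
    show "finite (?X u)" by simp
    show "?X u \<subseteq> V"
    proof
      fix x assume "x \<in> ?X u"
      then obtain j i where s: "(j, i) \<in> slots c u" "x = \<phi> j i" by auto
      show "x \<in> V" unfolding s(2)
        using V[OF u, of j i] slotsD(1,2)[OF s(1)] slot_pos[OF L[OF u] s(1)] len[OF u] by simp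
    qed
    fix x assume "x \<in> ?X u"
    then obtain j i where s: "(j, i) \<in> slots c u" "x = \<phi> j i" by auto
    note r = slot_replacement[OF L[OF u] s(1)]
    have "u[j := i] \<in> L" by (rule stable[OF u r(1,2)])
    then show "\<exists>v\<in>L. sum_list v < sum_list u \<and> mdvd (exp_of \<phi> v) (Poly_Mapping.single x 1 + exp_of \<phi> u)"
      unfolding s(2) using r(3) exp_of_update[OF slotsD(1)[OF s(1)]] by blast
  next
    fix u g assume "u \<in> L" "g \<in> L" "g \<noteq> u" "sum_list g \<le> sum_list u"
    from lookup_exp_of_first_drop[OF \<phi> L[OF this(1)] L[OF this(2)] this(3,4)]
    obtain j i where s: "(j, i) \<in> slots c u"
      "Poly_Mapping.lookup (exp_of \<phi> u) (\<phi> j i) < Poly_Mapping.lookup (exp_of \<phi> g) (\<phi> j i)" by blast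
    have "\<phi> j i \<in> ?X u" using imageI[OF s(1), of "\<lambda>(j, i). \<phi> j i"] by simp
    with s(2) show "\<exists>x\<in>?X u. Poly_Mapping.lookup (exp_of \<phi> u) x < Poly_Mapping.lookup (exp_of \<phi> g) x" ..
  qed
  then obtain D where D: "linear_resolution V (mono_ideal V (exp_of \<phi> ` L) :: ('v, 'k) mpoly set) d (\<lambda>i. \<Sum>u\<in>L. card (?X u) choose i) D" ..
  have "card (?X u) = u ! (d - 1) - 1 - c * (d - 1)" if u: "u \<in> L" for u
  proof -
    have "inj_on (\<lambda>(j, i). \<phi> j i) (slots c u)"
    proof (rule inj_onI)
      fix x y assume s: "x \<in> slots c u" "y \<in> slots c u" and eq: "(\<lambda>(j, i). \<phi> j i) x = (\<lambda>(j, i). \<phi> j i) y"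
      obtain p a q b where xy: "x = (p, a)" "y = (q, b)" by (cases x, cases y) blast
      have "a = b" using eq unfolding xy prod.case by (rule column_faithfulD[OF \<phi>])
      then show "x = y" using slots_unique[OF L[OF u]] s unfolding xy by blast
    qed
    from card_image[OF this] show ?thesis using card_slots[OF L[OF u] d] by simp
  qed
  then show ?betti unfolding I betti_linear_resolution[OF D] by simp
qed


section \<open>Colex initial segments and the comparison\<close>

lemma dsubsets_sorted_list:
  assumes "S \<in> dsubsets d"
  shows "gapped 1 d (sorted_list_of_set S)" "set (sorted_list_of_set S) = S"
proof -
  have fin: "finite S" and S: "S \<subseteq> {1..}" "card S = d" using assms by (auto simp: dsubsets_def)
  show set: "set (sorted_list_of_set S) = S" using fin by simp
  have "sorted_list_of_set S ! j < sorted_list_of_set S ! Suc j" if "Suc j < d" for j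
    using sorted_wrt_nth_less[OF strict_sorted_list_of_set[of S], of j "Suc j"] that S by simp
  moreover have "1 \<le> sorted_list_of_set S ! j" if "j < d" for j
    using nth_mem[of j "sorted_list_of_set S"] set S that by auto
  ultimately show "gapped 1 d (sorted_list_of_set S)" using S by (auto simp: gapped_def Suc_le_eq)
qed

lemma gapped_one_set:
  assumes "gapped 1 d u"
  shows "set u \<in> dsubsets d" "sorted_list_of_set (set u) = u"
proof -
  have len: "length u = d" using assms by (simp add: gapped_def)
  have "sorted_wrt (<) u" unfolding sorted_wrt_iff_nth_less
    using gapped_less[OF assms] len by (auto simp: Suc_le_eq)
  then have s: "sorted u" "distinct u" by (simp_all add: strict_sorted_iff)
  then show "sorted_list_of_set (set u) = u"
    by (rule sorted_list_of_set.idem_if_sorted_distinct)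
  show "set u \<in> dsubsets d" using s len assms
    by (auto simp: dsubsets_def distinct_card gapped_def in_set_conv_nth)
qed

lemma dmultisets_sorted_list:
  assumes "A \<in> dmultisets d"
  shows "gapped 0 d (sorted_list_of_multiset A)" "mset (sorted_list_of_multiset A) = A"
proof -
  have A: "set_mset A \<subseteq> {1..}" "size A = d" using assms by (auto simp: dmultisets_def)
  show m: "mset (sorted_list_of_multiset A) = A" by simp
  have len: "length (sorted_list_of_multiset A) = d" using A m by (metis size_mset)
  have "sorted_list_of_multiset A ! j \<le> sorted_list_of_multiset A ! Suc j" if "Suc j < d" for j
    using sorted_nth_mono[OF sorted_sorted_list_of_multiset, of j "Suc j" A] that len by simp
  moreover have "1 \<le> sorted_list_of_multiset A ! j" if "j < d" for j
    using nth_mem[of j "sorted_list_of_multiset A"] A that len by (auto simp: set_sorted_list_of_multiset)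
  ultimately show "gapped 0 d (sorted_list_of_multiset A)" using len by (auto simp: gapped_def)
qed

lemma gapped_zero_mset:
  assumes "gapped 0 d u"
  shows "mset u \<in> dmultisets d" "sorted_list_of_multiset (mset u) = u"
proof -
  have len: "length u = d" using assms by (simp add: gapped_def)
  have "sorted u" unfolding sorted_iff_nth_mono using gapped_mono[OF assms] len by auto
  then show "sorted_list_of_multiset (mset u) = u"
    by (simp add: sort_key_id_if_sorted sorted_list_of_multiset_mset)
  show "mset u \<in> dmultisets d" using len assms
    by (auto simp: dmultisets_def gapped_def in_set_conv_nth)
qed

text \<open>Reading a set as a binary number embeds colex into the order of the natural numbers, which gives
  finite initial segments of any size without an analysis of colex itself.\<close>

definition bin_code :: "nat list \<Rightarrow> nat" where
  "bin_code u = (\<Sum>j<length u. 2 ^ (u ! j))"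

text \<open>Strictly increasing exponents: the sum of the first powers of two stays below the next power.\<close>

lemma partial_bin_code_less:
  assumes "gapped 1 d u" "m < d"
  shows "(\<Sum>j<Suc m. 2 ^ (u ! j)) < (2 :: nat) ^ Suc (u ! m)"
  using assms(2)
proof (induction m)
  case (Suc m)
  have "u ! m + 1 \<le> u ! Suc m" using assms(1) Suc.prems by (simp add: gapped_def)
  then have "(2 :: nat) ^ Suc (u ! m) \<le> 2 ^ (u ! Suc m)" by (intro power_increasing) auto
  then show ?case using Suc by simp
qed simp

lemma bin_code_bounds:
  assumes u: "gapped 1 d u" and d: "1 \<le> d"
  shows "bin_code u < 2 ^ Suc (u ! (d - 1))" "2 ^ (u ! (d - 1)) \<le> bin_code u"
proof -
  have len: "length u = d" using u by (simp add: gapped_def)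
  show "bin_code u < 2 ^ Suc (u ! (d - 1))"
    using partial_bin_code_less[OF u, of "d - 1"] d len by (simp add: bin_code_def)
  show "2 ^ (u ! (d - 1)) \<le> bin_code u"
    unfolding bin_code_def len using d by (intro member_le_sum) auto
qed

lemma bin_code_colex:
  assumes u: "gapped 1 d u" and v: "gapped 1 d v"
    and m: "m < d" "u ! m < v ! m" and above: "\<And>j. m < j \<Longrightarrow> j < d \<Longrightarrow> u ! j = v ! j"
  shows "bin_code u < bin_code v"
proof -
  have len: "length u = d" "length v = d" using u v by (auto simp: gapped_def)
  have split: "bin_code w = (\<Sum>j<Suc m. 2 ^ (w ! j)) + (\<Sum>j=Suc m..<d. 2 ^ (w ! j))" if "length w = d" for w
    unfolding bin_code_def that using sum.atLeastLessThan_concat[of 0 "Suc m" d "\<lambda>j. 2 ^ (w ! j) :: nat"] m(1)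
    by (simp add: atLeast0LessThan)
  have "(\<Sum>j<Suc m. 2 ^ (u ! j)) < (2 :: nat) ^ Suc (u ! m)" by (rule partial_bin_code_less[OF u m(1)])
  also have "\<dots> \<le> 2 ^ (v ! m)" using m(2) by (intro power_increasing) auto
  also have "\<dots> \<le> (\<Sum>j<Suc m. 2 ^ (v ! j))" by (intro member_le_sum) auto
  finally have "(\<Sum>j<Suc m. 2 ^ (u ! j)) < (\<Sum>j<Suc m. (2 :: nat) ^ (v ! j))" .
  moreover have "(\<Sum>j=Suc m..<d. 2 ^ (u ! j)) = (\<Sum>j=Suc m..<d. (2 :: nat) ^ (v ! j))"
    using above by (intro sum.cong) auto
  ultimately show ?thesis unfolding split[OF len(1)] split[OF len(2)] by simp
qed

lemma bin_code_mono: "list_all2 (\<le>) u v \<Longrightarrow> bin_code u \<le> bin_code v"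
  by (auto simp: bin_code_def list_all2_conv_all_nth intro!: sum_mono)

lemma bin_code_set_encode: "distinct u \<Longrightarrow> bin_code u = set_encode (set u)"
  by (simp add: bin_code_def set_encode_def sum.distinct_set_conv_list sum_list_sum_nth atLeast0LessThan)

lemma infinite_nat_initial_segment:
  assumes "infinite (R :: nat set)"
  shows "\<exists>r. card {x \<in> R. x < r} = n"
proof (induction n)
  case 0
  show ?case by (rule exI[of _ 0]) simp
next
  case (Suc n)
  then obtain r where r: "card {x \<in> R. x < r} = n" by blast
  have "\<exists>y. y \<in> R \<and> r \<le> y" using assms by (metis infinite_nat_iff_unbounded_le)
  then obtain y where y: "y \<in> R" "r \<le> y" "\<And>x. x < y \<Longrightarrow> \<not> (x \<in> R \<and> r \<le> x)"
    using exists_least_iff[of "\<lambda>y. y \<in> R \<and> r \<le> y"] by blast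
  \<comment> \<open>\<open>y\<close> is the least element of \<open>R\<close> not counted so far.\<close>
  have "{x \<in> R. x < Suc y} = insert y {x \<in> R. x < r}"
    using y by (auto simp: less_Suc_eq not_le dest: y(3))
  then have "card {x \<in> R. x < Suc y} = Suc n" using r y(2) by simp
  then show ?case ..
qed

lemma infinite_dsubsets:
  assumes "1 \<le> d"
  shows "infinite (dsubsets d)"
proof
  assume "finite (dsubsets d)"
  then have "finite (\<Union>(dsubsets d))" by (auto simp: dsubsets_def)
  moreover have "{1..} \<subseteq> \<Union>(dsubsets d)"
  proof
    fix x :: nat assume "x \<in> {1..}"
    then have "{x..<x + d} \<in> dsubsets d" "x \<in> {x..<x + d}" using assms by (auto simp: dsubsets_def)
    then show "x \<in> \<Union>(dsubsets d)" by blast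
  qed
  ultimately show False using infinite_Ici[of "1 :: nat"] finite_subset by blast
qed

text \<open>The sets whose binary code is below a bound form a colex initial segment. The code of a set lies
  between \<open>2 ^ t\<close> and \<open>2 ^ (t + 1)\<close> for its largest element
  \<open>t\<close>, so a set with smaller largest element has a smaller code; this is the last
  property, and it is all that the comparison of Betti numbers uses. Codes are monotone for the Gale
  order, so the segment is a down-set there.\<close>

lemma colex_segment_exists:
  assumes d: "1 \<le> d"
  obtains C where "colex_segment d C" "card C = n" "sqfree_strongly_stable d C"
    "\<And>S T. S \<in> C \<Longrightarrow> T \<in> dsubsets d - C \<Longrightarrow> sorted_list_of_set S ! (d - 1) \<le> sorted_list_of_set T ! (d - 1)"
proof -
  let ?e = "\<lambda>S. bin_code (sorted_list_of_set S)"
  have enc: "?e S = set_encode S" if "S \<in> dsubsets d" for S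
    using that bin_code_set_encode[of "sorted_list_of_set S"] by (simp add: dsubsets_def)
  have inj: "inj_on ?e (dsubsets d)"
  proof (rule inj_onI)
    fix S T assume S: "S \<in> dsubsets d" and T: "T \<in> dsubsets d" and "?e S = ?e T"
    then have "set_encode S = set_encode T" by (simp add: enc)
    then show "S = T" using S T by (simp add: set_encode_eq dsubsets_def)
  qed
  have "infinite (?e ` dsubsets d)" using infinite_dsubsets[OF d] finite_imageD[OF _ inj] by blast
  from infinite_nat_initial_segment[OF this] obtain r where r: "card {x \<in> ?e ` dsubsets d. x < r} = n" by blast
  define C where "C = {S \<in> dsubsets d. ?e S < r}"
  have img: "?e ` C = {x \<in> ?e ` dsubsets d. x < r}" by (auto simp: C_def)
  have injC: "inj_on ?e C" using inj by (rule inj_on_subset) (auto simp: C_def)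
  have "finite (?e ` C)" unfolding img by simp
  then have fin: "finite C" using injC by (rule finite_imageD)
  have card: "card C = n" using card_image[OF injC] r img by simp
  have g: "gapped 1 d (sorted_list_of_set S)" if "S \<in> dsubsets d" for S using dsubsets_sorted_list(1)[OF that] .
  have "T \<in> C" if "S \<in> C" "T \<in> dsubsets d" "colex_less T S" for S T
  proof -
    have S: "S \<in> dsubsets d" "?e S < r" using that(1) by (auto simp: C_def)
    have "card T = d" using that(2) by (simp add: dsubsets_def)
    with that(3) obtain m where m: "m < d" "sorted_list_of_set T ! m < sorted_list_of_set S ! m"
      "\<And>j. m < j \<Longrightarrow> j < d \<Longrightarrow> sorted_list_of_set T ! j = sorted_list_of_set S ! j"
      by (auto simp: colex_less_def Let_def)
    from bin_code_colex[OF g[OF that(2)] g[OF S(1)] m] S that(2) show ?thesis by (simp add: C_def)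
  qed
  then have seg: "colex_segment d C" using fin by (auto simp: colex_segment_def C_def)
  have "T \<in> C" if "S \<in> C" "T \<in> dsubsets d" "gale_le (sorted_list_of_set T) (sorted_list_of_set S)" for S T
    using bin_code_mono[OF that(3)] that by (auto simp: C_def)
  then have st: "sqfree_strongly_stable d C" by (auto simp: sqfree_strongly_stable_def C_def)
  have "sorted_list_of_set S ! (d - 1) \<le> sorted_list_of_set T ! (d - 1)" if "S \<in> C" "T \<in> dsubsets d - C" for S T
  proof (rule ccontr)
    assume "\<not> ?thesis"
    then have "Suc (sorted_list_of_set T ! (d - 1)) \<le> sorted_list_of_set S ! (d - 1)" by simp
    then have "(2 :: nat) ^ Suc (sorted_list_of_set T ! (d - 1)) \<le> 2 ^ (sorted_list_of_set S ! (d - 1))"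
      by (rule power_increasing) simp
    then have "?e T < ?e S"
      using bin_code_bounds(1)[OF g d, of T] bin_code_bounds(2)[OF g d, of S] that by (auto simp: C_def)
    then show False using that by (auto simp: C_def)
  qed
  with seg card st show ?thesis using that by blast
qed

text \<open>After cancelling the common part, any bijection from \<open>C - A\<close> to \<open>A - C\<close>
  does not decrease \<open>f\<close>.\<close>

lemma sum_initial_le:
  fixes f :: "'a \<Rightarrow> nat"
  assumes fin: "finite A" "finite C" and card: "card A = card C"
    and le: "\<And>x y. x \<in> C - A \<Longrightarrow> y \<in> A - C \<Longrightarrow> f x \<le> f y"
  shows "sum f C \<le> sum f A"
proof -
  have "card (C - A) = card (A - C)"
    using card card_Diff_subset_Int[of C A] card_Diff_subset_Int[of A C] fin by (simp add: Int_commute)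
  then obtain h where h: "bij_betw h (C - A) (A - C)"
    using fin by (metis finite_same_card_bij finite_Diff)
  have "sum f (C - A) \<le> sum (f \<circ> h) (C - A)"
    using bij_betw_apply[OF h] by (intro sum_mono) (simp only: o_apply le)
  also have "\<dots> = sum f (A - C)" using sum.reindex_bij_betw[OF h, of f] by simp
  finally show ?thesis
    using sum.Int_Diff[OF fin(2), of f A] sum.Int_Diff[OF fin(1), of f C] by (simp add: Int_commute)
qed


definition shift_list :: "nat \<Rightarrow> nat list \<Rightarrow> nat list" where
  "shift_list c u = map (\<lambda>j. u ! j + (1 - c) * j) [0..<length u]"

lemma gapped_shift_list: "c \<le> 1 \<Longrightarrow> gapped c d u \<Longrightarrow> gapped 1 d (shift_list c u)"
  by (cases c) (auto simp: gapped_def shift_list_def)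

lemma shift_list_inj: "length u = length v \<Longrightarrow> shift_list c u = shift_list c v \<Longrightarrow> u = v"
  by (rule nth_equalityI) (auto simp: shift_list_def atLeast0LessThan dest: bspec)

text \<open>Shifting the lists of \<open>L\<close> to strictly increasing ones puts both families among the
  \<open>d\<close>-subsets and preserves the number of slots, which is a monotone function of the
  last entry.\<close>

lemma sum_choose_colex_le:
  assumes d: "1 \<le> d" and c: "c \<le> 1" and fin: "finite L" and down: "gale_down_set c d L"
    and C: "finite C" "card C = card L" "C \<subseteq> dsubsets d"
    and initial: "\<And>S T. S \<in> C \<Longrightarrow> T \<in> dsubsets d - C \<Longrightarrow> sorted_list_of_set S ! (d - 1) \<le> sorted_list_of_set T ! (d - 1)"
  shows "(\<Sum>S\<in>C. (sorted_list_of_set S ! (d - 1) - 1 - (d - 1)) choose i) \<le>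
     (\<Sum>u\<in>L. (u ! (d - 1) - 1 - c * (d - 1)) choose i)"
proof -
  \<comment> \<open>\<open>?f S\<close> is the summand of \<open>S\<close>, and \<open>?s u\<close> the \<open>d\<close>-subset that corresponds to \<open>u\<close>.\<close>
  let ?f = "\<lambda>S. (sorted_list_of_set S ! (d - 1) - 1 - (d - 1)) choose i"
  let ?s = "\<lambda>u. set (shift_list c u)"
  have L: "gapped c d u" if "u \<in> L" for u using down that by (simp add: gale_down_set_def)
  have g: "gapped 1 d (shift_list c u)" if "u \<in> L" for u using gapped_shift_list[OF c L[OF that]] .
  have inj: "inj_on ?s L"
  proof (rule inj_onI)
    fix u v assume uv: "u \<in> L" "v \<in> L" "?s u = ?s v"
    have "shift_list c u = shift_list c v"
      using arg_cong[OF uv(3), of sorted_list_of_set]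
      unfolding gapped_one_set(2)[OF g[OF uv(1)]] gapped_one_set(2)[OF g[OF uv(2)]] .
    moreover have "length u = length v" using L[OF uv(1)] L[OF uv(2)] by (simp add: gapped_def)
    ultimately show "u = v" by (rule shift_list_inj[rotated])
  qed
  have "sum ?f C \<le> sum ?f (?s ` L)"
  proof (rule sum_initial_le)
    show "finite (?s ` L)" using fin by simp
    show "card (?s ` L) = card C" using card_image[OF inj] C(2) by simp
    fix S T assume "S \<in> C - ?s ` L" "T \<in> ?s ` L - C"
    then show "?f S \<le> ?f T"
      using initial[of S T] gapped_one_set(1)[OF g] by (intro binomial_right_mono diff_le_mono) auto
  qed (rule C(1))
  also have "\<dots> = (\<Sum>u\<in>L. ?f (?s u))" by (simp add: sum.reindex[OF inj])
  also have "\<dots> = (\<Sum>u\<in>L. (u ! (d - 1) - 1 - c * (d - 1)) choose i)"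
  proof (rule sum.cong[OF refl])
    fix u assume u: "u \<in> L"
    have "shift_list c u ! (d - 1) = u ! (d - 1) + (1 - c) * (d - 1)"
      using L[OF u] d by (auto simp: shift_list_def gapped_def)
    then have "shift_list c u ! (d - 1) - 1 - (d - 1) = u ! (d - 1) - 1 - c * (d - 1)"
      using c by (cases c) auto
    then show "?f (?s u) = (u ! (d - 1) - 1 - c * (d - 1)) choose i"
      unfolding gapped_one_set(2)[OF g[OF u]] by simp
  qed
  finally show ?thesis .
qed

lemma mon_ideal_gen_ideal: "mon_ideal V L = gen_ideal (\<lambda>j i. i) V L"
  by (simp add: mon_ideal_def gen_ideal_def)

lemma F_ideal_gen_ideal: "F_ideal V L = gen_ideal (\<lambda>j i. (Suc j, i)) V L"
  by (simp add: F_ideal_def gen_ideal_def)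

lemma column_faithful_mon: "column_faithful (\<lambda>j i. i)"
  by (simp add: column_faithful_def)

lemma column_faithful_F: "column_faithful (\<lambda>j i. (Suc j, i))"
  by (simp add: column_faithful_def)

lemma sqfree_stable_lists:
  assumes "sqfree_strongly_stable d K"
  shows "gale_down_set 1 d (sorted_list_of_set ` K)"
proof -
  have K: "K \<subseteq> dsubsets d"
    and closed: "\<And>S T. S \<in> K \<Longrightarrow> T \<in> dsubsets d \<Longrightarrow> gale_le (sorted_list_of_set T) (sorted_list_of_set S) \<Longrightarrow> T \<in> K"
    using assms by (auto simp: sqfree_strongly_stable_def)
  have "gapped 1 d u" if "u \<in> sorted_list_of_set ` K" for u
    using that K dsubsets_sorted_list(1) by auto
  moreover have "v \<in> sorted_list_of_set ` K" if "u \<in> sorted_list_of_set ` K" "gapped 1 d v" "gale_le v u" for u v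
    using that closed[of _ "set v"] gapped_one_set[OF that(2)] by (metis image_iff)
  ultimately show ?thesis unfolding gale_down_set_def by blast
qed

lemma stable_lists:
  assumes "strongly_stable d M"
  shows "gale_down_set 0 d (sorted_list_of_multiset ` M)"
proof -
  have M: "M \<subseteq> dmultisets d"
    and closed: "\<And>A B. A \<in> M \<Longrightarrow> B \<in> dmultisets d \<Longrightarrow> gale_le (sorted_list_of_multiset B) (sorted_list_of_multiset A) \<Longrightarrow> B \<in> M"
    using assms by (auto simp: strongly_stable_def)
  have "gapped 0 d u" if "u \<in> sorted_list_of_multiset ` M" for u
    using that M dmultisets_sorted_list(1) by auto
  moreover have "v \<in> sorted_list_of_multiset ` M" if "u \<in> sorted_list_of_multiset ` M" "gapped 0 d v" "gale_le v u" for u v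
    using that closed[of _ "mset v"] gapped_zero_mset[OF that(2)] by (metis image_iff)
  ultimately show ?thesis unfolding gale_down_set_def by blast
qed

text \<open>The colex segment with as many members as \<open>L\<close> is a Gale down-set for \<open>c =
  1\<close>, so the same formula computes the Betti numbers on both sides.\<close>

theorem gen_ideal_obeys_colex_lower_bound:
  assumes \<phi>: "column_faithful \<phi>" and d: "1 \<le> d" and c: "c \<le> 1" and fin: "finite L"
    and down: "gale_down_set c d L"
    and vars: "\<forall>u\<in>L. \<forall>j<d. \<phi> j ` {1..u ! j} \<subseteq> V"
  shows "obeys_colex_lower_bound d V (gen_ideal \<phi> V L :: ('v, 'k::field) mpoly set)"
proof -
  obtain C where C: "colex_segment d C" "card C = card L" "sqfree_strongly_stable d C"
    "\<And>S T. S \<in> C \<Longrightarrow> T \<in> dsubsets d - C \<Longrightarrow> sorted_list_of_set S ! (d - 1) \<le> sorted_list_of_set T ! (d - 1)"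
    using colex_segment_exists[OF d] by metis
  have Cd: "finite C" "C \<subseteq> dsubsets d" using C(1) by (auto simp: colex_segment_def)
  have inj: "inj_on sorted_list_of_set C"
    using Cd(2) dsubsets_sorted_list(2) by (metis inj_on_def subsetD)
  have "card (min_gens J) = card (min_gens (gen_ideal \<phi> V L :: ('v, 'k) mpoly set)) \<and>
      (\<forall>i. betti {1..N} J i \<le> betti V (gen_ideal \<phi> V L :: ('v, 'k) mpoly set) i)"
    if N: "\<Union>C \<subseteq> {1..N}" and J: "J = mon_ideal {1..N} (sorted_list_of_set ` C)"
    for N and J :: "(nat, 'k) mpoly set"
  proof -
    have "u ! j \<le> N" if u: "u \<in> sorted_list_of_set ` C" and j: "j < d" for u j
    proof -
      from u obtain S where S: "S \<in> C" "u = sorted_list_of_set S" by blast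
      then have "S \<in> dsubsets d" using Cd(2) by blast
      from dsubsets_sorted_list[OF this] have "length u = d" "set u = S"
        unfolding S(2) gapped_def by blast+
      then have "u ! j \<in> S" using j nth_mem[of j u] by simp
      then show ?thesis using N S(1) by fastforce
    qed
    then have vJ: "\<forall>u\<in>sorted_list_of_set ` C. \<forall>j<d. (\<lambda>i. i) ` {1..u ! j} \<subseteq> {1..N}" by force
    note invJ = gen_ideal_invariants[OF column_faithful_mon d finite_imageI[OF Cd(1)]
        sqfree_stable_lists[OF C(3)] vJ, where 'k = 'k]
    note invI = gen_ideal_invariants[OF \<phi> d fin down vars, where 'k = 'k]
    have "betti {1..N} J i = (\<Sum>S\<in>C. (sorted_list_of_set S ! (d - 1) - 1 - (d - 1)) choose i)" for i
      unfolding J mon_ideal_gen_ideal invJ(2) by (simp add: sum.reindex[OF inj])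
    then have "betti {1..N} J i \<le> betti V (gen_ideal \<phi> V L :: ('v, 'k) mpoly set) i" for i
      unfolding invI(2) using sum_choose_colex_le[OF d c fin down Cd(1) C(2) Cd(2) C(4)] by simp
    moreover have "card (min_gens J) = card (min_gens (gen_ideal \<phi> V L :: ('v, 'k) mpoly set))"
      unfolding J mon_ideal_gen_ideal invJ(1) invI(1) using card_image[OF inj] C(2) by simp
    ultimately show ?thesis by blast
  qed
  then show ?thesis unfolding obeys_colex_lower_bound_def Let_def using C(1) by blast
qed

theorem proposition4p1:
  fixes d :: nat
  assumes "d \<ge> 2"
  shows "(\<forall>K N. finite K \<and> sqfree_strongly_stable d K \<and> \<Union>K \<subseteq> {1..N} \<longrightarrow>
            obeys_colex_lower_bound d {1..N}
              (mon_ideal {1..N} (sorted_list_of_set ` K) :: (nat, 'k::field) mpoly set) \<and>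
            obeys_colex_lower_bound d ({1..d} \<times> {1..N})
              (F_ideal ({1..d} \<times> {1..N}) (sorted_list_of_set ` K) :: (nat \<times> nat, 'k) mpoly set))
       \<and> (\<forall>M N. finite M \<and> strongly_stable d M \<and> (\<Union>A\<in>M. set_mset A) \<subseteq> {1..N} \<longrightarrow>
            obeys_colex_lower_bound d {1..N}
              (mon_ideal {1..N} (sorted_list_of_multiset ` M) :: (nat, 'k) mpoly set) \<and>
            obeys_colex_lower_bound d ({1..d} \<times> {1..N})
              (F_ideal ({1..d} \<times> {1..N}) (sorted_list_of_multiset ` M) :: (nat \<times> nat, 'k) mpoly set))"
proof -
  have d: "1 \<le> d" using assms by simp
  have both: "obeys_colex_lower_bound d {1..N} (mon_ideal {1..N} L :: (nat, 'k) mpoly set) \<and>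
      obeys_colex_lower_bound d ({1..d} \<times> {1..N}) (F_ideal ({1..d} \<times> {1..N}) L :: (nat \<times> nat, 'k) mpoly set)"
    if c: "c \<le> 1" and L: "finite L" "gale_down_set c d L" and N: "\<And>u. u \<in> L \<Longrightarrow> set u \<subseteq> {1..N}" for c L N
  proof -
    have le: "u ! j \<le> N" if "u \<in> L" "j < d" for u j
    proof -
      have "length u = d" using L(2) that(1) by (simp add: gale_down_set_def gapped_def)
      then have "u ! j \<in> set u" using that(2) by simp
      then show ?thesis using N[OF that(1)] by auto
    qed
    have "\<forall>u\<in>L. \<forall>j<d. (\<lambda>i. i) ` {1..u ! j} \<subseteq> {1..N}" using le by force
    note mon = gen_ideal_obeys_colex_lower_bound[OF column_faithful_mon d c L this]
    have "\<forall>u\<in>L. \<forall>j<d. (\<lambda>i. (Suc j, i)) ` {1..u ! j} \<subseteq> {1..d} \<times> {1..N}" using le by force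
    note F = gen_ideal_obeys_colex_lower_bound[OF column_faithful_F d c L this]
    show ?thesis unfolding mon_ideal_gen_ideal F_ideal_gen_ideal by (intro conjI mon F)
  qed
  show ?thesis
  proof (intro conjI[OF allI[OF allI] allI[OF allI]] impI)
    fix K N assume K: "finite K \<and> sqfree_strongly_stable d K \<and> \<Union>K \<subseteq> {1..N}"
    then have "sqfree_strongly_stable d K" by simp
    note stable = sqfree_stable_lists[OF this]
    have "set u \<subseteq> {1..N}" if "u \<in> sorted_list_of_set ` K" for u
    proof -
      from that obtain S where S: "S \<in> K" "u = sorted_list_of_set S" by blast
      then have "S \<in> dsubsets d" using K by (auto simp: sqfree_strongly_stable_def)
      then have "set u = S" unfolding S(2) by (rule dsubsets_sorted_list(2))
      then show ?thesis using K S(1) by blast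
    qed
    then show "obeys_colex_lower_bound d {1..N}
          (mon_ideal {1..N} (sorted_list_of_set ` K) :: (nat, 'k) mpoly set) \<and>
        obeys_colex_lower_bound d ({1..d} \<times> {1..N})
          (F_ideal ({1..d} \<times> {1..N}) (sorted_list_of_set ` K) :: (nat \<times> nat, 'k) mpoly set)"
      using K by (intro both[OF order_refl _ stable]) auto
  next
    fix M N assume M: "finite M \<and> strongly_stable d M \<and> (\<Union>A\<in>M. set_mset A) \<subseteq> {1..N}"
    then have "strongly_stable d M" by simp
    note stable = stable_lists[OF this]
    have "set u \<subseteq> {1..N}" if "u \<in> sorted_list_of_multiset ` M" for u
    proof -
      from that obtain A where A: "A \<in> M" "u = sorted_list_of_multiset A" by blast
      then have "set u = set_mset A" by (simp add: set_sorted_list_of_multiset)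
      then show ?thesis using M A(1) by blast
    qed
    then show "obeys_colex_lower_bound d {1..N}
          (mon_ideal {1..N} (sorted_list_of_multiset ` M) :: (nat, 'k) mpoly set) \<and>
        obeys_colex_lower_bound d ({1..d} \<times> {1..N})
          (F_ideal ({1..d} \<times> {1..N}) (sorted_list_of_multiset ` M) :: (nat \<times> nat, 'k) mpoly set)"
      using M by (intro both[OF zero_le_one _ stable]) auto
  qed
qed

end
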